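(* For all $a>0$, the strong limits $$W_\pm(H_a,H_1)=\operatorname{s-lim}_{t\to\pm\infty}e^{iH_at}e^{-iH_1t}$$ exist and $$W_\pm(H_a,H_1)=F_a^*\,\Sigma_\pm(a)\,F_1,$$ where $\Sigma_\pm(a)$ is the unitary operator of multiplication in $L^2(-1,1)$ by the function $$\sigma_\pm(\lambda;a)=\frac{a^2+2(1-a^2)\lambda^2\pm2i(a^2-1)\lambda\sqrt{1-\lambda^2}}{\sqrt{a^4-4(a^2-1)\lambda^2}}.$$
   Context: $\mathbb{Z}_+=\{0,1,2,\dots\}$ and $(e_n)_{n\ge0}$ is the canonical orthonormal basis of $\ell^2(\mathbb{Z}_+)$. For $a>0$, $H_a$ is the bounded self-adjoint operator on $\ell^2(\mathbb{Z}_+)$ given by $$H_ae_0=\tfrac a2e_1,\qquad H_ae_1=\tfrac12(ae_0+e_2),\qquad H_ae_n=\tfrac12(e_{n-1}+e_{n+1})\ \ (n\ge2).$$ The polynomials $\mathrm{Ch}_n(\lambda;a)$ are defined by $\mathrm{Ch}_0=1$, $\mathrm{Ch}_1(\lambda;a)=2a^{-1}\lambda$, $a\,\mathrm{Ch}_0+\mathrm{Ch}_2=2\lambda\,\mathrm{Ch}_1$, and $\mathrm{Ch}_{n-1}+\mathrm{Ch}_{n+1}=2\lambda\,\mathrm{Ch}_n$ for $n\ge2$. The bounded operator $F_a:\ell^2(\mathbb{Z}_+)\to L^2(-1,1)$ (Lebesgue measure) is defined by $$(F_ae_n)(\lambda)=\psi_n(\lambda;a)=\sqrt{\frac2\pi}\,\frac{a\sqrt[4]{1-\lambda^2}}{\sqrt{a^4-4(a^2-1)\lambda^2}}\,\mathrm{Ch}_n(\lambda;a),\qquad\lambda\in(-1,1),$$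 and its adjoint is $(F_a^*g)_n=\int_{-1}^1\psi_n(\lambda;a)g(\lambda)\,d\lambda$. It satisfies $F_aF_a^*=I$ and $F_a^*F_a=E_a(-1,1)$, the spectral projection of $H_a$ for the interval $(-1,1)$. *)

theory Defs
  imports "HOL-Analysis.Analysis"
begin

section \<open>Complex inner product spaces and operators\<close>

text \<open>The inner product is conjugate linear in the first argument. The underlying real inner product
  is its real part, so that the norm is the one derived from \<^term>\<open>cinner x x\<close>.\<close>

class complex_inner = real_inner +
  fixes scaleC :: "complex \<Rightarrow> 'a \<Rightarrow> 'a" (infixr "*\<^sub>C" 75)
    and cinner :: "'a \<Rightarrow> 'a \<Rightarrow> complex"
  assumes scaleC_add_right: "c *\<^sub>C (x + y) = c *\<^sub>C x + c *\<^sub>C y"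
    and scaleC_add_left: "(c + d) *\<^sub>C x = c *\<^sub>C x + d *\<^sub>C x"
    and scaleC_scaleC: "c *\<^sub>C (d *\<^sub>C x) = (c * d) *\<^sub>C x"
    and scaleR_scaleC: "r *\<^sub>R x = complex_of_real r *\<^sub>C x"
    and cinner_commute: "cinner x y = cnj (cinner y x)"
    and cinner_add_right: "cinner x (y + z) = cinner x y + cinner x z"
    and cinner_scaleC_right: "cinner x (c *\<^sub>C y) = c * cinner x y"
    and inner_cinner: "inner x y = Re (cinner x y)"

definition bounded_clinear :: "('a::complex_inner \<Rightarrow> 'b::complex_inner) \<Rightarrow> bool" where
  "bounded_clinear T \<longleftrightarrow> bounded_linear T \<and> (\<forall>c x. T (c *\<^sub>C x) = c *\<^sub>C T x)"

definition cadjoint :: "('a::complex_inner \<Rightarrow> 'b::complex_inner) \<Rightarrow> 'b \<Rightarrow> 'a" where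
  "cadjoint T = (THE S. \<forall>x y. cinner (T x) y = cinner x (S y))"

definition unitary :: "('a::complex_inner \<Rightarrow> 'b::complex_inner) \<Rightarrow> bool" where
  "unitary T \<longleftrightarrow> bounded_clinear T \<and> surj T \<and> (\<forall>x y. cinner (T x) (T y) = cinner x y)"

definition op_exp :: "('a::complex_inner \<Rightarrow> 'a) \<Rightarrow> 'a \<Rightarrow> 'a" where
  "op_exp A f = (\<Sum>k. (1 / fact k) *\<^sub>R (A ^^ k) f)"

definition has_strong_limit ::
    "('t \<Rightarrow> 'a::complex_inner \<Rightarrow> 'b::complex_inner) \<Rightarrow> ('a \<Rightarrow> 'b) \<Rightarrow> 't filter \<Rightarrow> bool" where
  "has_strong_limit U W F \<longleftrightarrow> bounded_clinear W \<and> (\<forall>f. ((\<lambda>t. U t f) \<longlongrightarrow> W f) F)"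

definition strong_limit ::
    "'t filter \<Rightarrow> ('t \<Rightarrow> 'a::complex_inner \<Rightarrow> 'b::complex_inner) \<Rightarrow> 'a \<Rightarrow> 'b" where
  "strong_limit F U = (THE W. has_strong_limit U W F)"

text \<open>The family \<open>exp (i A t) exp (- i B t)\<close>, whose strong limits as \<open>t\<close> tends to plus or minus
  infinity are the wave operators of the pair \<open>A\<close>, \<open>B\<close>.\<close>

definition wave_family :: "('a::complex_inner \<Rightarrow> 'a) \<Rightarrow> ('a \<Rightarrow> 'a) \<Rightarrow> real \<Rightarrow> 'a \<Rightarrow> 'a" where
  "wave_family A B t =
     op_exp (\<lambda>f. (\<i> * complex_of_real t) *\<^sub>C A f) \<circ> op_exp (\<lambda>f. (- \<i> * complex_of_real t) *\<^sub>C B f)"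

definition wave_plus :: "('a::complex_inner \<Rightarrow> 'a) \<Rightarrow> ('a \<Rightarrow> 'a) \<Rightarrow> 'a \<Rightarrow> 'a" where
  "wave_plus A B = strong_limit at_top (wave_family A B)"

definition wave_minus :: "('a::complex_inner \<Rightarrow> 'a) \<Rightarrow> ('a \<Rightarrow> 'a) \<Rightarrow> 'a \<Rightarrow> 'a" where
  "wave_minus A B = strong_limit at_bot (wave_family A B)"


section \<open>Square summable sequences\<close>

lemma cmod_mult_le_squares: "cmod (cnj z * w) \<le> (cmod z)\<^sup>2 + (cmod w)\<^sup>2"
proof -
  have "2 * (cmod z * cmod w) \<le> (cmod z)\<^sup>2 + (cmod w)\<^sup>2"
    using sum_squares_bound[of "cmod z" "cmod w"] by simp
  moreover have "0 \<le> cmod z * cmod w" by simp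
  ultimately show ?thesis unfolding norm_mult complex_mod_cnj by linarith
qed

lemma cmod_add_square_le: "(cmod (z + w))\<^sup>2 \<le> 2 * (cmod z)\<^sup>2 + 2 * (cmod w)\<^sup>2"
proof -
  have "(cmod (z + w))\<^sup>2 \<le> (cmod z + cmod w)\<^sup>2"
    by (intro power_mono norm_triangle_ineq) auto
  also have "\<dots> \<le> 2 * (cmod z)\<^sup>2 + 2 * (cmod w)\<^sup>2"
    using sum_squares_bound[of "cmod z" "cmod w"] by (simp add: power2_sum)
  finally show ?thesis .
qed

lemma cnj_mult_self: "cnj z * z = complex_of_real ((cmod z)\<^sup>2)"
  by (metis complex_norm_square mult.commute of_real_power)

typedef ell2 = "{f :: nat \<Rightarrow> complex. summable (\<lambda>n. (cmod (f n))\<^sup>2)}"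
  morphisms ell2_nth Abs_ell2
  by (rule exI[of _ "\<lambda>_. 0"]) simp

setup_lifting type_definition_ell2

lemma summable_ell2_cinner:
  assumes "summable (\<lambda>n. (cmod (f n))\<^sup>2)" "summable (\<lambda>n. (cmod (g n))\<^sup>2)"
  shows "summable (\<lambda>n. cnj (f n) * g n)"
  by (rule summable_comparison_test'[OF summable_add[OF assms], of 0])
     (simp only: cmod_mult_le_squares)

lemma summable_ell2_scaleC:
  assumes "summable (\<lambda>n. (cmod (f n))\<^sup>2)"
  shows "summable (\<lambda>n. (cmod (c * f n))\<^sup>2)"
  using summable_mult[OF assms, of "(cmod c)\<^sup>2"] by (simp add: norm_mult power_mult_distrib)

instantiation ell2 :: complex_inner
begin

lift_definition zero_ell2 :: ell2 is "\<lambda>_. 0" by simp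

lift_definition plus_ell2 :: "ell2 \<Rightarrow> ell2 \<Rightarrow> ell2" is "\<lambda>f g n. f n + g n"
proof -
  fix f g :: "nat \<Rightarrow> complex"
  assume "summable (\<lambda>n. (cmod (f n))\<^sup>2)" "summable (\<lambda>n. (cmod (g n))\<^sup>2)"
  then have "summable (\<lambda>n. 2 * (cmod (f n))\<^sup>2 + 2 * (cmod (g n))\<^sup>2)"
    by (intro summable_add summable_mult)
  then show "summable (\<lambda>n. (cmod (f n + g n))\<^sup>2)"
    by (rule summable_comparison_test'[of _ 0]) (simp add: cmod_add_square_le)
qed

lift_definition scaleC_ell2 :: "complex \<Rightarrow> ell2 \<Rightarrow> ell2" is "\<lambda>c f n. c * f n"
  by (rule summable_ell2_scaleC)

lift_definition scaleR_ell2 :: "real \<Rightarrow> ell2 \<Rightarrow> ell2" is "\<lambda>r f n. complex_of_real r * f n"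
  by (rule summable_ell2_scaleC)

lift_definition uminus_ell2 :: "ell2 \<Rightarrow> ell2" is "\<lambda>f n. - f n" by simp

definition minus_ell2 :: "ell2 \<Rightarrow> ell2 \<Rightarrow> ell2" where "minus_ell2 f g = f + - g"

lift_definition cinner_ell2 :: "ell2 \<Rightarrow> ell2 \<Rightarrow> complex" is "\<lambda>f g. \<Sum>n. cnj (f n) * g n" .

definition inner_ell2 :: "ell2 \<Rightarrow> ell2 \<Rightarrow> real" where "inner_ell2 f g = Re (cinner f g)"

definition norm_ell2 :: "ell2 \<Rightarrow> real" where "norm_ell2 f = sqrt (inner f f)"

definition sgn_ell2 :: "ell2 \<Rightarrow> ell2" where "sgn_ell2 f = inverse (norm f) *\<^sub>R f"

definition dist_ell2 :: "ell2 \<Rightarrow> ell2 \<Rightarrow> real" where "dist_ell2 f g = norm (f - g)"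

definition uniformity_ell2 :: "(ell2 \<times> ell2) filter" where
  "uniformity_ell2 = (INF e\<in>{0 <..}. principal {(x, y). dist x y < e})"

definition open_ell2 :: "ell2 set \<Rightarrow> bool" where
  "open_ell2 U = (\<forall>x\<in>U. eventually (\<lambda>(x', y). x' = x \<longrightarrow> y \<in> U) uniformity)"

instance
proof
  fix f g h :: ell2 and r s :: real and c d :: complex and U :: "ell2 set"
  show "f + g + h = f + (g + h)" by transfer (simp add: algebra_simps)
  show "f + g = g + f" by transfer (simp add: algebra_simps)
  show "0 + f = f" by transfer simp
  show "- f + f = 0" by transfer simp
  show "f - g = f + - g" by (simp add: minus_ell2_def)
  show "r *\<^sub>R (f + g) = r *\<^sub>R f + r *\<^sub>R g" by transfer (simp add: algebra_simps)
  show "(r + s) *\<^sub>R f = r *\<^sub>R f + s *\<^sub>R f" by transfer (simp add: algebra_simps)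
  show "r *\<^sub>R s *\<^sub>R f = (r * s) *\<^sub>R f" by transfer (simp add: algebra_simps)
  show "1 *\<^sub>R f = f" by transfer simp
  show "sgn f = inverse (norm f) *\<^sub>R f" by (rule sgn_ell2_def)
  show "dist f g = norm (f - g)" by (rule dist_ell2_def)
  show "uniformity = (INF e\<in>{0 <..}. principal {(x, y :: ell2). dist x y < e})"
    by (rule uniformity_ell2_def)
  show "open U = (\<forall>x\<in>U. eventually (\<lambda>(x', y). x' = x \<longrightarrow> y \<in> U) uniformity)"
    by (rule open_ell2_def)
  show "norm f = sqrt (inner f f)" by (rule norm_ell2_def)
  show "c *\<^sub>C (f + g) = c *\<^sub>C f + c *\<^sub>C g" by transfer (simp add: algebra_simps)
  show "(c + d) *\<^sub>C f = c *\<^sub>C f + d *\<^sub>C f" by transfer (simp add: algebra_simps)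
  show "c *\<^sub>C d *\<^sub>C f = (c * d) *\<^sub>C f" by transfer (simp add: algebra_simps)
  show "r *\<^sub>R f = complex_of_real r *\<^sub>C f" by transfer simp
  show comm: "cinner f g = cnj (cinner g f)" for f g :: ell2
  proof transfer
    fix f g :: "nat \<Rightarrow> complex"
    assume "summable (\<lambda>n. (cmod (f n))\<^sup>2)" "summable (\<lambda>n. (cmod (g n))\<^sup>2)"
    then have "(\<lambda>n. cnj (g n) * f n) sums (\<Sum>n. cnj (g n) * f n)"
      by (intro summable_sums summable_ell2_cinner)
    then have "(\<lambda>n. cnj (cnj (g n) * f n)) sums cnj (\<Sum>n. cnj (g n) * f n)"
      by (subst sums_cnj)
    then show "(\<Sum>n. cnj (f n) * g n) = cnj (\<Sum>n. cnj (g n) * f n)"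
      by (simp add: sums_iff mult.commute)
  qed
  show add: "cinner f (g + h) = cinner f g + cinner f h" for f g h :: ell2
    by transfer (simp add: distrib_left suminf_add summable_ell2_cinner)
  show scale: "cinner f (c *\<^sub>C g) = c * cinner f g" for f g :: ell2 and c
  proof transfer
    fix f g :: "nat \<Rightarrow> complex" and c
    assume "summable (\<lambda>n. (cmod (f n))\<^sup>2)" "summable (\<lambda>n. (cmod (g n))\<^sup>2)"
    from suminf_mult[OF summable_ell2_cinner[OF this], of c]
    show "(\<Sum>n. cnj (f n) * (c * g n)) = c * (\<Sum>n. cnj (f n) * g n)"
      by (simp add: mult.left_commute)
  qed
  show inn: "inner f g = Re (cinner f g)" for f g :: ell2 by (rule inner_ell2_def)
  show sym: "inner f g = inner g f" for f g :: ell2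
    unfolding inn by (subst comm) simp
  have "inner h (f + g) = inner h f + inner h g" by (simp add: inn add)
  then show "inner (f + g) h = inner f h + inner g h" by (simp add: sym)
  have "r *\<^sub>R f = complex_of_real r *\<^sub>C f" by transfer simp
  then have "inner g (r *\<^sub>R f) = r * inner g f" by (simp add: inn scale)
  then show "inner (r *\<^sub>R f) g = r * inner f g" by (simp add: sym)
  have self: "inner f f = (\<Sum>n. (cmod (ell2_nth f n))\<^sup>2)"
  proof -
    have "(\<lambda>n. (cmod (ell2_nth f n))\<^sup>2) sums (\<Sum>n. (cmod (ell2_nth f n))\<^sup>2)"
      using ell2_nth[of f] by (simp add: summable_sums)
    then have "(\<lambda>n. complex_of_real ((cmod (ell2_nth f n))\<^sup>2)) sums
        complex_of_real (\<Sum>n. (cmod (ell2_nth f n))\<^sup>2)"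
      by (subst sums_of_real_iff)
    then show ?thesis
      by (simp only: inn cinner_ell2.rep_eq cnj_mult_self sums_iff Re_complex_of_real)
  qed
  show "0 \<le> inner f f" unfolding self by (rule suminf_nonneg) (use ell2_nth[of f] in auto)
  show "(inner f f = 0) = (f = 0)"
  proof -
    have "(inner f f = 0) = (\<forall>n. (cmod (ell2_nth f n))\<^sup>2 = 0)"
      unfolding self by (rule suminf_eq_zero_iff) (use ell2_nth[of f] in auto)
    also have "\<dots> = (f = 0)" by transfer auto
    finally show ?thesis .
  qed
qed

end

lift_definition ell2_basis :: "nat \<Rightarrow> ell2" is "\<lambda>n k. if k = n then 1 else 0"
proof -
  fix n :: nat
  show "summable (\<lambda>k. (cmod (if k = n then 1 else 0))\<^sup>2)"
    by (rule summable_finite[of "{n}"]) auto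
qed

text \<open>The bounded operator with prescribed values on the canonical basis. It is unique if it exists.\<close>

definition ell2_op :: "(nat \<Rightarrow> 'a::complex_inner) \<Rightarrow> ell2 \<Rightarrow> 'a" where
  "ell2_op v = (THE T. bounded_clinear T \<and> (\<forall>n. T (ell2_basis n) = v n))"


section \<open>The space of square integrable functions on the interval\<close>

abbreviation leb :: "real measure" where "leb \<equiv> lebesgue_on {-1<..<1}"

definition square_integrable :: "(real \<Rightarrow> complex) \<Rightarrow> bool" where
  "square_integrable f \<longleftrightarrow> f \<in> borel_measurable leb \<and> integrable leb (\<lambda>x. (cmod (f x))\<^sup>2)"

lemma square_integrable_zero: "square_integrable (\<lambda>_. 0)"
  by (simp add: square_integrable_def)

lemma square_integrable_add:
  assumes "square_integrable f" "square_integrable g"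
  shows "square_integrable (\<lambda>x. f x + g x)"
proof -
  have [measurable]: "f \<in> borel_measurable leb" "g \<in> borel_measurable leb"
    using assms by (auto simp: square_integrable_def)
  have "integrable leb (\<lambda>x. (cmod (f x + g x))\<^sup>2)"
    by (rule Bochner_Integration.integrable_bound
          [where f = "\<lambda>x. 2 * (cmod (f x))\<^sup>2 + 2 * (cmod (g x))\<^sup>2"])
       (use assms in \<open>auto simp: square_integrable_def cmod_add_square_le\<close>)
  then show ?thesis by (simp add: square_integrable_def)
qed

lemma square_integrable_scaleC:
  assumes "square_integrable f"
  shows "square_integrable (\<lambda>x. c * f x)"
  using assms by (auto simp: square_integrable_def norm_mult power_mult_distrib)

lemma square_integrable_uminus: "square_integrable f \<Longrightarrow> square_integrable (\<lambda>x. - f x)"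
  using square_integrable_scaleC[of f "-1"] by simp

lemma integrable_cinner:
  assumes "square_integrable f" "square_integrable g"
  shows "integrable leb (\<lambda>x. cnj (f x) * g x)"
proof -
  have [measurable]: "f \<in> borel_measurable leb" "g \<in> borel_measurable leb"
    using assms by (auto simp: square_integrable_def)
  have "(\<lambda>x. cnj (f x)) \<in> borel_measurable leb"
    by (rule borel_measurable_continuous_on[OF continuous_on_cnj[OF continuous_on_id]]) simp
  then have [measurable]: "(\<lambda>x. cnj (f x) * g x) \<in> borel_measurable leb" by simp
  show ?thesis
    by (rule Bochner_Integration.integrable_bound
          [where f = "\<lambda>x. (cmod (f x))\<^sup>2 + (cmod (g x))\<^sup>2"])
       (use assms in \<open>auto simp only: square_integrable_def intro!: AE_I2 order.trans[OF cmod_mult_le_squares]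
          Bochner_Integration.integrable_add\<close>, auto)
qed

definition L2_rel :: "(real \<Rightarrow> complex) \<Rightarrow> (real \<Rightarrow> complex) \<Rightarrow> bool" where
  "L2_rel f g \<longleftrightarrow> square_integrable f \<and> square_integrable g \<and> (AE x in leb. f x = g x)"

quotient_type L2 = "real \<Rightarrow> complex" / partial: L2_rel
  morphisms rep_L2 abs_L2
proof (rule part_equivpI)
  show "\<exists>f. L2_rel f f"
    by (rule exI[of _ "\<lambda>_. 0"]) (simp add: L2_rel_def square_integrable_zero)
  show "symp L2_rel"
    by (rule sympI) (auto simp: L2_rel_def elim: eventually_mono)
  show "transp L2_rel"
    by (rule transpI) (auto simp: L2_rel_def elim: eventually_elim2)
qed

instantiation L2 :: complex_inner
begin

lift_definition zero_L2 :: L2 is "\<lambda>_. 0" by (simp add: L2_rel_def square_integrable_zero)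

lift_definition plus_L2 :: "L2 \<Rightarrow> L2 \<Rightarrow> L2" is "\<lambda>f g x. f x + g x"
  by (auto simp: L2_rel_def square_integrable_add elim: eventually_elim2)

lift_definition scaleC_L2 :: "complex \<Rightarrow> L2 \<Rightarrow> L2" is "\<lambda>c f x. c * f x"
  by (auto simp: L2_rel_def square_integrable_scaleC elim: eventually_mono)

lift_definition scaleR_L2 :: "real \<Rightarrow> L2 \<Rightarrow> L2" is "\<lambda>r f x. complex_of_real r * f x"
  by (auto simp: L2_rel_def square_integrable_scaleC elim: eventually_mono)

lift_definition uminus_L2 :: "L2 \<Rightarrow> L2" is "\<lambda>f x. - f x"
  by (auto simp: L2_rel_def square_integrable_uminus elim: eventually_mono)

definition minus_L2 :: "L2 \<Rightarrow> L2 \<Rightarrow> L2" where "minus_L2 f g = f + - g"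

lift_definition cinner_L2 :: "L2 \<Rightarrow> L2 \<Rightarrow> complex" is "\<lambda>f g. \<integral>x. cnj (f x) * g x \<partial>leb"
proof -
  fix f f' g g' assume "L2_rel f f'" "L2_rel g g'"
  then have "AE x in leb. cnj (f x) * g x = cnj (f' x) * g' x"
      and "integrable leb (\<lambda>x. cnj (f x) * g x)" "integrable leb (\<lambda>x. cnj (f' x) * g' x)"
    by (auto simp: L2_rel_def integrable_cinner elim: eventually_elim2)
  then show "(\<integral>x. cnj (f x) * g x \<partial>leb) = (\<integral>x. cnj (f' x) * g' x \<partial>leb)"
    by (intro integral_cong_AE) auto
qed

definition inner_L2 :: "L2 \<Rightarrow> L2 \<Rightarrow> real" where "inner_L2 f g = Re (cinner f g)"

definition norm_L2 :: "L2 \<Rightarrow> real" where "norm_L2 f = sqrt (inner f f)"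

definition sgn_L2 :: "L2 \<Rightarrow> L2" where "sgn_L2 f = inverse (norm f) *\<^sub>R f"

definition dist_L2 :: "L2 \<Rightarrow> L2 \<Rightarrow> real" where "dist_L2 f g = norm (f - g)"

definition uniformity_L2 :: "(L2 \<times> L2) filter" where
  "uniformity_L2 = (INF e\<in>{0 <..}. principal {(x, y). dist x y < e})"

definition open_L2 :: "L2 set \<Rightarrow> bool" where
  "open_L2 U = (\<forall>x\<in>U. eventually (\<lambda>(x', y). x' = x \<longrightarrow> y \<in> U) uniformity)"

instance
proof
  fix f g h :: L2 and r s :: real and c d :: complex and U :: "L2 set"
  note sq = square_integrable_add square_integrable_scaleC square_integrable_uminus
    square_integrable_zero
  show "f + g + h = f + (g + h)" by transfer (simp add: L2_rel_def sq algebra_simps)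
  show "f + g = g + f" by transfer (simp add: L2_rel_def sq algebra_simps)
  show "0 + f = f" by transfer (simp add: L2_rel_def sq)
  show "- f + f = 0" by transfer (simp add: L2_rel_def sq)
  show "f - g = f + - g" by (simp add: minus_L2_def)
  show "r *\<^sub>R (f + g) = r *\<^sub>R f + r *\<^sub>R g" by transfer (simp add: L2_rel_def sq distrib_left)
  show "(r + s) *\<^sub>R f = r *\<^sub>R f + s *\<^sub>R f" by transfer (simp add: L2_rel_def sq distrib_right)
  show "r *\<^sub>R s *\<^sub>R f = (r * s) *\<^sub>R f" by transfer (simp add: L2_rel_def sq mult.assoc)
  show "1 *\<^sub>R f = f" by transfer (simp add: L2_rel_def)
  show "sgn f = inverse (norm f) *\<^sub>R f" by (rule sgn_L2_def)
  show "dist f g = norm (f - g)" by (rule dist_L2_def)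
  show "uniformity = (INF e\<in>{0 <..}. principal {(x, y :: L2). dist x y < e})"
    by (rule uniformity_L2_def)
  show "open U = (\<forall>x\<in>U. eventually (\<lambda>(x', y). x' = x \<longrightarrow> y \<in> U) uniformity)"
    by (rule open_L2_def)
  show "norm f = sqrt (inner f f)" by (rule norm_L2_def)
  show "c *\<^sub>C (f + g) = c *\<^sub>C f + c *\<^sub>C g" by transfer (simp add: L2_rel_def sq distrib_left)
  show "(c + d) *\<^sub>C f = c *\<^sub>C f + d *\<^sub>C f" by transfer (simp add: L2_rel_def sq distrib_right)
  show "c *\<^sub>C d *\<^sub>C f = (c * d) *\<^sub>C f" by transfer (simp add: L2_rel_def sq mult.assoc)
  show RC: "r *\<^sub>R f = complex_of_real r *\<^sub>C f" for r and f :: L2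
    by transfer (simp add: L2_rel_def sq)
  show comm: "cinner f g = cnj (cinner g f)" for f g :: L2
    by transfer (simp add: Bochner_Integration.integral_cnj[symmetric] mult.commute)
  show add: "cinner f (g + h) = cinner f g + cinner f h" for f g h :: L2
    by transfer (simp add: L2_rel_def distrib_left integrable_cinner)
  show scale: "cinner f (c *\<^sub>C g) = c * cinner f g" for f g :: L2 and c
    by transfer (simp add: mult.left_commute)
  show inn: "inner f g = Re (cinner f g)" for f g :: L2 by (rule inner_L2_def)
  show sym: "inner f g = inner g f" for f g :: L2
    unfolding inn by (subst comm) simp
  have "inner h (f + g) = inner h f + inner h g" by (simp add: inn add)
  then show "inner (f + g) h = inner f h + inner g h" by (simp add: sym)
  have "inner g (r *\<^sub>R f) = r * inner g f" by (simp add: RC inn scale)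
  then show "inner (r *\<^sub>R f) g = r * inner f g" by (simp add: sym)
  have self: "Re (\<integral>x. cnj (f x) * f x \<partial>leb) = (\<integral>x. (cmod (f x))\<^sup>2 \<partial>leb)" for f
    by (simp only: cnj_mult_self integral_complex_of_real Re_complex_of_real)
  show "0 \<le> inner f f"
    unfolding inn by transfer (simp only: self, simp)
  show "(inner f f = 0) = (f = 0)"
    unfolding inn
  proof transfer
    fix f assume "L2_rel f f"
    then have "(Re (\<integral>x. cnj (f x) * f x \<partial>leb) = 0) = (AE x in leb. (cmod (f x))\<^sup>2 = 0)"
      unfolding self by (intro integral_nonneg_eq_0_iff_AE) (auto simp: L2_rel_def square_integrable_def)
    with \<open>L2_rel f f\<close> show "(Re (\<integral>x. cnj (f x) * f x \<partial>leb) = 0) = L2_rel f (\<lambda>_. 0)"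
      by (simp add: L2_rel_def square_integrable_zero)
  qed
qed

end

text \<open>The class of a function that is not square integrable is set to zero.\<close>

lift_definition L2_class :: "(real \<Rightarrow> complex) \<Rightarrow> L2" is
  "\<lambda>f. if square_integrable f then f else (\<lambda>_. 0)"
  by (simp add: L2_rel_def square_integrable_zero)

definition mult_op :: "(real \<Rightarrow> complex) \<Rightarrow> L2 \<Rightarrow> L2" where
  "mult_op \<phi> g = L2_class (\<lambda>x. \<phi> x * rep_L2 g x)"


section \<open>The operators of the model\<close>

definition H :: "real \<Rightarrow> ell2 \<Rightarrow> ell2" where
  "H a = ell2_op (\<lambda>n.
     if n = 0 then (a / 2) *\<^sub>R ell2_basis 1
     else if n = 1 then (1 / 2) *\<^sub>R (a *\<^sub>R ell2_basis 0 + ell2_basis 2)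
     else (1 / 2) *\<^sub>R (ell2_basis (n - 1) + ell2_basis (n + 1)))"

fun Ch :: "real \<Rightarrow> nat \<Rightarrow> real \<Rightarrow> real" where
  "Ch a 0 l = 1"
| "Ch a (Suc 0) l = 2 / a * l"
| "Ch a (Suc (Suc 0)) l = 2 * l * Ch a (Suc 0) l - a * Ch a 0 l"
| "Ch a (Suc (Suc (Suc n))) l = 2 * l * Ch a (Suc (Suc n)) l - Ch a (Suc n) l"

definition psi :: "real \<Rightarrow> nat \<Rightarrow> real \<Rightarrow> real" where
  "psi a n l = sqrt (2 / pi) * (a * root 4 (1 - l\<^sup>2) / sqrt (a ^ 4 - 4 * (a\<^sup>2 - 1) * l\<^sup>2)) * Ch a n l"

definition F :: "real \<Rightarrow> ell2 \<Rightarrow> L2" where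
  "F a = ell2_op (\<lambda>n. L2_class (\<lambda>l. complex_of_real (psi a n l)))"

text \<open>The sign \<open>s\<close> is 1 for the upper and -1 for the lower choice.\<close>

definition sigma :: "real \<Rightarrow> real \<Rightarrow> real \<Rightarrow> complex" where
  "sigma s a l =
     (complex_of_real (a\<^sup>2 + 2 * (1 - a\<^sup>2) * l\<^sup>2)
       + complex_of_real s * 2 * \<i> * complex_of_real ((a\<^sup>2 - 1) * l * sqrt (1 - l\<^sup>2)))
     / complex_of_real (sqrt (a ^ 4 - 4 * (a\<^sup>2 - 1) * l\<^sup>2))"

definition Sigma_plus :: "real \<Rightarrow> L2 \<Rightarrow> L2" where
  "Sigma_plus a = mult_op (sigma 1 a)"

definition Sigma_minus :: "real \<Rightarrow> L2 \<Rightarrow> L2" where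
  "Sigma_minus a = mult_op (sigma (-1) a)"

end

theory Submission
  imports Defs
begin

text \<open>With \<open>\<lambda> = cos x\<close> the eigenfunctions become
  \<open>psi a n \<lambda> = sqrt (2 / (\<pi> sin x)) Im (exp (i n x) w(x))\<close> for \<open>n \<ge> 1\<close>, where \<open>w\<close> is the phase of the Jost
  function \<open>(2 - a\<^sup>2) cos x + i a\<^sup>2 sin x\<close>; the symbols are \<open>\<sigma>\<^sub>+ = w exp (- i x)\<close> and its conjugate \<open>\<sigma>\<^sub>-\<close>.
  Since \<open>F a\<close> intertwines \<open>H a\<close> with multiplication by \<open>\<lambda>\<close>, \<open>F 1\<close> is isometric and \<open>exp (i H\<^sub>a t)\<close> is
  isometric, the claim is that \<open>F\<^sub>1\<^sup>* exp (- i \<lambda> t) g - F\<^sub>a\<^sup>* exp (- i \<lambda> t) \<sigma> g\<close> tends to \<open>0\<close>. In the \<open>n\<close>-th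
  coordinate of this vector one of the two exponentials \<open>exp (\<plusminus> i n x)\<close> cancels, and the other one has no
  stationary point against \<open>exp (- i t cos x)\<close>. For a basis vector one integration by parts bounds the
  coordinate by \<open>C / n\<close>, uniformly in \<open>t\<close>, and shows that it tends to \<open>0\<close>; dominated convergence for the
  sum over \<open>n\<close> concludes.\<close>


section \<open>Complex inner product spaces\<close>

text \<open>The integration by parts works because the amplitude in every coordinate carries the
  factor \<open>sin ((k + 1) x)\<close>, contributed by the \<open>k\<close>-th basis vector. It
  removes the boundary terms, and it absorbs the factor t that appears when 1 / (n + t sin x) is
  differentiated; near the endpoints the phase derivative is not of order t, so nothing else could
  absorb it. The phase w enters only squared, once from \<open>psi a n\<close> and once from the
  symbol. Its square is the Jost function over its conjugate, with no modulus to differentiate. The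
  coordinate n = 0 is exceptional: its weight is 1 / a, so in general nothing cancels, and the bare
  phase - t cos x is stationary at both ends. A factor exp (i x) is taken out of the amplitude to
  give it frequency 1. The exponential of \<open>H a\<close> is evaluated on the range of the
  adjoint of \<open>F a\<close>, which contains the claimed limit, so existence and formula come out
  together. As \<open>ell2_op\<close> and \<open>cadjoint\<close> are definite descriptions and
  \<open>op_exp\<close> is a series, Bessel bounds and completeness are what give these terms their
  meaning.\<close>

lemma cinner_scaleC_left: "cinner (c *\<^sub>C x) y = cnj c * cinner x (y::'a::complex_inner)"
  by (metis cinner_commute cinner_scaleC_right complex_cnj_mult)

lemma cinner_self: "cinner x x = complex_of_real ((norm (x::'a::complex_inner))\<^sup>2)"
proof (rule complex_eqI)
  show "Re (cinner x x) = Re (complex_of_real ((norm x)\<^sup>2))"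
    by (simp add: inner_cinner[symmetric] power2_norm_eq_inner)
  show "Im (cinner x x) = Im (complex_of_real ((norm x)\<^sup>2))"
    using arg_cong[OF cinner_commute[of x x], of Im] by simp
qed

lemma norm_scaleC: "norm (c *\<^sub>C x) = cmod c * norm (x::'a::complex_inner)"
proof -
  have "complex_of_real ((norm (c *\<^sub>C x))\<^sup>2) = cnj c * c * cinner x x"
    by (simp only: cinner_self[symmetric] cinner_scaleC_left cinner_scaleC_right mult_ac)
  also have "\<dots> = complex_of_real ((cmod c * norm x)\<^sup>2)"
    by (simp add: cnj_mult_self cinner_self power_mult_distrib)
  finally have "(norm (c *\<^sub>C x))\<^sup>2 = (cmod c * norm x)\<^sup>2"
    by (simp only: of_real_eq_iff)
  then show ?thesis by (rule power2_eq_imp_eq) auto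
qed

text \<open>Multiplying \<open>y\<close> by the conjugate of the inner product makes the inner
  product real and nonnegative, which reduces the claim to the real Cauchy-Schwarz
  inequality.\<close>

lemma norm_cinner_le: "cmod (cinner x y) \<le> norm x * norm (y::'a::complex_inner)"
proof (cases "cinner x y = 0")
  case False
  let ?c = "cinner x y"
  have "(cmod ?c)\<^sup>2 = inner x (cnj ?c *\<^sub>C y)"
    by (simp add: inner_cinner cinner_scaleC_right cnj_mult_self)
  also have "\<dots> \<le> norm x * (cmod ?c * norm y)"
    using Cauchy_Schwarz_ineq2[of x "cnj ?c *\<^sub>C y"] by (simp add: norm_scaleC)
  finally show ?thesis
    using False by (simp add: power2_eq_square mult_ac)
qed simp

lemma bounded_linear_scaleC_right: "bounded_linear ((*\<^sub>C) c :: 'a::complex_inner \<Rightarrow> 'a)"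
  by (rule bounded_linear_intro[of _ "cmod c"])
     (simp_all add: scaleC_add_right scaleR_scaleC scaleC_scaleC mult.commute norm_scaleC)

lemma bounded_linear_scaleC_left: "bounded_linear (\<lambda>c. c *\<^sub>C (x::'a::complex_inner))"
  by (rule bounded_linear_intro[of _ "norm x"])
     (simp_all add: scaleC_add_left scaleR_scaleC scaleC_scaleC scaleR_conv_of_real norm_scaleC)

lemma bounded_linear_cinner_right: "bounded_linear (cinner (x::'a::complex_inner))"
  by (rule bounded_linear_intro[of _ "norm x"])
     (use norm_cinner_le[of x] in \<open>simp_all add: cinner_add_right scaleR_scaleC cinner_scaleC_right
       scaleR_conv_of_real mult.commute\<close>)

lemmas scaleC_zero_right [simp] = linear_0[OF bounded_linear.linear[OF bounded_linear_scaleC_right]]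
lemmas scaleC_zero_left [simp] = linear_0[OF bounded_linear.linear[OF bounded_linear_scaleC_left]]
lemmas scaleC_diff_right = linear_diff[OF bounded_linear.linear[OF bounded_linear_scaleC_right]]
lemmas cinner_zero_right [simp] = linear_0[OF bounded_linear.linear[OF bounded_linear_cinner_right]]
lemmas cinner_diff_right = linear_diff[OF bounded_linear.linear[OF bounded_linear_cinner_right]]
lemmas cinner_sum_right = linear_sum[OF bounded_linear.linear[OF bounded_linear_cinner_right]]

lemma scaleC_one [simp]: "1 *\<^sub>C (x::'a::complex_inner) = x"
  using scaleR_scaleC[of 1 x] by simp

lemma cinner_sum_left: "cinner (sum f A) y = (\<Sum>i\<in>A. cinner (f i) (y::'a::complex_inner))"
proof -
  have "cinner (sum f A) y = cnj (\<Sum>i\<in>A. cinner y (f i))"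
    by (subst cinner_commute) (simp add: cinner_sum_right)
  then show ?thesis by (simp add: cinner_commute[symmetric])
qed

lemma cinner_eqI:
  assumes "\<And>x. cinner x y = cinner x z"
  shows "y = (z::'a::complex_inner)"
proof -
  have "cinner (y - z) (y - z) = 0" using assms[of "y - z"] by (simp add: cinner_diff_right)
  then show ?thesis by (simp add: cinner_self)
qed

lemma bounded_clinear_linear: "bounded_clinear T \<Longrightarrow> bounded_linear T"
  and bounded_clinear_scaleC: "bounded_clinear T \<Longrightarrow> T (c *\<^sub>C x) = c *\<^sub>C T x"
  by (simp_all add: bounded_clinear_def)

lemma bounded_clinearI:
  assumes "\<And>x y. T (x + y) = T x + T y" "\<And>c x. T (c *\<^sub>C x) = c *\<^sub>C T x"
    and "\<And>x. norm (T x) \<le> K * norm x"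
  shows "bounded_clinear T"
  unfolding bounded_clinear_def
  by (intro conjI allI bounded_linear_intro[of _ K]) (use assms in \<open>auto simp: scaleR_scaleC mult.commute\<close>)

lemma bounded_clinear_compose:
  "bounded_clinear S \<Longrightarrow> bounded_clinear T \<Longrightarrow> bounded_clinear (\<lambda>x. S (T x))"
  by (simp add: bounded_clinear_def bounded_linear_compose)

lemma bounded_clinear_diff:
  "bounded_clinear S \<Longrightarrow> bounded_clinear T \<Longrightarrow> bounded_clinear (\<lambda>x. S x - T x)"
  by (simp add: bounded_clinear_def bounded_linear_sub scaleC_diff_right)

lemma cadjoint_eqI:
  assumes "\<And>x y. cinner (T x) y = cinner x (S y)"
  shows "cadjoint T = S"
  unfolding cadjoint_def
proof (rule the_equality)
  fix R assume "\<forall>x y. cinner (T x) y = cinner x (R y)"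
  then have "R y = S y" for y by (intro cinner_eqI) (metis assms)
  then show "R = S" by (rule ext)
qed (intro allI assms)

lemma strong_limit_eqI:
  assumes "has_strong_limit U W G" "G \<noteq> bot"
  shows "strong_limit G U = W"
  unfolding strong_limit_def
proof (rule the_equality)
  fix V assume "has_strong_limit U V G"
  then have "V f = W f" for f
    using assms tendsto_unique unfolding has_strong_limit_def by blast
  then show "V = W" by (rule ext)
qed (rule assms)


section \<open>Square summable sequences\<close>

lemma cinner_basis: "cinner (ell2_basis n) f = ell2_nth f n"
proof transfer
  fix n and f :: "nat \<Rightarrow> complex"
  have "(\<lambda>k. cnj (if k = n then 1 else 0) * f k) sums (\<Sum>k\<in>{n}. cnj (if k = n then 1 else 0) * f k)"
    by (rule sums_finite) auto
  then show "(\<Sum>k. cnj (if k = n then 1 else 0) * f k) = f n"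
    by (simp add: sums_iff)
qed

lemma ell2_norm_sums: "(\<lambda>n. (cmod (ell2_nth f n))\<^sup>2) sums (norm f)\<^sup>2"
proof -
  have s: "summable (\<lambda>n. (cmod (ell2_nth f n))\<^sup>2)" using ell2_nth[of f] by simp
  have "complex_of_real ((norm f)\<^sup>2) = (\<Sum>n. complex_of_real ((cmod (ell2_nth f n))\<^sup>2))"
    by (simp only: cinner_self[symmetric] cinner_ell2.rep_eq cnj_mult_self)
  also have "\<dots> = complex_of_real (\<Sum>n. (cmod (ell2_nth f n))\<^sup>2)"
    using suminf_of_real[OF s, symmetric] by simp
  finally show ?thesis using s by (simp only: of_real_eq_iff sums_iff)
qed

lemma ell2_nth_diff: "ell2_nth (f - g) n = ell2_nth f n - ell2_nth g n"
  by (simp add: cinner_basis[symmetric] cinner_diff_right)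

lemma ell2_norm_le:
  assumes "\<And>N. (\<Sum>n<N. (cmod (ell2_nth f n))\<^sup>2) \<le> C\<^sup>2" "0 \<le> C"
  shows "norm f \<le> C"
proof -
  have "(norm f)\<^sup>2 \<le> C\<^sup>2"
    using ell2_norm_sums[of f] assms(1) by (intro LIMSEQ_le_const2[of _ "(norm f)\<^sup>2"]) (auto simp: sums_def)
  then show ?thesis using assms(2) by (rule power2_le_imp_le)
qed

lemma ell2_partial_norm_le: "(\<Sum>n<N. (cmod (ell2_nth f n))\<^sup>2) \<le> (norm f)\<^sup>2"
  using sum_le_suminf[of "\<lambda>n. (cmod (ell2_nth f n))\<^sup>2" "{..<N}"] ell2_norm_sums[of f]
  by (simp add: sums_iff)

text \<open>Coordinates converge because they are inner products with basis vectors. The Cauchy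
  estimate passes to the limit in each finite partial sum with a bound independent of its length;
  this one bound yields both the square summability of the limit and the convergence in
  norm.\<close>

instance ell2 :: banach
proof
  fix X :: "nat \<Rightarrow> ell2" assume X: "Cauchy X"
  have "Cauchy (\<lambda>k. ell2_nth (X k) n)" for n
    unfolding cinner_basis[symmetric]
    by (rule bounded_linear.Cauchy[OF bounded_linear_cinner_right X])
  then have "\<exists>l. (\<lambda>k. ell2_nth (X k) n) \<longlonglongrightarrow> l" for n
    using Cauchy_convergent_iff unfolding convergent_def by blast
  then obtain l where l: "\<And>n. (\<lambda>k. ell2_nth (X k) n) \<longlonglongrightarrow> l n" by metis
  have tail: "\<exists>M. \<forall>j\<ge>M. \<forall>N. (\<Sum>n<N. (cmod (ell2_nth (X j) n - l n))\<^sup>2) \<le> e\<^sup>2" if e: "e > 0" for e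
  proof -
    obtain M where M: "\<And>j k. j \<ge> M \<Longrightarrow> k \<ge> M \<Longrightarrow> norm (X j - X k) < e"
      using X e unfolding Cauchy_iff by metis
    have "(\<Sum>n<N. (cmod (ell2_nth (X j) n - l n))\<^sup>2) \<le> e\<^sup>2" if j: "j \<ge> M" for j N
    proof (rule LIMSEQ_le_const2)
      show "(\<lambda>k. \<Sum>n<N. (cmod (ell2_nth (X j) n - ell2_nth (X k) n))\<^sup>2)
          \<longlonglongrightarrow> (\<Sum>n<N. (cmod (ell2_nth (X j) n - l n))\<^sup>2)"
        by (intro tendsto_intros l)
      have "(\<Sum>n<N. (cmod (ell2_nth (X j) n - ell2_nth (X k) n))\<^sup>2) \<le> e\<^sup>2" if "k \<ge> M" for k
      proof -
        have "(norm (X j - X k))\<^sup>2 \<le> e\<^sup>2" using M[OF j that] by (intro power_mono) auto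
        with ell2_partial_norm_le[of "X j - X k" N] show ?thesis by (simp add: ell2_nth_diff)
      qed
      then show "\<exists>M. \<forall>k\<ge>M. (\<Sum>n<N. (cmod (ell2_nth (X j) n - ell2_nth (X k) n))\<^sup>2) \<le> e\<^sup>2" by blast
    qed
    then show ?thesis by blast
  qed
  obtain M where M: "\<And>N. (\<Sum>n<N. (cmod (ell2_nth (X M) n - l n))\<^sup>2) \<le> 1\<^sup>2"
    using tail[of 1] by auto
  have "summable (\<lambda>n. (cmod (ell2_nth (X M) n - l n))\<^sup>2)"
    by (rule summableI_nonneg_bounded[where x = 1]) (use M in simp_all)
  then have "summable (\<lambda>n. 2 * (cmod (ell2_nth (X M) n - l n))\<^sup>2 + 2 * (cmod (ell2_nth (X M) n))\<^sup>2)"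
    using ell2_nth[of "X M"] by (intro summable_add summable_mult) auto
  then have "summable (\<lambda>n. (cmod (l n))\<^sup>2)"
  proof (rule summable_comparison_test'[of _ 0])
    fix n
    have "(cmod (l n))\<^sup>2 \<le> 2 * (cmod (l n - ell2_nth (X M) n))\<^sup>2 + 2 * (cmod (ell2_nth (X M) n))\<^sup>2"
      using cmod_add_square_le[of "l n - ell2_nth (X M) n" "ell2_nth (X M) n"] by simp
    then show "norm ((cmod (l n))\<^sup>2)
        \<le> 2 * (cmod (ell2_nth (X M) n - l n))\<^sup>2 + 2 * (cmod (ell2_nth (X M) n))\<^sup>2"
      by (simp add: norm_minus_commute)
  qed
  then have nth: "ell2_nth (Abs_ell2 l) = l" by (simp add: Abs_ell2_inverse)
  have "X \<longlonglongrightarrow> Abs_ell2 l"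
  proof (rule LIMSEQ_I)
    fix r :: real assume "r > 0"
    then obtain M where M: "\<And>j N. j \<ge> M \<Longrightarrow> (\<Sum>n<N. (cmod (ell2_nth (X j) n - l n))\<^sup>2) \<le> (r / 2)\<^sup>2"
      using tail[of "r / 2"] by auto
    have "norm (X j - Abs_ell2 l) \<le> r / 2" if "j \<ge> M" for j
      by (rule ell2_norm_le) (use M[OF that] \<open>r > 0\<close> in \<open>auto simp: ell2_nth_diff nth\<close>)
    with \<open>r > 0\<close> show "\<exists>M. \<forall>j\<ge>M. norm (X j - Abs_ell2 l) < r"
      by (intro exI[of _ M]) (force intro: le_less_trans)
  qed
  then show "convergent X" unfolding convergent_def by blast
qed

lemma ell2_nth_sum: "ell2_nth (sum g A) n = (\<Sum>k\<in>A. ell2_nth (g k) n)"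
  by (simp add: cinner_basis[symmetric] cinner_sum_right)

lemma ell2_nth_scaleC: "ell2_nth (c *\<^sub>C f) n = c * ell2_nth f n"
  by (simp add: cinner_basis[symmetric] cinner_scaleC_right)

lemma ell2_nth_basis: "ell2_nth (ell2_basis m) n = (if n = m then 1 else 0)"
  by (simp add: ell2_basis.rep_eq)

text \<open>The remainder has zero coordinates below N and those of -f from N on, so its squared
  norm is the tail of the series for the squared norm of f.\<close>

lemma ell2_expansion: "(\<lambda>n. ell2_nth f n *\<^sub>C ell2_basis n) sums f"
  unfolding sums_def
proof (rule tendsto_norm_zero_cancel[THEN LIM_zero_cancel])
  let ?a = "\<lambda>n. (cmod (ell2_nth f n))\<^sup>2"
  have "(norm ((\<Sum>n<N. ell2_nth f n *\<^sub>C ell2_basis n) - f))\<^sup>2 = (norm f)\<^sup>2 - (\<Sum>n<N. ?a n)" for N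
  proof -
    let ?g = "(\<Sum>n<N. ell2_nth f n *\<^sub>C ell2_basis n) - f"
    have "(\<lambda>n. ?a n - (if n < N then ?a n else 0)) sums ((norm f)\<^sup>2 - (\<Sum>n<N. ?a n))"
      using sums_diff[OF ell2_norm_sums[of f] sums_If_finite_set[of "{..<N}" ?a]] by simp
    moreover have "ell2_nth ?g n = (if n < N then ell2_nth f n else 0) - ell2_nth f n" for n
      by (simp add: ell2_nth_diff ell2_nth_sum ell2_nth_scaleC ell2_nth_basis if_distrib cong: if_cong)
    then have "?a n - (if n < N then ?a n else 0) = (cmod (ell2_nth ?g n))\<^sup>2" for n
      by simp
    ultimately show ?thesis
      using sums_unique2[OF ell2_norm_sums[of ?g]] by simp
  qed
  moreover have "(\<lambda>N. (norm f)\<^sup>2 - (\<Sum>n<N. ?a n)) \<longlonglongrightarrow> (norm f)\<^sup>2 - (norm f)\<^sup>2"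
    using ell2_norm_sums[of f] by (intro tendsto_intros) (simp add: sums_def)
  ultimately have "(\<lambda>N. (norm ((\<Sum>n<N. ell2_nth f n *\<^sub>C ell2_basis n) - f))\<^sup>2) \<longlonglongrightarrow> 0" by simp
  from tendsto_real_sqrt[OF this] 
  show "(\<lambda>N. norm ((\<Sum>n<N. ell2_nth f n *\<^sub>C ell2_basis n) - f)) \<longlonglongrightarrow> 0" by simp
qed

lemma bounded_clinear_expansion:
  assumes "bounded_clinear T"
  shows "(\<lambda>n. ell2_nth f n *\<^sub>C T (ell2_basis n)) sums T f"
  using bounded_linear.sums[OF bounded_clinear_linear[OF assms] ell2_expansion[of f]]
  by (simp add: bounded_clinear_scaleC[OF assms])

lemma bounded_clinear_eq_on_basis:
  assumes "bounded_clinear S" "bounded_clinear T" "\<And>n. S (ell2_basis n) = T (ell2_basis n)"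
  shows "S f = T f"
  using bounded_clinear_expansion[OF assms(1), of f] bounded_clinear_expansion[OF assms(2), of f]
  unfolding assms(3) by (rule sums_unique2)

lemma ell2_op_eqI:
  assumes "bounded_clinear T" "\<And>n. T (ell2_basis n) = v n"
  shows "ell2_op v = T"
  unfolding ell2_op_def
proof (rule the_equality)
  fix S assume S: "bounded_clinear S \<and> (\<forall>n. S (ell2_basis n) = v n)"
  show "S = T"
    by (rule ext, rule bounded_clinear_eq_on_basis) (simp_all add: S assms)
qed (simp add: assms)


section \<open>Exponentials of bounded operators\<close>

lemma bounded_clinear_norm_le:
  assumes "bounded_clinear A"
  obtains M where "M > 0" "\<And>x. norm (A x) \<le> M * norm x"
  using bounded_linear.pos_bounded[OF bounded_clinear_linear[OF assms]] by (metis mult.commute)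

lemma norm_funpow_le:
  fixes A :: "'a::real_normed_vector \<Rightarrow> 'a"
  assumes "0 \<le> M" "\<And>x. norm (A x) \<le> M * norm x"
  shows "norm ((A ^^ k) x) \<le> M ^ k * norm x"
proof (induction k)
  case (Suc k)
  have "norm ((A ^^ Suc k) x) \<le> M * norm ((A ^^ k) x)" using assms(2) by simp
  also have "\<dots> \<le> M * (M ^ k * norm x)" using Suc assms(1) by (rule mult_left_mono)
  finally show ?case by simp
qed simp

lemma funpow_scaleC:
  fixes A :: "'a::complex_inner \<Rightarrow> 'a"
  assumes "bounded_clinear A"
  shows "((\<lambda>f. c *\<^sub>C A f) ^^ k) x = c ^ k *\<^sub>C (A ^^ k) x"
  by (induction k) (simp_all add: scaleC_scaleC bounded_clinear_scaleC[OF assms])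

text \<open>The scalar is kept apart from the operator, so that a map intertwining \<open>A\<close>
  with \<open>B\<close> carries the series of \<open>A\<close> termwise to that of \<open>B\<close>
  with the same \<open>c\<close>.\<close>

definition exp_term :: "('a::complex_inner \<Rightarrow> 'a) \<Rightarrow> complex \<Rightarrow> 'a \<Rightarrow> nat \<Rightarrow> 'a" where
  "exp_term A c x k = (c ^ k / fact k) *\<^sub>C (A ^^ k) x"

lemma summable_norm_exp_term:
  assumes "bounded_clinear A"
  shows "summable (\<lambda>k. norm (exp_term A c x k))"
proof -
  obtain M where M: "M > 0" "\<And>x. norm (A x) \<le> M * norm x"
    using bounded_clinear_norm_le[OF assms] by blast
  have "summable (\<lambda>k. (cmod c * M) ^ k /\<^sub>R fact k * norm x)"
    by (intro summable_mult2 summable_exp_generic)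
  then show ?thesis
  proof (rule summable_comparison_test'[of _ 0])
    fix k
    have "norm (exp_term A c x k) \<le> cmod c ^ k / fact k * (M ^ k * norm x)"
      unfolding exp_term_def norm_scaleC
      by (intro mult_mono norm_funpow_le) (use M in \<open>auto simp: norm_divide norm_power\<close>)
    then show "norm (norm (exp_term A c x k)) \<le> (cmod c * M) ^ k /\<^sub>R fact k * norm x"
      by (simp add: power_mult_distrib field_simps)
  qed
qed

lemma op_exp_sums:
  fixes A :: "'a::{complex_inner,banach} \<Rightarrow> 'a"
  assumes "bounded_clinear A"
  shows "exp_term A c x sums op_exp (\<lambda>f. c *\<^sub>C A f) x"
proof -
  have "op_exp (\<lambda>f. c *\<^sub>C A f) x = suminf (exp_term A c x)"
    unfolding op_exp_def exp_term_def
    by (simp add: funpow_scaleC[OF assms] scaleR_scaleC scaleC_scaleC mult.commute)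
  then show ?thesis
    using summable_norm_cancel[OF summable_norm_exp_term[OF assms]] by (simp add: summable_sums)
qed

text \<open>The conclusion is a \<open>sums\<close> statement because the sum of the
  \<open>B\<close>-series is identified independently: as multiplication by an exponential when
  \<open>T\<close> is \<open>F 1\<close>, as an exponential of \<open>H a\<close> when
  \<open>T\<close> is the adjoint of \<open>F a\<close>. Uniqueness of sums then gives the
  equality.\<close>

lemma bounded_clinear_op_exp_sums:
  fixes A :: "'a::{complex_inner,banach} \<Rightarrow> 'a"
  assumes "bounded_clinear A" "bounded_clinear T" "\<And>x. T (A x) = B (T x)"
  shows "exp_term B c (T x) sums T (op_exp (\<lambda>f. c *\<^sub>C A f) x)"
proof -
  have "T ((A ^^ k) x) = (B ^^ k) (T x)" for k
    by (induction k) (simp_all add: assms(3))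
  then have "T (exp_term A c x k) = exp_term B c (T x) k" for k
    by (simp add: exp_term_def bounded_clinear_scaleC[OF assms(2)])
  then show ?thesis
    using bounded_linear.sums[OF bounded_clinear_linear[OF assms(2)] op_exp_sums[OF assms(1), of c x]] by simp
qed

lemma sum_binomial_alternating:
  fixes z :: complex
  shows "(\<Sum>j\<le>n. (- z) ^ j / fact j * (z ^ (n - j) / fact (n - j))) = (if n = 0 then 1 else 0)"
proof -
  have "(\<Sum>j\<le>n. (- z) ^ j / fact j * (z ^ (n - j) / fact (n - j)))
      = (\<Sum>j\<le>n. of_nat (n choose j) * (- z) ^ j * z ^ (n - j)) / fact n"
    unfolding sum_divide_distrib by (rule sum.cong) (simp_all add: binomial_fact field_simps)
  also have "\<dots> = (- z + z) ^ n / fact n" by (simp only: binomial_ring)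
  finally show ?thesis by auto
qed

text \<open>Expanding both factors of \<open>\<langle>exp(itA)x, exp(itA)x\<rangle>\<close> gives a double series whose terms of total
  degree \<open>n > 0\<close> cancel.\<close>

lemma norm_op_exp_selfadjoint:
  fixes A :: "'a::{complex_inner,banach} \<Rightarrow> 'a"
  assumes A: "bounded_clinear A" and sa: "\<And>x y. cinner (A x) y = cinner x (A y)"
  shows "norm (op_exp (\<lambda>f. (\<i> * complex_of_real t) *\<^sub>C A f) x) = norm x"
proof -
  let ?z = "\<i> * complex_of_real t"
  define u where "u = exp_term A ?z x"
  define U where "U = op_exp (\<lambda>f. ?z *\<^sub>C A f) x"
  have U: "u sums U" unfolding u_def U_def by (rule op_exp_sums[OF A])
  have un: "summable (\<lambda>k. norm (u k))" unfolding u_def by (rule summable_norm_exp_term[OF A])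
  have norm_sum: "((\<lambda>k. norm (u k)) has_sum suminf (\<lambda>k. norm (u k))) UNIV"
    by (rule norm_summable_imp_has_sum) (use un in \<open>simp_all add: summable_sums\<close>)
  let ?g = "\<lambda>(j, k). cinner (u j) (u k)"
  have "(\<lambda>(j, k). norm (u j) * norm (u k)) summable_on Sigma UNIV (\<lambda>_. UNIV)"
    by (rule summable_on_SigmaI[where g = "\<lambda>j. norm (u j) * suminf (\<lambda>k. norm (u k))"])
       (use norm_sum has_sum_imp_summable[OF norm_sum] in
         \<open>auto intro!: has_sum_cmult_right summable_on_cmult_left\<close>)
  then have "(\<lambda>p. norm (?g p)) summable_on Sigma UNIV (\<lambda>_. UNIV)"
    by (rule Infinite_Sum.abs_summable_on_comparison_test') (auto simp: norm_cinner_le)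
  then have "?g summable_on Sigma UNIV (\<lambda>_. UNIV)" by (rule abs_summable_summable)
  then obtain S where S: "(?g has_sum S) (Sigma UNIV (\<lambda>_. UNIV))"
    unfolding summable_on_def by blast
  have row: "((\<lambda>k. cinner y (u k)) has_sum cinner y U) UNIV" for y
  proof (rule norm_summable_imp_has_sum)
    show "(\<lambda>k. cinner y (u k)) sums cinner y U"
      by (rule bounded_linear.sums[OF bounded_linear_cinner_right U])
    show "summable (\<lambda>k. norm (cinner y (u k)))"
      by (rule summable_comparison_test'[OF summable_mult[OF un, of "norm y"], of 0])
         (simp add: norm_cinner_le)
  qed
  have "((\<lambda>j. cinner (u j) U) has_sum S) UNIV"
    by (rule has_sum_SigmaD[OF S]) (use row in auto)
  moreover have "((\<lambda>j. cinner (u j) U) has_sum cinner U U) UNIV"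
    using row[of U] has_sum_cnj_iff[of "\<lambda>k. cinner U (u k)" UNIV "cinner U U"]
    by (simp add: cinner_commute[symmetric])
  ultimately have SU: "S = cinner U U" by (rule has_sum_unique)
  have "((\<lambda>p. ?g (snd p, fst p - snd p)) has_sum S) (SIGMA n:UNIV. {..n})"
    by (rule has_sum_reindex_bij_witness[where i = "\<lambda>(j, k). (j + k, j)"
          and j = "\<lambda>p. (snd p, fst p - snd p)", THEN iffD2, OF _ _ _ _ _ _ S]) auto
  then have diag: "((\<lambda>n. \<Sum>j\<le>n. cinner (u j) (u (n - j))) has_sum S) UNIV"
    by (rule has_sum_SigmaD) (auto intro!: has_sum_finiteI)
  have pow: "cinner ((A ^^ j) x) ((A ^^ k) x) = cinner x ((A ^^ (j + k)) x)" for j k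
  proof (induction j arbitrary: k)
    case (Suc j)
    have "cinner ((A ^^ Suc j) x) ((A ^^ k) x) = cinner ((A ^^ j) x) ((A ^^ Suc k) x)"
      by (simp add: sa)
    with Suc[of "Suc k"] show ?case by simp
  qed simp
  \<comment> \<open>Since \<open>?z\<close> is purely imaginary, conjugate linearity in the first
    argument turns \<open>?z ^ j\<close> into \<open>(- ?z) ^ j\<close>, and the coefficients add up
    to the expansion of (- z + z)^n / n!.\<close>
  have "(\<Sum>j\<le>n. cinner (u j) (u (n - j))) = (if n = 0 then cinner x x else 0)" for n
  proof -
    have "cinner (u j) (u (n - j))
        = (- ?z) ^ j / fact j * (?z ^ (n - j) / fact (n - j)) * cinner x ((A ^^ n) x)" if "j \<le> n" for j
      using that by (simp add: u_def exp_term_def cinner_scaleC_left cinner_scaleC_right pow mult_ac)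
    then have "(\<Sum>j\<le>n. cinner (u j) (u (n - j)))
        = (\<Sum>j\<le>n. (- ?z) ^ j / fact j * (?z ^ (n - j) / fact (n - j))) * cinner x ((A ^^ n) x)"
      unfolding sum_distrib_right by (intro sum.cong) auto
    then show ?thesis by (simp only: sum_binomial_alternating) auto
  qed
  with diag have "((\<lambda>n::nat. if n = 0 then cinner x x else 0) has_sum S) UNIV" by simp
  moreover have "((\<lambda>n::nat. if n = 0 then cinner x x else 0) has_sum cinner x x) UNIV"
    by (rule has_sum_finite_neutralI[of "{0}"]) auto
  ultimately have "cinner U U = cinner x x" using SU has_sum_unique by blast
  then have "(norm U)\<^sup>2 = (norm x)\<^sup>2" by (simp only: cinner_self of_real_eq_iff)
  then show ?thesis unfolding U_def by (rule power2_eq_imp_eq) auto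
qed


section \<open>Square integrable functions\<close>

lemma square_integrable_rep_L2: "square_integrable (rep_L2 g)"
  using Quotient_rep_reflp[OF Quotient_L2] by (simp add: L2_rel_def)

lemma L2_class_rep: "L2_class (rep_L2 g) = g"
  by (simp add: L2_class.abs_eq L2_rel_def square_integrable_rep_L2 square_integrable_zero
      Quotient_abs_rep[OF Quotient_L2])

lemma rep_L2_class:
  assumes "square_integrable f"
  shows "AE x in leb. rep_L2 (L2_class f) x = f x"
proof -
  have "L2_class f = abs_L2 f" using assms by (simp add: L2_class_def)
  then have "L2_rel (rep_L2 (L2_class f)) f"
    using Quotient_rep_abs[OF Quotient_L2, of f] assms by (simp add: L2_rel_def)
  then show ?thesis by (simp add: L2_rel_def)
qed

lemma L2_class_eqI:
  assumes "square_integrable f" "square_integrable g" "\<And>x. x \<in> {-1<..<1} \<Longrightarrow> f x = g x"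
  shows "L2_class f = L2_class g"
proof -
  have "AE x in leb. f x = g x" using assms(3) by (intro AE_I2) simp
  then show ?thesis using assms(1,2) by transfer (simp add: L2_rel_def)
qed

lemma L2_class_AE_eqI:
  assumes "square_integrable f" "square_integrable g" "AE x in leb. f x = g x"
  shows "L2_class f = L2_class g"
  using assms by transfer (simp add: L2_rel_def)

lemma L2_cases:
  obtains f where "square_integrable f" "g = L2_class f"
  using square_integrable_rep_L2 L2_class_rep by metis

lemma L2_class_add:
  "square_integrable f \<Longrightarrow> square_integrable g \<Longrightarrow> L2_class f + L2_class g = L2_class (\<lambda>x. f x + g x)"
  by transfer (simp add: L2_rel_def square_integrable_add)

lemma L2_class_scaleC: "square_integrable f \<Longrightarrow> c *\<^sub>C L2_class f = L2_class (\<lambda>x. c * f x)"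
  by transfer (simp add: L2_rel_def square_integrable_scaleC)

lemma square_integrable_diff:
  "square_integrable f \<Longrightarrow> square_integrable g \<Longrightarrow> square_integrable (\<lambda>x. f x - g x)"
  using square_integrable_add[of f "\<lambda>x. - g x"] square_integrable_uminus[of g] by simp

lemma L2_class_diff:
  assumes "square_integrable f" "square_integrable g"
  shows "L2_class f - L2_class g = L2_class (\<lambda>x. f x - g x)"
  using L2_class_add[OF square_integrable_diff[OF assms] assms(2)] by (simp add: algebra_simps)

lemma square_integrable_sum:
  "(\<And>i. i \<in> A \<Longrightarrow> square_integrable (f i)) \<Longrightarrow> square_integrable (\<lambda>x. \<Sum>i\<in>A. f i x)"
  by (induction A rule: infinite_finite_induct)
     (simp_all add: square_integrable_zero square_integrable_add)

lemma L2_class_zero: "L2_class (\<lambda>_. 0) = 0"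
  by transfer (simp add: L2_rel_def square_integrable_zero)

lemma L2_class_sum:
  assumes "\<And>i. i \<in> A \<Longrightarrow> square_integrable (f i)"
  shows "(\<Sum>i\<in>A. L2_class (f i)) = L2_class (\<lambda>x. \<Sum>i\<in>A. f i x)"
  using assms
  by (induction A rule: infinite_finite_induct)
     (simp_all add: L2_class_zero L2_class_add square_integrable_sum)

lemma cinner_L2_class:
  "square_integrable f \<Longrightarrow> square_integrable g
    \<Longrightarrow> cinner (L2_class f) (L2_class g) = (\<integral>x. cnj (f x) * g x \<partial>leb)"
  by transfer simp

lemma norm_L2_class:
  assumes "square_integrable f"
  shows "(norm (L2_class f))\<^sup>2 = (\<integral>x. (cmod (f x))\<^sup>2 \<partial>leb)"
proof -
  have "complex_of_real ((norm (L2_class f))\<^sup>2) = (\<integral>x. complex_of_real ((cmod (f x))\<^sup>2) \<partial>leb)"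
    by (simp only: cinner_self[symmetric] cinner_L2_class[OF assms assms] cnj_mult_self)
  then show ?thesis by (simp only: integral_complex_of_real of_real_eq_iff)
qed

lemma nn_integral_L2_class:
  assumes "square_integrable f"
  shows "(\<integral>\<^sup>+x. ennreal ((cmod (f x))\<^sup>2) \<partial>leb) = ennreal ((norm (L2_class f))\<^sup>2)"
  using assms unfolding norm_L2_class[OF assms] square_integrable_def
  by (intro nn_integral_eq_integral) auto

lemma finite_measure_leb: "finite_measure leb"
  by (rule finite_measure_lebesgue_on) simp

text \<open>Cauchy-Schwarz against the constant 1, whose norm is the square root of the length 2 of
  the interval.\<close>

lemma integral_norm_le_L2:
  assumes "square_integrable f"
  shows "(\<integral>x. cmod (f x) \<partial>leb) \<le> sqrt 2 * norm (L2_class f)" and "integrable leb f"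
proof -
  have one: "square_integrable (\<lambda>_. 1)"
    using finite_measure.integrable_const[OF finite_measure_leb] by (simp add: square_integrable_def)
  have [measurable]: "f \<in> borel_measurable leb" using assms by (simp add: square_integrable_def)
  have "(\<lambda>x. complex_of_real (cmod (f x))) \<in> borel_measurable leb" by measurable
  then have f: "square_integrable (\<lambda>x. complex_of_real (cmod (f x)))"
    using assms by (simp add: square_integrable_def)
  have "measure leb (space leb) = 2"
    by (simp add: measure_restrict_space)
  then have "(norm (L2_class (\<lambda>_. 1)))\<^sup>2 = 2"
    unfolding norm_L2_class[OF one] by simp
  then have n1: "norm (L2_class (\<lambda>_. 1)) = sqrt 2" by (metis norm_ge_zero real_sqrt_unique)
  have n2: "norm (L2_class (\<lambda>x. complex_of_real (cmod (f x)))) = norm (L2_class f)"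
    by (rule power2_eq_imp_eq) (simp_all add: norm_L2_class assms f)
  have "cinner (L2_class (\<lambda>_. 1)) (L2_class (\<lambda>x. complex_of_real (cmod (f x))))
      = complex_of_real (\<integral>x. cmod (f x) \<partial>leb)"
    by (simp add: cinner_L2_class[OF one f])
  then show "(\<integral>x. cmod (f x) \<partial>leb) \<le> sqrt 2 * norm (L2_class f)"
    using norm_cinner_le[of "L2_class (\<lambda>_. 1)" "L2_class (\<lambda>x. complex_of_real (cmod (f x)))"]
    by (simp add: n1 n2)
  show "integrable leb f" using integrable_cinner[OF one assms] by simp
qed

text \<open>A Cauchy sequence in \<open>L\<^sup>2\<close> is Cauchy in \<open>L\<^sup>1\<close>, the interval being finite, so a subsequence converges
  almost everywhere; Fatou's lemma identifies the limit.\<close>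

instance L2 :: banach
proof
  fix X :: "nat \<Rightarrow> L2" assume X: "Cauchy X"
  define f where "f n = rep_L2 (X n)" for n
  have sq: "square_integrable (f n)" and Xf: "X n = L2_class (f n)" for n
    by (simp_all add: f_def square_integrable_rep_L2 L2_class_rep)
  have [measurable]: "f n \<in> borel_measurable leb" for n using sq by (simp add: square_integrable_def)
  have X_diff: "X i - X j = L2_class (\<lambda>x. f i x - f j x)" for i j
    by (simp add: Xf L2_class_diff sq)
  have "\<exists>N. \<forall>i\<ge>N. \<forall>j\<ge>N. (LINT x|leb. norm (f i x - f j x)) < e" if "e > 0" for e :: real
  proof -
    obtain N where N: "\<And>i j. i \<ge> N \<Longrightarrow> j \<ge> N \<Longrightarrow> norm (X i - X j) < e / sqrt 2"
      using X \<open>e > 0\<close> unfolding Cauchy_iff by (metis divide_pos_pos real_sqrt_gt_0_iff zero_less_numeral)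
    have "(LINT x|leb. norm (f i x - f j x)) < e" if "i \<ge> N" "j \<ge> N" for i j
    proof -
      have "(LINT x|leb. norm (f i x - f j x)) \<le> sqrt 2 * norm (X i - X j)"
        unfolding X_diff by (intro integral_norm_le_L2 square_integrable_diff sq)
      also have "\<dots> < e" using N[OF that] by (simp add: field_simps)
      finally show ?thesis .
    qed
    then show ?thesis by blast
  qed
  then obtain r where r: "strict_mono r" "AE x in leb. Cauchy (\<lambda>i. f (r i) x)"
    using cauchy_L1_AE_cauchy_subseq[of leb f] integral_norm_le_L2(2)[OF sq] by blast
  define l where "l x = lim (\<lambda>i. f (r i) x)" for x
  have [measurable]: "l \<in> borel_measurable leb" unfolding l_def[abs_def] by measurable
  have l: "AE x in leb. (\<lambda>i. f (r i) x) \<longlonglongrightarrow> l x"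
    using r(2) by eventually_elim (simp add: l_def Cauchy_convergent_iff convergent_LIMSEQ_iff)
  have close: "(\<integral>\<^sup>+x. ennreal ((cmod (f j x - l x))\<^sup>2) \<partial>leb) \<le> ennreal (e\<^sup>2)"
    if e: "\<And>i. i \<ge> N \<Longrightarrow> norm (X j - X i) < e" for j N e
  proof -
    have "(\<integral>\<^sup>+x. ennreal ((cmod (f j x - l x))\<^sup>2) \<partial>leb)
        = (\<integral>\<^sup>+x. liminf (\<lambda>i. ennreal ((cmod (f j x - f (r i) x))\<^sup>2)) \<partial>leb)"
    proof (rule nn_integral_cong_AE)
      show "AE x in leb. ennreal ((cmod (f j x - l x))\<^sup>2)
          = liminf (\<lambda>i. ennreal ((cmod (f j x - f (r i) x))\<^sup>2))"
        using l
      proof eventually_elim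
        case (elim x)
        have "(\<lambda>i. ennreal ((cmod (f j x - f (r i) x))\<^sup>2)) \<longlonglongrightarrow> ennreal ((cmod (f j x - l x))\<^sup>2)"
          by (intro tendsto_ennrealI tendsto_intros elim)
        then show ?case by (rule lim_imp_Liminf[OF sequentially_bot, symmetric])
      qed
    qed
    also have "\<dots> \<le> liminf (\<lambda>i. \<integral>\<^sup>+x. ennreal ((cmod (f j x - f (r i) x))\<^sup>2) \<partial>leb)"
      by (rule nn_integral_liminf) simp
    also have "\<dots> = liminf (\<lambda>i. ennreal ((norm (X j - X (r i)))\<^sup>2))"
      by (simp add: X_diff nn_integral_L2_class square_integrable_diff sq)
    also have "\<dots> \<le> ennreal (e\<^sup>2)"
    proof (rule Liminf_le)
      show "eventually (\<lambda>i. ennreal ((norm (X j - X (r i)))\<^sup>2) \<le> ennreal (e\<^sup>2)) sequentially"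
        using eventually_ge_at_top[of N]
      proof eventually_elim
        case (elim i)
        have "norm (X j - X (r i)) < e"
          using e[of "r i"] seq_suble[OF r(1), of i] elim by linarith
        then show ?case by (intro ennreal_leI power_mono) auto
      qed
    qed simp
    finally show ?thesis .
  qed
  have sq_diff: "square_integrable (\<lambda>x. f j x - l x)"
    if "\<And>i. i \<ge> N \<Longrightarrow> norm (X j - X i) < e" for j N e
    using le_less_trans[OF close[OF that] ennreal_less_top] unfolding square_integrable_def
    by (intro conjI integrableI_bounded) auto
  obtain N where N: "\<And>i j. i \<ge> N \<Longrightarrow> j \<ge> N \<Longrightarrow> norm (X i - X j) < 1"
    using X unfolding Cauchy_iff by (metis zero_less_one)
  \<comment> \<open>The limit \<open>l\<close> is recovered from two functions known to be square
    integrable: \<open>f N\<close>, and \<open>f N - l\<close> by the Fatou bound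
    \<open>close\<close>.\<close>
  have "square_integrable (\<lambda>x. f N x - (f N x - l x))"
    by (intro square_integrable_diff sq sq_diff[of N N 1] N) auto
  then have sql: "square_integrable l" by simp
  have "X \<longlonglongrightarrow> L2_class l"
  proof (rule LIMSEQ_I)
    fix e :: real assume "e > 0"
    then obtain N where N: "\<And>i j. i \<ge> N \<Longrightarrow> j \<ge> N \<Longrightarrow> norm (X i - X j) < e / 2"
      using X unfolding Cauchy_iff by (metis half_gt_zero)
    have "norm (X j - L2_class l) < e" if "j \<ge> N" for j
    proof -
      have "ennreal ((norm (X j - L2_class l))\<^sup>2) \<le> ennreal ((e / 2)\<^sup>2)"
        using close[of N j "e / 2"] N[OF that]
        by (simp add: Xf L2_class_diff sq sql nn_integral_L2_class square_integrable_diff)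
      then have "norm (X j - L2_class l) \<le> e / 2"
        using \<open>e > 0\<close> by (simp add: power2_le_iff_abs_le abs_le_iff)
      then show ?thesis using \<open>e > 0\<close> by simp
    qed
    then show "\<exists>N. \<forall>j\<ge>N. norm (X j - L2_class l) < e" by blast
  qed
  then show "convergent X" unfolding convergent_def by blast
qed


section \<open>Operators on square summable sequences\<close>

text \<open>The upper frame bound. It is stated for finite combinations, where it can be computed,
  and it guarantees that the definite description \<open>ell2_op v\<close> denotes an operator, of
  norm at most sqrt C.\<close>

definition bessel :: "(nat \<Rightarrow> 'a::complex_inner) \<Rightarrow> real \<Rightarrow> bool" where
  "bessel v C \<longleftrightarrow> 0 \<le> C \<and> (\<forall>c N. (norm (\<Sum>n<N. c n *\<^sub>C v n))\<^sup>2 \<le> C * (\<Sum>n<N. (cmod (c n))\<^sup>2))"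

lemma bessel_le: "bessel v C \<Longrightarrow> (norm (\<Sum>n<N. c n *\<^sub>C v n))\<^sup>2 \<le> C * (\<Sum>n<N. (cmod (c n))\<^sup>2)"
  by (simp add: bessel_def)

lemma bessel_segment:
  assumes "bessel v C"
  shows "(norm (\<Sum>n=m..<N. c n *\<^sub>C v n))\<^sup>2 \<le> C * (\<Sum>n=m..<N. (cmod (c n))\<^sup>2)"
proof -
  let ?c = "\<lambda>n. if m \<le> n then c n else 0"
  have eq: "(\<Sum>n<N. if m \<le> n then g n else 0) = (\<Sum>n=m..<N. g n)"
    for g :: "nat \<Rightarrow> 'b::comm_monoid_add"
    by (rule sum.mono_neutral_cong_right) auto
  have "(\<Sum>n<N. ?c n *\<^sub>C v n) = (\<Sum>n<N. if m \<le> n then c n *\<^sub>C v n else 0)"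
    "(\<Sum>n<N. (cmod (?c n))\<^sup>2) = (\<Sum>n<N. if m \<le> n then (cmod (c n))\<^sup>2 else 0)"
    by (auto intro!: sum.cong)
  with bessel_le[OF assms, of ?c N] show ?thesis by (simp only: eq)
qed

lemma ell2_op_bessel:
  fixes v :: "nat \<Rightarrow> 'a::{complex_inner,banach}"
  assumes v: "bessel v C"
  shows "bounded_clinear (ell2_op v)" and "ell2_op v (ell2_basis n) = v n"
proof -
  have C: "0 \<le> C" using v by (simp add: bessel_def)
  define T where "T f = (\<Sum>n. ell2_nth f n *\<^sub>C v n)" for f
  have summable: "summable (\<lambda>n. ell2_nth f n *\<^sub>C v n)" for f
    unfolding summable_Cauchy
  proof (intro allI impI)
    fix e :: real assume e: "e > 0"
    have "summable (\<lambda>n. (cmod (ell2_nth f n))\<^sup>2)" using ell2_nth[of f] by simp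
    \<comment> \<open>The divisor is C + 1 because C may be 0.\<close>
    then obtain N where N: "\<And>m n. m \<ge> N \<Longrightarrow> norm (\<Sum>k=m..<n. (cmod (ell2_nth f k))\<^sup>2) < e\<^sup>2 / (C + 1)"
      using e C unfolding summable_Cauchy by (metis add_nonneg_pos divide_pos_pos zero_less_one zero_less_power)
    have "norm (\<Sum>k=m..<n. ell2_nth f k *\<^sub>C v k) < e" if "m \<ge> N" for m n
    proof -
      let ?s = "\<Sum>k=m..<n. (cmod (ell2_nth f k))\<^sup>2"
      have s: "0 \<le> ?s" "?s < e\<^sup>2 / (C + 1)" using N[OF that, of n] by (auto intro: sum_nonneg)
      have "(norm (\<Sum>k=m..<n. ell2_nth f k *\<^sub>C v k))\<^sup>2 \<le> C * ?s" by (rule bessel_segment[OF v])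
      also have "\<dots> \<le> (C + 1) * ?s" using s by (simp add: distrib_right)
      also have "\<dots> < e\<^sup>2" using s C by (simp add: field_simps)
      finally show ?thesis using e by (simp add: power2_less_imp_less)
    qed
    then show "\<exists>N. \<forall>m\<ge>N. \<forall>n. norm (\<Sum>k=m..<n. ell2_nth f k *\<^sub>C v k) < e" by blast
  qed
  have "bounded_clinear T"
  proof (rule bounded_clinearI)
    show "T (f + g) = T f + T g" for f g
      unfolding T_def by (subst suminf_add[OF summable summable])
        (simp add: plus_ell2.rep_eq scaleC_add_left)
    show "T (c *\<^sub>C f) = c *\<^sub>C T f" for c f
      unfolding T_def bounded_linear.suminf[OF bounded_linear_scaleC_right summable]
      by (simp add: ell2_nth_scaleC scaleC_scaleC)
    show "norm (T f) \<le> sqrt C * norm f" for f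
    proof (rule LIMSEQ_le_const2)
      show "(\<lambda>N. norm (\<Sum>n<N. ell2_nth f n *\<^sub>C v n)) \<longlonglongrightarrow> norm (T f)"
        using summable_LIMSEQ[OF summable[of f]] unfolding T_def by (intro tendsto_norm)
      have "norm (\<Sum>n<N. ell2_nth f n *\<^sub>C v n) \<le> sqrt C * norm f" for N
      proof (rule power2_le_imp_le)
        have "(norm (\<Sum>n<N. ell2_nth f n *\<^sub>C v n))\<^sup>2 \<le> C * (\<Sum>n<N. (cmod (ell2_nth f n))\<^sup>2)"
          by (rule bessel_le[OF v])
        also have "\<dots> \<le> C * (norm f)\<^sup>2" by (intro mult_left_mono ell2_partial_norm_le C)
        finally show "(norm (\<Sum>n<N. ell2_nth f n *\<^sub>C v n))\<^sup>2 \<le> (sqrt C * norm f)\<^sup>2"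
          using C by (simp add: power_mult_distrib)
      qed (use C in simp)
      then show "\<exists>M. \<forall>N\<ge>M. norm (\<Sum>n<N. ell2_nth f n *\<^sub>C v n) \<le> sqrt C * norm f" by blast
    qed
  qed
  moreover have "T (ell2_basis n) = v n" for n
  proof -
    have "(\<lambda>k. ell2_nth (ell2_basis n) k *\<^sub>C v k) sums (\<Sum>k\<in>{n}. ell2_nth (ell2_basis n) k *\<^sub>C v k)"
      by (rule sums_finite) (auto simp: ell2_nth_basis)
    then show ?thesis by (simp add: T_def sums_iff ell2_nth_basis)
  qed
  ultimately show "bounded_clinear (ell2_op v)" "ell2_op v (ell2_basis n) = v n"
    using ell2_op_eqI[of T v] by auto
qed

lemma bessel_add:
  assumes "bessel v C" "bessel w D"
  shows "bessel (\<lambda>n. v n + w n) (2 * C + 2 * D)"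
  unfolding bessel_def
proof (intro conjI allI)
  show "0 \<le> 2 * C + 2 * D" using assms by (simp add: bessel_def)
  fix c N
  let ?x = "\<Sum>n<N. c n *\<^sub>C v n" and ?y = "\<Sum>n<N. c n *\<^sub>C w n"
  have "(norm (\<Sum>n<N. c n *\<^sub>C (v n + w n)))\<^sup>2 = (norm (?x + ?y))\<^sup>2"
    by (simp add: scaleC_add_right sum.distrib)
  also have "\<dots> \<le> (norm ?x + norm ?y)\<^sup>2" by (intro power_mono norm_triangle_ineq) simp
  also have "\<dots> \<le> 2 * (norm ?x)\<^sup>2 + 2 * (norm ?y)\<^sup>2"
    using sum_squares_bound[of "norm ?x" "norm ?y"] by (simp add: power2_sum)
  also have "\<dots> \<le> (2 * C + 2 * D) * (\<Sum>n<N. (cmod (c n))\<^sup>2)"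
    using bessel_le[OF assms(1), of c N] bessel_le[OF assms(2), of c N]
    by (simp add: distrib_right)
  finally show "(norm (\<Sum>n<N. c n *\<^sub>C (v n + w n)))\<^sup>2 \<le> (2 * C + 2 * D) * (\<Sum>n<N. (cmod (c n))\<^sup>2)" .
qed

text \<open>The images are mutually orthogonal, so the squared norm of a combination is a weighted
  sum of squares. Asking for injectivity only where the weight is nonzero admits the truncated shift
  \<open>n - 1\<close>, which sends both 0 and 1 to 0 but has weight 0 at n = 0.\<close>

lemma bessel_weighted_shift:
  assumes inj: "inj_on p {n. b n \<noteq> 0}" and b: "\<And>n. (cmod (b n))\<^sup>2 \<le> B"
  shows "bessel (\<lambda>n. b n *\<^sub>C ell2_basis (p n)) B"
  unfolding bessel_def
proof (intro conjI allI)
  show "0 \<le> B" using b[of 0] zero_le_power2[of "cmod (b 0)"] by linarith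
  fix c :: "nat \<Rightarrow> complex" and N
  let ?d = "\<lambda>n. c n * b n"
  let ?x = "\<Sum>n<N. c n *\<^sub>C b n *\<^sub>C ell2_basis (p n)"
  have orth: "cinner (?d m *\<^sub>C ell2_basis (p m)) (?d n *\<^sub>C ell2_basis (p n))
      = (if m = n then complex_of_real ((cmod (?d n))\<^sup>2) else 0)" for m n
    using inj_onD[OF inj, of m n]
    by (auto simp: cinner_scaleC_left cinner_scaleC_right cinner_basis ell2_nth_basis
        cnj_mult_self[of "c n * b n", symmetric] simp del: of_real_power)
  have "complex_of_real ((norm ?x)\<^sup>2)
      = (\<Sum>n<N. \<Sum>m<N. cinner (?d m *\<^sub>C ell2_basis (p m)) (?d n *\<^sub>C ell2_basis (p n)))"
    by (simp only: cinner_self[symmetric] cinner_sum_left cinner_sum_right scaleC_scaleC)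
  also have "\<dots> = complex_of_real (\<Sum>n<N. (cmod (?d n))\<^sup>2)"
    unfolding orth by simp
  finally have "(norm ?x)\<^sup>2 = (\<Sum>n<N. (cmod (?d n))\<^sup>2)" by (simp only: of_real_eq_iff)
  also have "\<dots> \<le> (\<Sum>n<N. B * (cmod (c n))\<^sup>2)"
    by (intro sum_mono) (simp add: norm_mult power_mult_distrib b mult_right_mono mult.commute)
  finally show "(norm ?x)\<^sup>2 \<le> B * (\<Sum>n<N. (cmod (c n))\<^sup>2)" by (simp add: sum_distrib_left)
qed

text \<open>The candidate adjoint has the coordinates \<open>s y n\<close>. Testing \<open>T\<close>
  on the finite vector built from these coordinates gives S = \<langle>T x, y\<rangle> \<le> M sqrt
  S |y| for the partial sum S of their squares; cancelling sqrt S bounds S uniformly in N, so the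
  candidate is a square summable sequence.\<close>

lemma cadjoint_ell2:
  fixes T :: "ell2 \<Rightarrow> 'a::complex_inner"
  assumes T: "bounded_clinear T"
  shows "cinner (T x) y = cinner x (cadjoint T y)"
    and "bounded_clinear (cadjoint T)"
    and "ell2_nth (cadjoint T y) n = cinner (T (ell2_basis n)) y"
proof -
  obtain M where M: "M > 0" "\<And>x. norm (T x) \<le> M * norm x"
    using bounded_linear.pos_bounded[OF bounded_clinear_linear[OF T]] by (metis mult.commute)
  define s where "s y n = cinner (T (ell2_basis n)) y" for y n
  have bound: "(\<Sum>n<N. (cmod (s y n))\<^sup>2) \<le> (M * norm y)\<^sup>2" for y N
  proof -
    let ?x = "\<Sum>n<N. s y n *\<^sub>C ell2_basis n" and ?S = "\<Sum>n<N. (cmod (s y n))\<^sup>2"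
    have S0: "0 \<le> ?S" by (simp add: sum_nonneg)
    have "bessel (\<lambda>n. 1 *\<^sub>C ell2_basis n) 1" by (rule bessel_weighted_shift) auto
    from bessel_le[OF this, of "s y" N] have "(norm ?x)\<^sup>2 \<le> ?S" by simp
    then have x: "norm ?x \<le> sqrt ?S" by (rule real_le_rsqrt)
    have "complex_of_real ?S = cinner (T ?x) y"
      by (simp add: linear_sum[OF bounded_linear.linear[OF bounded_clinear_linear[OF T]]] cinner_sum_left
          bounded_clinear_scaleC[OF T] cinner_scaleC_left s_def[symmetric] cnj_mult_self)
    then have "?S = cmod (cinner (T ?x) y)" using S0 by (metis abs_of_nonneg norm_of_real)
    also have "\<dots> \<le> norm (T ?x) * norm y" by (rule norm_cinner_le)
    also have "\<dots> \<le> M * sqrt ?S * norm y"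
      using order.trans[OF M(2)[of ?x] mult_left_mono[OF x]] M(1) by (intro mult_right_mono) auto
    finally have *: "sqrt ?S * sqrt ?S \<le> sqrt ?S * (M * norm y)"
      unfolding real_sqrt_mult_self abs_of_nonneg[OF S0] by (simp only: mult_ac)
    have My: "0 \<le> M * norm y" using M(1) by simp
    have "sqrt ?S \<le> M * norm y"
    proof (cases "sqrt ?S > 0")
      case True
      then show ?thesis using * by (rule mult_left_le_imp_le[rotated])
    next
      case False
      then show ?thesis using My by linarith
    qed
    then show ?thesis by (rule sqrt_le_D)
  qed
  have "summable (\<lambda>n. (cmod (s y n))\<^sup>2)" for y
    by (rule summableI_nonneg_bounded[OF _ bound]) simp
  define S where "S y = Abs_ell2 (s y)" for y
  have nth: "ell2_nth (S y) n = s y n" for y n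
    using \<open>summable (\<lambda>n. (cmod (s y n))\<^sup>2)\<close> by (simp add: S_def Abs_ell2_inverse)
  have adj: "cinner (T x) y = cinner x (S y)" for x y
  proof -
    have "(\<lambda>n. ell2_nth x n * cinner y (T (ell2_basis n))) sums cinner y (T x)"
      using bounded_linear.sums[OF bounded_linear_cinner_right bounded_clinear_expansion[OF T, of x], of y]
      by (simp add: cinner_scaleC_right)
    moreover have "(\<lambda>n. ell2_nth x n * cinner (S y) (ell2_basis n)) sums cinner (S y) x"
      using bounded_linear.sums[OF bounded_linear_cinner_right ell2_expansion[of x], of "S y"]
      by (simp add: cinner_scaleC_right)
    moreover have "cinner (S y) (ell2_basis n) = cinner y (T (ell2_basis n))" for n
      by (metis cinner_commute cinner_basis nth s_def)
    ultimately have "cinner (S y) x = cinner y (T x)" using sums_unique2 by simp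
    then show ?thesis by (metis cinner_commute)
  qed
  then have eq: "cadjoint T = S" by (rule cadjoint_eqI)
  have "ell2_nth (S (f + g)) n = ell2_nth (S f + S g) n" "ell2_nth (S (c *\<^sub>C f)) n = ell2_nth (c *\<^sub>C S f) n"
    for f g c n
    by (simp_all add: nth s_def plus_ell2.rep_eq ell2_nth_scaleC cinner_add_right cinner_scaleC_right)
  then have "S (f + g) = S f + S g" "S (c *\<^sub>C f) = c *\<^sub>C S f" for f g c
    by (metis ell2_nth_inject ext)+
  moreover have "norm (S y) \<le> M * norm y" for y
    by (rule ell2_norm_le) (use bound M in \<open>simp_all add: nth\<close>)
  ultimately have "bounded_clinear S" by (rule bounded_clinearI)
  with adj show "cinner (T x) y = cinner x (cadjoint T y)" "bounded_clinear (cadjoint T)"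
      "ell2_nth (cadjoint T y) n = cinner (T (ell2_basis n)) y"
    by (simp_all add: eq nth s_def)
qed

section \<open>The Jacobi operators \<open>H a\<close>: boundedness and self-adjointness\<close>

lemma ell2_eqI: "(\<And>n. ell2_nth f n = ell2_nth g n) \<Longrightarrow> f = g"
  by (metis ell2_nth_inject ext)

lemma selfadjointI:
  assumes A: "bounded_clinear A"
    and sym: "\<And>m n. cnj (ell2_nth (A (ell2_basis m)) n) = ell2_nth (A (ell2_basis n)) m"
  shows "cinner (A x) y = cinner x (A y)"
proof -
  have "ell2_nth (cadjoint A (ell2_basis n)) m = ell2_nth (A (ell2_basis n)) m" for m n
    by (metis sym cadjoint_ell2(3)[OF A] cinner_basis cinner_commute)
  then have "cadjoint A (ell2_basis n) = A (ell2_basis n)" for n by (rule ell2_eqI)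
  then have "cadjoint A y = A y"
    by (rule bounded_clinear_eq_on_basis[OF cadjoint_ell2(2)[OF A] A])
  then show ?thesis using cadjoint_ell2(1)[OF A, of x y] by simp
qed

text \<open>The operator is split into a lowering and a raising weighted shift. The coefficients are
  written exactly as in \<open>psi_recurrence\<close>, so that the intertwining relation reduces to
  matching the two three-term formulas.\<close>

lemma
  fixes a :: real
  defines "v \<equiv> \<lambda>n. complex_of_real (if n = 0 then 0 else if n = 1 then a / 2 else 1 / 2) *\<^sub>C ell2_basis (n - 1)
      + complex_of_real (if n = 0 then a / 2 else 1 / 2) *\<^sub>C ell2_basis (n + 1)"
  shows bounded_clinear_H: "bounded_clinear (H a)" and H_basis: "H a (ell2_basis n) = v n"
proof -
  let ?B = "max ((a / 2)\<^sup>2) ((1 / 2)\<^sup>2)"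
  have "bessel v (2 * ?B + 2 * ?B)"
    unfolding v_def by (intro bessel_add bessel_weighted_shift) (auto simp: inj_on_def le_max_iff_disj split: if_splits)
  moreover have "H a = ell2_op v"
    unfolding H_def v_def
    by (intro arg_cong[of _ _ ell2_op] ext)
       (auto simp: scaleR_scaleC scaleC_scaleC scaleC_add_right numeral_2_eq_2)
  ultimately show "bounded_clinear (H a)" "H a (ell2_basis n) = v n"
    using ell2_op_bessel[of v] by auto
qed

lemma H_selfadjoint: "cinner (H a x) y = cinner x (H a y)"
  by (rule selfadjointI[OF bounded_clinear_H])
     (auto simp: H_basis plus_ell2.rep_eq ell2_nth_scaleC ell2_nth_basis)


section \<open>Multiplication operators\<close>

definition bounded_symbol :: "(real \<Rightarrow> complex) \<Rightarrow> real \<Rightarrow> bool" where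
  "bounded_symbol \<phi> K \<longleftrightarrow> \<phi> \<in> borel_measurable leb \<and> 0 \<le> K \<and> (\<forall>x\<in>{-1<..<1}. cmod (\<phi> x) \<le> K)"

lemma square_integrable_mult:
  assumes "bounded_symbol \<phi> K" "square_integrable f"
  shows "square_integrable (\<lambda>x. \<phi> x * f x)"
  unfolding square_integrable_def
proof (intro conjI)
  have [measurable]: "f \<in> borel_measurable leb" "\<phi> \<in> borel_measurable leb"
    using assms by (simp_all add: square_integrable_def bounded_symbol_def)
  show "(\<lambda>x. \<phi> x * f x) \<in> borel_measurable leb" by measurable
  show "integrable leb (\<lambda>x. (cmod (\<phi> x * f x))\<^sup>2)"
  proof (rule Bochner_Integration.integrable_bound)
    show "integrable leb (\<lambda>x. K\<^sup>2 * (cmod (f x))\<^sup>2)"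
      using assms(2) by (simp add: square_integrable_def)
    show "AE x in leb. norm ((cmod (\<phi> x * f x))\<^sup>2) \<le> norm (K\<^sup>2 * (cmod (f x))\<^sup>2)"
      using assms(1) by (intro AE_I2)
        (auto simp: bounded_symbol_def norm_mult power_mult_distrib intro!: mult_right_mono power_mono)
  qed measurable
qed

text \<open>\<open>mult_op\<close> multiplies a representative picked by \<open>rep_L2\<close>; for
  a bounded symbol the choice does not affect the class, which lets all later computations use
  explicit functions.\<close>

lemma mult_op_class:
  assumes "bounded_symbol \<phi> K" "square_integrable f"
  shows "mult_op \<phi> (L2_class f) = L2_class (\<lambda>x. \<phi> x * f x)"
  unfolding mult_op_def
  by (rule L2_class_AE_eqI)
     (use rep_L2_class[OF assms(2)] in \<open>auto intro!: square_integrable_mult[OF assms(1)] assms(2)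
        square_integrable_rep_L2 elim: eventually_mono\<close>)

lemma norm_mult_op_le:
  assumes "bounded_symbol \<phi> K"
  shows "norm (mult_op \<phi> g) \<le> K * norm g"
proof (cases g rule: L2_cases)
  case (1 f)
  have "(norm (mult_op \<phi> g))\<^sup>2 = (\<integral>x. (cmod (\<phi> x * f x))\<^sup>2 \<partial>leb)"
    by (simp add: 1 mult_op_class[OF assms] norm_L2_class square_integrable_mult[OF assms])
  also have "\<dots> \<le> (\<integral>x. K\<^sup>2 * (cmod (f x))\<^sup>2 \<partial>leb)"
  proof (rule integral_mono)
    show "integrable leb (\<lambda>x. (cmod (\<phi> x * f x))\<^sup>2)"
      using square_integrable_mult[OF assms 1(1)] by (simp add: square_integrable_def)
    show "integrable leb (\<lambda>x. K\<^sup>2 * (cmod (f x))\<^sup>2)" using 1(1) by (simp add: square_integrable_def)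
    show "(cmod (\<phi> x * f x))\<^sup>2 \<le> K\<^sup>2 * (cmod (f x))\<^sup>2" if "x \<in> space leb" for x
      using assms that
      by (auto simp: bounded_symbol_def norm_mult power_mult_distrib intro!: mult_right_mono power_mono)
  qed
  also have "\<dots> = (K * norm g)\<^sup>2" by (simp add: 1 norm_L2_class power_mult_distrib)
  finally show ?thesis
    by (rule power2_le_imp_le) (use assms in \<open>simp add: bounded_symbol_def\<close>)
qed

lemma bounded_clinear_mult_op:
  assumes "bounded_symbol \<phi> K"
  shows "bounded_clinear (mult_op \<phi>)"
proof (rule bounded_clinearI)
  note sq = square_integrable_mult[OF assms] square_integrable_add square_integrable_scaleC
  fix x y and c
  obtain f g where f: "square_integrable f" "x = L2_class f" and g: "square_integrable g" "y = L2_class g"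
    using L2_cases by metis
  show "mult_op \<phi> (x + y) = mult_op \<phi> x + mult_op \<phi> y"
    by (simp add: f g L2_class_add mult_op_class[OF assms] sq distrib_left)
  show "mult_op \<phi> (c *\<^sub>C x) = c *\<^sub>C mult_op \<phi> x"
    by (simp add: f L2_class_scaleC mult_op_class[OF assms] sq mult.left_commute)
  show "norm (mult_op \<phi> x) \<le> K * norm x" by (rule norm_mult_op_le[OF assms])
qed

lemma bounded_symbol_mult:
  assumes "bounded_symbol \<phi> K" "bounded_symbol \<eta> L"
  shows "bounded_symbol (\<lambda>x. \<phi> x * \<eta> x) (K * L)"
  using assms by (auto simp: bounded_symbol_def norm_mult intro!: mult_mono)

lemma mult_op_mult_op:
  assumes "bounded_symbol \<phi> K" "bounded_symbol \<eta> L"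
  shows "mult_op \<phi> (mult_op \<eta> g) = mult_op (\<lambda>x. \<phi> x * \<eta> x) g"
  by (cases g rule: L2_cases)
     (simp add: mult_op_class[OF assms(1)] mult_op_class[OF assms(2)]
       mult_op_class[OF bounded_symbol_mult[OF assms]] square_integrable_mult[OF assms(2)] mult.assoc)

lemma mult_op_cong:
  assumes "bounded_symbol \<phi> K" "bounded_symbol \<eta> L" "\<And>x. x \<in> {-1<..<1} \<Longrightarrow> \<phi> x = \<eta> x"
  shows "mult_op \<phi> g = mult_op \<eta> g"
  unfolding mult_op_def
  by (rule L2_class_eqI) (auto simp: assms(3) intro!: square_integrable_mult[OF assms(1)]
      square_integrable_mult[OF assms(2)] square_integrable_rep_L2)

lemma mult_op_one: "mult_op (\<lambda>_. 1) g = g"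
  by (simp add: mult_op_def L2_class_rep)

lemma measurable_cnj: "\<phi> \<in> borel_measurable M \<Longrightarrow> (\<lambda>x. cnj (\<phi> x)) \<in> borel_measurable M"
  by (rule borel_measurable_continuous_on[OF continuous_on_cnj[OF continuous_on_id]])

lemma bounded_symbol_cnj: "bounded_symbol \<phi> K \<Longrightarrow> bounded_symbol (\<lambda>x. cnj (\<phi> x)) K"
  by (simp add: bounded_symbol_def measurable_cnj)

lemma cinner_mult_op:
  assumes "bounded_symbol \<phi> K"
  shows "cinner (mult_op \<phi> f) g = cinner f (mult_op (\<lambda>x. cnj (\<phi> x)) g)"
proof -
  obtain u v where u: "square_integrable u" "f = L2_class u" and v: "square_integrable v" "g = L2_class v"
    using L2_cases by metis
  note b = assms bounded_symbol_cnj[OF assms]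
  have "cinner (mult_op \<phi> f) g = (\<integral>x. cnj (\<phi> x * u x) * v x \<partial>leb)"
    by (simp only: u v mult_op_class[OF b(1)] square_integrable_mult[OF b(1)] cinner_L2_class)
  also have "\<dots> = (\<integral>x. cnj (u x) * (cnj (\<phi> x) * v x) \<partial>leb)"
    by (simp add: mult_ac)
  also have "\<dots> = cinner f (mult_op (\<lambda>x. cnj (\<phi> x)) g)"
    by (simp only: u v mult_op_class[OF b(2)] square_integrable_mult[OF b(2)] cinner_L2_class)
  finally show ?thesis .
qed

lemma unitary_mult_op:
  assumes m: "\<phi> \<in> borel_measurable leb" and one: "\<And>x. x \<in> {-1<..<1} \<Longrightarrow> cmod (\<phi> x) = 1"
  shows "unitary (mult_op \<phi>)"
proof -
  have b: "bounded_symbol \<phi> 1" using m one by (simp add: bounded_symbol_def)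
  have b': "bounded_symbol (\<lambda>x. cnj (\<phi> x)) 1" by (rule bounded_symbol_cnj[OF b])
  have b1: "bounded_symbol (\<lambda>_. 1) 1" by (simp add: bounded_symbol_def)
  have u: "cnj (\<phi> x) * \<phi> x = 1" if "x \<in> {-1<..<1}" for x
    using one[OF that] by (simp add: cnj_mult_self)
  have inv: "mult_op (\<lambda>x. cnj (\<phi> x)) (mult_op \<phi> g) = g" "mult_op \<phi> (mult_op (\<lambda>x. cnj (\<phi> x)) g) = g" for g
    using mult_op_cong[OF bounded_symbol_mult[OF b' b] b1, of g]
      mult_op_cong[OF bounded_symbol_mult[OF b b'] b1, of g] u
    by (simp_all add: mult_op_mult_op[OF b' b] mult_op_mult_op[OF b b'] mult_op_one mult.commute)
  show ?thesis
    unfolding unitary_def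
    by (intro conjI allI surjI[of _ "mult_op (\<lambda>x. cnj (\<phi> x))"])
       (simp_all add: bounded_clinear_mult_op[OF b] inv cinner_mult_op[OF b])
qed

section \<open>The exponential of multiplication by the variable, as a norm convergent
  series\<close>

lemma exp_remainder_le:
  fixes z :: complex
  assumes "cmod z \<le> r"
  shows "cmod (exp z - (\<Sum>k<N. z ^ k / fact k)) \<le> exp r - (\<Sum>k<N. r ^ k / fact k)"
proof -
  have z: "(\<lambda>k. z ^ k / fact k) sums exp z" and r: "(\<lambda>k. r ^ k / fact k) sums exp r"
    using exp_converges[of z] exp_converges[of r]
    by (simp_all add: scaleR_conv_of_real divide_inverse mult.commute)
  have le: "norm (z ^ (k + N) / fact (k + N)) \<le> r ^ (k + N) / fact (k + N)" for k
    using assms by (simp add: norm_divide norm_power divide_right_mono power_mono)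
  have s: "summable (\<lambda>k. r ^ (k + N) / fact (k + N))"
    using r by (intro summable_ignore_initial_segment) (simp add: sums_iff)
  have "exp z - (\<Sum>k<N. z ^ k / fact k) = (\<Sum>k. z ^ (k + N) / fact (k + N))"
    using suminf_minus_initial_segment[of "\<lambda>k. z ^ k / fact k" N] z by (simp add: sums_iff)
  also have "cmod \<dots> \<le> (\<Sum>k. r ^ (k + N) / fact (k + N))"
    by (rule norm_suminf_le[OF le s])
  also have "\<dots> = exp r - (\<Sum>k<N. r ^ k / fact k)"
    using suminf_minus_initial_segment[of "\<lambda>k. r ^ k / fact k" N] r by (simp add: sums_iff)
  finally show ?thesis .
qed

lemma bounded_symbol_continuous:
  assumes "continuous_on {-1<..<1} \<phi>" "0 \<le> K" "\<And>x. x \<in> {-1<..<1} \<Longrightarrow> cmod (\<phi> x) \<le> K"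
  shows "bounded_symbol \<phi> K"
  using assms continuous_imp_measurable_on_sets_lebesgue[OF assms(1)] by (simp add: bounded_symbol_def)

lemma bounded_symbol_id: "bounded_symbol complex_of_real 1"
  by (rule bounded_symbol_continuous) (auto intro!: continuous_intros)

lemma bounded_symbol_exp: "bounded_symbol (\<lambda>l. exp (c * complex_of_real l)) (exp (cmod c))"
proof (rule bounded_symbol_continuous)
  fix x :: real assume "x \<in> {-1<..<1}"
  then have "cmod c * \<bar>x\<bar> \<le> cmod c" using mult_left_mono[of "\<bar>x\<bar>" 1 "cmod c"] by (auto simp: abs_le_iff)
  then have "cmod (c * complex_of_real x) \<le> cmod c" by (simp add: norm_mult)
  then show "cmod (exp (c * complex_of_real x)) \<le> exp (cmod c)"
    by (intro order.trans[OF norm_exp]) simp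
qed (auto intro!: continuous_intros)

text \<open>The partial sum minus the limit is again a multiplication operator, by the Taylor
  remainder of the exponential. On the interval this remainder is bounded by that of the real
  exponential at |c|, which tends to 0.\<close>

lemma exp_term_mult_op_sums:
  "exp_term (mult_op complex_of_real) c g sums mult_op (\<lambda>l. exp (c * complex_of_real l)) g"
proof -
  obtain f where f: "square_integrable f" "g = L2_class f" by (rule L2_cases)
  let ?r = "\<lambda>N. exp (cmod c) - (\<Sum>k<N. cmod c ^ k / fact k)"
  have pow: "square_integrable (\<lambda>x. complex_of_real x ^ k * f x)
      \<and> (mult_op complex_of_real ^^ k) g = L2_class (\<lambda>x. complex_of_real x ^ k * f x)" for k
  proof (induction k)
    case (Suc k)
    then show ?case
      using square_integrable_mult[OF bounded_symbol_id, of "\<lambda>x. complex_of_real x ^ k * f x"]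
        mult_op_class[OF bounded_symbol_id, of "\<lambda>x. complex_of_real x ^ k * f x"]
      by (simp add: mult.assoc)
  qed (simp add: f)
  have sq: "square_integrable (\<lambda>x. c ^ k / fact k * (complex_of_real x ^ k * f x))" for k
    using pow by (intro square_integrable_scaleC) simp
  have sqe: "square_integrable (\<lambda>x. exp (c * complex_of_real x) * f x)"
    by (rule square_integrable_mult[OF bounded_symbol_exp f(1)])
  have bound: "norm ((\<Sum>k<N. exp_term (mult_op complex_of_real) c g k) - mult_op (\<lambda>l. exp (c * complex_of_real l)) g)
      \<le> ?r N * norm g" for N
  proof -
    let ?\<phi> = "\<lambda>x. (\<Sum>k<N. (c * complex_of_real x) ^ k / fact k) - exp (c * complex_of_real x)"
    have le: "cmod (?\<phi> x) \<le> ?r N" if "x \<in> {-1<..<1}" for x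
    proof -
      have "cmod c * \<bar>x\<bar> \<le> cmod c"
        using that mult_left_mono[of "\<bar>x\<bar>" 1 "cmod c"] by (auto simp: abs_le_iff)
      then show ?thesis
        using exp_remainder_le[of "c * complex_of_real x" "cmod c" N]
        by (simp add: norm_mult norm_minus_commute)
    qed
    have "0 \<le> ?r N" by (rule order.trans[OF norm_ge_zero le[of 0]]) simp
    with le have b: "bounded_symbol ?\<phi> (?r N)"
      by (intro bounded_symbol_continuous) (auto intro!: continuous_intros)
    have "exp_term (mult_op complex_of_real) c g k = L2_class (\<lambda>x. c ^ k / fact k * (complex_of_real x ^ k * f x))"
      for k
      using pow[of k] by (simp only: exp_term_def L2_class_scaleC)
    then have "(\<Sum>k<N. exp_term (mult_op complex_of_real) c g k) - mult_op (\<lambda>l. exp (c * complex_of_real l)) g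
        = L2_class (\<lambda>x. (\<Sum>k<N. c ^ k / fact k * (complex_of_real x ^ k * f x)) - exp (c * complex_of_real x) * f x)"
      by (simp only: f(2) L2_class_sum[OF sq] mult_op_class[OF bounded_symbol_exp f(1)]
          L2_class_diff[OF square_integrable_sum[OF sq] sqe])
    also have "\<dots> = mult_op ?\<phi> g"
      unfolding f(2) mult_op_class[OF b f(1)]
      by (rule arg_cong[of _ _ L2_class])
         (simp add: fun_eq_iff right_diff_distrib sum_distrib_left power_mult_distrib mult_ac)
    finally show ?thesis using norm_mult_op_le[OF b, of g] by simp
  qed
  have "?r \<longlonglongrightarrow> exp (cmod c) - exp (cmod c)"
  proof (intro tendsto_intros)
    show "(\<lambda>N. \<Sum>k<N. cmod c ^ k / fact k) \<longlonglongrightarrow> exp (cmod c)"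
      using exp_converges[of "cmod c"] by (simp add: sums_def divide_inverse mult.commute)
  qed
  then have lim: "(\<lambda>N. ?r N * norm g) \<longlonglongrightarrow> 0"
    using tendsto_mult_right[of ?r 0 sequentially "norm g"] by simp
  show ?thesis
    unfolding sums_def
    by (rule LIM_zero_cancel, rule Lim_null_comparison[OF always_eventually lim]) (intro allI bound)
qed


section \<open>Oscillatory integrals\<close>

definition osc :: "real \<Rightarrow> real \<Rightarrow> (real \<Rightarrow> complex) \<Rightarrow> complex" where
  "osc n t h = integral {0..pi} (\<lambda>x. exp (\<i> * complex_of_real (n * x - t * cos x)) * h x)"

text \<open>The integral of the reciprocal of the phase derivative. One quantity serves both needs
  of dominated convergence: it is at most pi / n for all t \<ge> 0, and for fixed n it tends to 0 as
  t grows.\<close>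

definition osc_bound :: "real \<Rightarrow> real \<Rightarrow> real" where
  "osc_bound n t = integral {0..pi} (\<lambda>x. 1 / (n + t * sin x))"

lemma phase_pos: "n > 0 \<Longrightarrow> t \<ge> 0 \<Longrightarrow> x \<in> {0..pi} \<Longrightarrow> n \<le> n + t * sin x"
  by (simp add: sin_ge_zero)

lemma osc_bound_integrable:
  assumes "n > 0" "t \<ge> 0"
  shows "(\<lambda>x. 1 / (n + t * sin x)) integrable_on {0..pi}"
  using phase_pos[OF assms] assms(1)
  by (intro integrable_continuous_interval continuous_intros) fastforce

lemma osc_bound_le:
  assumes "n > 0" "t \<ge> 0"
  shows "osc_bound n t \<le> pi / n"
proof -
  have "osc_bound n t \<le> integral {0..pi} (\<lambda>_. 1 / n)"
    unfolding osc_bound_def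
    by (rule integral_le[OF osc_bound_integrable[OF assms]])
       (use phase_pos[OF assms] assms(1) in \<open>fastforce intro: frac_le\<close>)+
  then show ?thesis by simp
qed

lemma osc_bound_tendsto:
  assumes "n > 0"
  shows "(osc_bound n \<longlongrightarrow> 0) at_top"
proof -
  have "((\<lambda>t. osc_bound n (max 0 t)) \<longlongrightarrow> 0) at_top"
  proof (rule tendsto_at_topI_sequentially)
    fix X :: "nat \<Rightarrow> real" assume X: "filterlim X at_top sequentially"
    \<comment> \<open>At the endpoints the sine vanishes and the integrand stays 1 / n for every t,
      so the values there are replaced by 0. Clamping at 0 keeps the denominator at least n along
      the whole sequence.\<close>
    let ?f = "\<lambda>k x. if x \<in> {0<..<pi} then 1 / (n + max 0 (X k) * sin x) else 0"
    have eq: "integral {0..pi} (?f k) = osc_bound n (max 0 (X k))" for k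
      unfolding osc_bound_def by (rule integral_spike[of "{0, pi}"]) auto
    have int: "?f k integrable_on {0..pi}" for k
      by (rule integrable_spike[OF osc_bound_integrable[OF assms, of "max 0 (X k)"], of "{0, pi}"]) auto
    have "(\<lambda>k. integral {0..pi} (?f k)) \<longlonglongrightarrow> integral {0..pi} (\<lambda>_. 0)"
    proof (rule dominated_convergence(2)[where h = "\<lambda>_. 1 / n"])
      show "norm (?f k x) \<le> 1 / n" if "x \<in> {0..pi}" for k x
        using phase_pos[OF assms, of "max 0 (X k)" x] assms that by (auto intro!: frac_le)
      show "(\<lambda>k. ?f k x) \<longlonglongrightarrow> 0" if "x \<in> {0..pi}" for x
      proof (cases "x \<in> {0<..<pi}")
        case True
        then have s: "sin x > 0" by (simp add: sin_gt_zero)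
        have "filterlim (\<lambda>k. max 0 (X k)) at_top sequentially"
          by (rule filterlim_at_top_mono[OF X]) simp
        then have "filterlim (\<lambda>k. n + max 0 (X k) * sin x) at_top sequentially"
          using s by (intro filterlim_tendsto_add_at_top[OF tendsto_const]
              filterlim_at_top_mult_tendsto_pos[OF tendsto_const])
        then have "(\<lambda>k. 1 / (n + max 0 (X k) * sin x)) \<longlonglongrightarrow> 0"
          by (intro tendsto_divide_0[OF tendsto_const] filterlim_at_top_imp_at_infinity)
        then show ?thesis using True by simp
      next
        case False
        then show ?thesis by (simp only: if_False tendsto_const)
      qed
    qed (use int in auto)
    then show "(\<lambda>k. osc_bound n (max 0 (X k))) \<longlonglongrightarrow> 0" unfolding eq by simp
  qed
  then show ?thesis
    by (rule Lim_transform_eventually)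
       (use eventually_ge_at_top[of 0] in \<open>eventually_elim, simp\<close>)
qed

text \<open>On the half-line \<open>n > 0\<close>, \<open>t \<ge> 0\<close> the phase \<open>n x - t cos x\<close> has no stationary point, and its
  derivative dominates both \<open>n\<close> and \<open>t sin x\<close>; integrate by parts once.\<close>

lemma osc_le:
  assumes h: "continuous_on {0..pi} h"
    and h': "\<And>x. x \<in> {0<..<pi} \<Longrightarrow> (h has_vector_derivative h' x) (at x)"
    and K': "\<And>x. cmod (h' x) \<le> K" and K: "\<And>x. x \<in> {0..pi} \<Longrightarrow> cmod (h x) \<le> K * sin x"
    and n: "n > 0" and t: "t \<ge> 0"
  shows "cmod (osc n t h) \<le> 2 * K * osc_bound n t"
proof -
  define E where "E x = exp (\<i> * complex_of_real (n * x - t * cos x))" for x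
  define p where "p x = n + t * sin x" for x
  have p: "p x > 0" "t * sin x \<le> p x" if "x \<in> {0..pi}" for x
    using phase_pos[OF n t that] n by (auto simp: p_def)
  \<comment> \<open>With \<open>G\<close> = E h / p the product rule gives G' = i E h + r, so
    \<open>r\<close> is what remains of the oscillatory integral after the integration by
    parts.\<close>
  define r where "r x = E x * (h' x * complex_of_real (1 / p x) - h x * complex_of_real (t * cos x / (p x)\<^sup>2))" for x
  define G where "G x = E x * (h x * complex_of_real (1 / p x))" for x
  have dE: "(E has_vector_derivative \<i> * complex_of_real (p x) * E x) (at x)" for x
  proof -
    have "((\<lambda>x. \<i> * complex_of_real (n * x - t * cos x)) has_vector_derivative \<i> * complex_of_real (p x)) (at x)"
      unfolding p_def by (auto intro!: derivative_eq_intros has_vector_derivative_of_real)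
    from field_vector_diff_chain_at[OF this DERIV_exp]
    show ?thesis unfolding E_def o_def by (simp add: mult_ac)
  qed
  have "((\<lambda>x. \<i> * (E x * h x) + r x) has_integral G pi - G 0) {0..pi}"
  proof (rule fundamental_theorem_of_calculus_interior)
    have "continuous_on {0..pi} E" unfolding E_def by (intro continuous_intros)
    moreover have "continuous_on {0..pi} (\<lambda>x. complex_of_real (1 / p x))"
      using p(1) unfolding p_def by (intro continuous_intros) force
    ultimately show "continuous_on {0..pi} G" unfolding G_def by (intro continuous_on_mult h)
    fix x :: real assume x: "x \<in> {0<..<pi}"
    then have px: "p x > 0" using p(1)[of x] by simp
    have "((\<lambda>x. 1 / p x) has_real_derivative - (t * cos x / (p x)\<^sup>2)) (at x)"
      using px unfolding p_def by (auto intro!: derivative_eq_intros simp: power2_eq_square)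
    then have dp: "((\<lambda>x. complex_of_real (1 / p x)) has_vector_derivative complex_of_real (- (t * cos x / (p x)\<^sup>2))) (at x)"
      by (intro has_vector_derivative_of_real) (simp add: has_real_derivative_iff_has_vector_derivative)
    have "(G has_vector_derivative E x * (h x * complex_of_real (- (t * cos x / (p x)\<^sup>2)) + h' x * complex_of_real (1 / p x))
        + \<i> * complex_of_real (p x) * E x * (h x * complex_of_real (1 / p x))) (at x)"
      unfolding G_def by (intro has_vector_derivative_mult dE dp h' x)
    also have "E x * (h x * complex_of_real (- (t * cos x / (p x)\<^sup>2)) + h' x * complex_of_real (1 / p x))
        + \<i> * complex_of_real (p x) * E x * (h x * complex_of_real (1 / p x)) = \<i> * (E x * h x) + r x"
      using px by (simp add: r_def field_simps)
    finally show "(G has_vector_derivative \<i> * (E x * h x) + r x) (at x)" .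
  qed simp
  \<comment> \<open>The bound by \<open>K * sin x\<close> forces \<open>h\<close> to vanish at both
    endpoints.\<close>
  moreover have "G pi - G 0 = 0" using K[of 0] K[of pi] by (simp add: G_def)
  moreover have osc: "((\<lambda>x. E x * h x) has_integral osc n t h) {0..pi}"
    unfolding osc_def E_def
    by (intro integrable_integral integrable_continuous_interval continuous_intros h)
  then have "((\<lambda>x. \<i> * (E x * h x)) has_integral \<i> * osc n t h) {0..pi}"
    by (rule has_integral_mult_right)
  ultimately have "((\<lambda>x. (\<i> * (E x * h x) + r x) - \<i> * (E x * h x)) has_integral 0 - \<i> * osc n t h) {0..pi}"
    by (intro has_integral_diff) auto
  then have r: "(r has_integral - \<i> * osc n t h) {0..pi}" by simp
  have "norm (integral {0..pi} r) \<le> integral {0..pi} (\<lambda>x. 2 * K * (1 / (n + t * sin x)))"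
  proof (rule integral_norm_bound_integral)
    show "r integrable_on {0..pi}" using r by (rule has_integral_integrable)
    show "(\<lambda>x. 2 * K * (1 / (n + t * sin x))) integrable_on {0..pi}"
      by (intro integrable_on_mult_right osc_bound_integrable n t)
    fix x :: real assume x: "x \<in> {0..pi}"
    have K0: "0 \<le> K" using K'[of 0] norm_ge_zero order.trans by blast
    \<comment> \<open>Near the endpoints t / p^2 is of size t / n^2, unbounded in t. The factor sin
      x in the bound for \<open>h\<close> turns t into t sin x \<le> p, which cancels one power of
      p.\<close>
    have "cmod (h x * complex_of_real (t * cos x / (p x)\<^sup>2)) = cmod (h x) * (t * \<bar>cos x\<bar> / (p x)\<^sup>2)"
      using t by (simp add: norm_mult norm_divide abs_mult norm_power)
    also have "\<dots> \<le> (K * sin x) * (t * 1 / (p x)\<^sup>2)"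
      using t x by (intro mult_mono divide_right_mono K) (auto simp: K0 sin_ge_zero)
    also have "\<dots> = K * (t * sin x) / (p x)\<^sup>2" by (simp add: mult_ac)
    also have "\<dots> \<le> K * p x / (p x)\<^sup>2"
      using p[OF x] K0 by (intro divide_right_mono mult_left_mono) auto
    also have "\<dots> = K * (1 / p x)" using p(1)[OF x] by (simp add: power2_eq_square)
    finally have "cmod (h x * complex_of_real (t * cos x / (p x)\<^sup>2)) \<le> K * (1 / p x)" .
    moreover have "cmod (h' x * complex_of_real (1 / p x)) \<le> K * (1 / p x)"
      using p(1)[OF x] K'[of x] by (simp add: norm_mult norm_divide divide_right_mono)
    moreover have "cmod (E x) = 1" by (simp only: E_def norm_exp_i_times)
    ultimately show "norm (r x) \<le> 2 * K * (1 / (n + t * sin x))"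
      unfolding r_def norm_mult[of "E x"] p_def[symmetric]
      using norm_triangle_ineq4[of "h' x * complex_of_real (1 / p x)" "h x * complex_of_real (t * cos x / (p x)\<^sup>2)"]
      by simp
  qed
  also have "\<dots> = 2 * K * osc_bound n t" by (simp only: osc_bound_def integral_mult_right)
  also have "integral {0..pi} r = - \<i> * osc n t h" using r by (rule integral_unique)
  finally show ?thesis by (simp add: norm_mult)
qed

text \<open>A substitute for C^1 up to the boundary that needs no one-sided derivatives: boundedness
  of the derivative inside and continuity on the closed interval are what the integration by parts
  consumes. Closure under sums, products and inverses lets amplitudes be checked from their
  structure alone.\<close>

definition bdd_C1 :: "(real \<Rightarrow> complex) \<Rightarrow> bool" where
  "bdd_C1 h \<longleftrightarrow> continuous_on {0..pi} h \<and>
     (\<exists>K. \<forall>x\<in>{0<..<pi}. \<exists>d. (h has_vector_derivative d) (at x) \<and> cmod d \<le> K)"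

lemma bdd_C1_bounded:
  assumes "bdd_C1 h"
  obtains B where "B \<ge> 0" "\<And>x. x \<in> {0..pi} \<Longrightarrow> cmod (h x) \<le> B"
proof -
  have "compact (h ` {0..pi})" using assms unfolding bdd_C1_def by (intro compact_continuous_image) auto
  then obtain B where "\<forall>y\<in>h ` {0..pi}. norm y \<le> B" using compact_imp_bounded bounded_iff by metis
  then show ?thesis by (intro that[of "max 0 B"]) (auto simp: le_max_iff_disj)
qed

lemma bdd_C1I:
  assumes "\<And>x. (h has_vector_derivative h' x) (at x)" "continuous_on {0..pi} h'"
  shows "bdd_C1 h"
proof -
  have "compact (h' ` {0..pi})" using assms by (intro compact_continuous_image) auto
  then obtain B where "\<forall>y\<in>h' ` {0..pi}. norm y \<le> B" using compact_imp_bounded bounded_iff by metis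
  moreover have "continuous_on {0..pi} h"
    by (rule continuous_at_imp_continuous_on) (use assms(1) has_vector_derivative_continuous in blast)
  ultimately show ?thesis using assms(1) unfolding bdd_C1_def by fastforce
qed

lemma bdd_C1_mult:
  assumes f: "bdd_C1 f" and g: "bdd_C1 g"
  shows "bdd_C1 (\<lambda>x. f x * g x)"
proof -
  obtain B where B: "B \<ge> 0" "\<And>x. x \<in> {0..pi} \<Longrightarrow> cmod (f x) \<le> B" using bdd_C1_bounded[OF f] by blast
  obtain C where C: "C \<ge> 0" "\<And>x. x \<in> {0..pi} \<Longrightarrow> cmod (g x) \<le> C" using bdd_C1_bounded[OF g] by blast
  obtain K where K: "\<And>x. x \<in> {0<..<pi} \<Longrightarrow> \<exists>d. (f has_vector_derivative d) (at x) \<and> cmod d \<le> K"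
    using f unfolding bdd_C1_def by blast
  obtain L where L: "\<And>x. x \<in> {0<..<pi} \<Longrightarrow> \<exists>d. (g has_vector_derivative d) (at x) \<and> cmod d \<le> L"
    using g unfolding bdd_C1_def by blast
  have "\<exists>d. ((\<lambda>x. f x * g x) has_vector_derivative d) (at x) \<and> cmod d \<le> B * L + K * C" if x: "x \<in> {0<..<pi}" for x
  proof -
    obtain d where d: "(f has_vector_derivative d) (at x)" "cmod d \<le> K" using K[OF x] by blast
    obtain e where e: "(g has_vector_derivative e) (at x)" "cmod e \<le> L" using L[OF x] by blast
    have "cmod (f x * e + d * g x) \<le> cmod (f x) * cmod e + cmod d * cmod (g x)"
      by (metis norm_mult norm_triangle_ineq)
    also have "\<dots> \<le> B * L + K * C"
      using B C d e x order.trans[OF norm_ge_zero d(2)] by (intro add_mono mult_mono) auto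
    finally show ?thesis using has_vector_derivative_mult[OF d(1) e(1)] by blast
  qed
  moreover have "continuous_on {0..pi} (\<lambda>x. f x * g x)"
    using f g unfolding bdd_C1_def by (intro continuous_on_mult) auto
  ultimately show ?thesis unfolding bdd_C1_def by blast
qed

lemma bdd_C1_add:
  assumes f: "bdd_C1 f" and g: "bdd_C1 g"
  shows "bdd_C1 (\<lambda>x. f x + g x)"
proof -
  obtain K where K: "\<And>x. x \<in> {0<..<pi} \<Longrightarrow> \<exists>d. (f has_vector_derivative d) (at x) \<and> cmod d \<le> K"
    using f unfolding bdd_C1_def by blast
  obtain L where L: "\<And>x. x \<in> {0<..<pi} \<Longrightarrow> \<exists>d. (g has_vector_derivative d) (at x) \<and> cmod d \<le> L"
    using g unfolding bdd_C1_def by blast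
  have "\<exists>d. ((\<lambda>x. f x + g x) has_vector_derivative d) (at x) \<and> cmod d \<le> K + L" if x: "x \<in> {0<..<pi}" for x
    using K[OF x] L[OF x] has_vector_derivative_add norm_triangle_mono by metis
  moreover have "continuous_on {0..pi} (\<lambda>x. f x + g x)"
    using f g unfolding bdd_C1_def by (intro continuous_on_add) auto
  ultimately show ?thesis unfolding bdd_C1_def by blast
qed

lemma bdd_C1_const: "bdd_C1 (\<lambda>_. c)"
  by (rule bdd_C1I[where h' = "\<lambda>_. 0"]) auto

lemma bdd_C1_diff: "bdd_C1 f \<Longrightarrow> bdd_C1 g \<Longrightarrow> bdd_C1 (\<lambda>x. f x - g x)"
  using bdd_C1_add[of f "\<lambda>x. - 1 * g x"] bdd_C1_mult[OF bdd_C1_const, of g "-1"] by simp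

lemma bdd_C1_exp: "bdd_C1 (\<lambda>x. exp (\<i> * complex_of_real (c * x)))"
proof (rule bdd_C1I)
  fix x
  have "((\<lambda>x. \<i> * complex_of_real (c * x)) has_vector_derivative \<i> * complex_of_real c) (at x)"
    by (auto intro!: derivative_eq_intros has_vector_derivative_of_real)
  from field_vector_diff_chain_at[OF this DERIV_exp]
  show "((\<lambda>x. exp (\<i> * complex_of_real (c * x))) has_vector_derivative
      \<i> * complex_of_real c * exp (\<i> * complex_of_real (c * x))) (at x)"
    by (simp add: o_def)
qed (intro continuous_intros)

lemma bdd_C1_sin: "bdd_C1 (\<lambda>x. complex_of_real (sin (c * x)))"
  by (rule bdd_C1I[where h' = "\<lambda>x. complex_of_real (c * cos (c * x))"])
     (auto intro!: derivative_eq_intros has_vector_derivative_of_real continuous_intros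
       simp: has_real_derivative_iff_has_vector_derivative[symmetric])

lemma bdd_C1_inverse:
  assumes f: "bdd_C1 f" and nz: "\<And>x. x \<in> {0..pi} \<Longrightarrow> f x \<noteq> 0"
  shows "bdd_C1 (\<lambda>x. inverse (f x))"
proof -
  have c: "continuous_on {0..pi} (\<lambda>x. inverse (f x))"
    using f nz unfolding bdd_C1_def by (intro continuous_on_inverse) auto
  have "compact ((\<lambda>x. inverse (f x)) ` {0..pi})" using c by (intro compact_continuous_image) auto
  then obtain B where B: "\<And>x. x \<in> {0..pi} \<Longrightarrow> cmod (inverse (f x)) \<le> B"
    using compact_imp_bounded bounded_iff by (metis imageI)
  obtain K where K: "\<And>x. x \<in> {0<..<pi} \<Longrightarrow> \<exists>d. (f has_vector_derivative d) (at x) \<and> cmod d \<le> K"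
    using f unfolding bdd_C1_def by blast
  have "\<exists>d. ((\<lambda>x. inverse (f x)) has_vector_derivative d) (at x) \<and> cmod d \<le> K * B\<^sup>2"
    if x: "x \<in> {0<..<pi}" for x
  proof -
    obtain d where d: "(f has_vector_derivative d) (at x)" "cmod d \<le> K" using K[OF x] by blast
    have nz': "f x \<noteq> 0" using nz x by simp
    have "((\<lambda>x. inverse (f x)) has_vector_derivative d * - (inverse (f x) ^ Suc (Suc 0))) (at x)"
      using field_vector_diff_chain_at[OF d(1) DERIV_inverse[OF nz']] by (simp add: o_def)
    moreover have "cmod (d * - (inverse (f x) ^ Suc (Suc 0))) \<le> K * B\<^sup>2"
      unfolding norm_mult norm_minus_cancel norm_power numeral_2_eq_2
      using B[of x] x order.trans[OF norm_ge_zero d(2)] d(2) by (intro mult_mono power_mono) auto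
    ultimately show ?thesis by blast
  qed
  with c show ?thesis unfolding bdd_C1_def by blast
qed

text \<open>The addition formula lets the multiple grow by one in each step. This upgrades the
  vanishing of \<open>sin ((k + 1) x)\<close> at both endpoints to the comparison with sin x
  required in \<open>osc_le\<close>.\<close>

lemma abs_sin_Suc_le:
  assumes "x \<in> {0..pi}"
  shows "\<bar>sin (real (Suc k) * x)\<bar> \<le> real (Suc k) * sin x"
proof (induction k)
  case 0
  then show ?case using assms by (simp add: sin_ge_zero)
next
  case (Suc k)
  have s: "0 \<le> sin x" using assms by (simp add: sin_ge_zero)
  have "\<bar>sin (real (Suc (Suc k)) * x)\<bar> = \<bar>sin (real (Suc k) * x) * cos x + cos (real (Suc k) * x) * sin x\<bar>"
    using sin_add[of "real (Suc k) * x" x] by (simp add: algebra_simps)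
  also have "\<dots> \<le> \<bar>sin (real (Suc k) * x)\<bar> * \<bar>cos x\<bar> + \<bar>cos (real (Suc k) * x)\<bar> * \<bar>sin x\<bar>"
    by (metis abs_mult abs_triangle_ineq)
  also have "\<dots> \<le> \<bar>sin (real (Suc k) * x)\<bar> * 1 + 1 * \<bar>sin x\<bar>"
    by (intro add_mono mult_mono) auto
  also have "\<dots> \<le> real (Suc (Suc k)) * sin x" using Suc s by (simp add: algebra_simps)
  finally show ?case .
qed

text \<open>Up to a constant the sine factor is \<open>phi 1 k\<close>, that is, the basis vector to
  which the evolution is applied. The constant depends on \<open>k\<close> and \<open>g\<close>
  only, because the amplitude does not contain n or t.\<close>

lemma osc_decay:
  assumes g: "bdd_C1 g"
  obtains K where "K \<ge> 0"
    "\<And>n t. n > 0 \<Longrightarrow> t \<ge> 0 \<Longrightarrow> cmod (osc n t (\<lambda>x. complex_of_real (sin (real (Suc k) * x)) * g x)) \<le> K * osc_bound n t"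
proof -
  let ?h = "\<lambda>x. complex_of_real (sin (real (Suc k) * x)) * g x"
  have h: "bdd_C1 ?h" by (rule bdd_C1_mult[OF bdd_C1_sin g])
  then obtain L where "\<forall>x\<in>{0<..<pi}. \<exists>d. (?h has_vector_derivative d) (at x) \<and> cmod d \<le> L"
    unfolding bdd_C1_def by blast
  then obtain h' where h': "\<And>x. x \<in> {0<..<pi} \<Longrightarrow> (?h has_vector_derivative h' x) (at x) \<and> cmod (h' x) \<le> L"
    by metis
  obtain B where B: "B \<ge> 0" "\<And>x. x \<in> {0..pi} \<Longrightarrow> cmod (g x) \<le> B" using bdd_C1_bounded[OF g] by blast
  define K where "K = max 0 L + real (Suc k) * B"
  \<comment> \<open>Only derivatives in the open interval matter; the value 0 elsewhere makes the
    bound by \<open>K\<close> hold at every point.\<close>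
  define d where "d x = (if x \<in> {0<..<pi} then h' x else 0)" for x
  have K0: "K \<ge> 0" using B(1) by (simp add: K_def)
  have bnd: "cmod (?h x) \<le> K * sin x" if x: "x \<in> {0..pi}" for x
  proof -
    have "cmod (?h x) = \<bar>sin (real (Suc k) * x)\<bar> * cmod (g x)" by (simp only: norm_mult norm_of_real)
    also have "\<dots> \<le> (real (Suc k) * sin x) * B"
      using B x by (intro mult_mono abs_sin_Suc_le[OF x]) (auto simp: sin_ge_zero)
    also have "\<dots> = (real (Suc k) * B) * sin x" by (simp only: mult_ac)
    also have "\<dots> \<le> K * sin x"
      by (rule mult_right_mono) (use x in \<open>simp_all add: K_def sin_ge_zero\<close>)
    finally show ?thesis .
  qed
  have dK: "cmod (d x) \<le> K" for x
  proof -
    have "cmod (d x) \<le> max 0 L" using h' by (auto simp: d_def le_max_iff_disj)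
    also have "\<dots> \<le> K" using B(1) by (simp add: K_def)
    finally show ?thesis .
  qed
  have "cmod (osc n t ?h) \<le> 2 * K * osc_bound n t" if "n > 0" "t \<ge> 0" for n t
    by (rule osc_le[where h' = d])
       (use h h' bnd dK that in \<open>auto simp: bdd_C1_def d_def\<close>)
  with K0 show ?thesis by (intro that[of "2 * K"]) auto
qed

lemma osc_square_sum_tendsto:
  fixes x :: "nat \<Rightarrow> real \<Rightarrow> complex"
  assumes le: "\<And>n t. n > 0 \<Longrightarrow> t \<ge> 0 \<Longrightarrow> cmod (x n t) \<le> K * osc_bound (real n) t" and K: "K \<ge> 0"
    and x0: "((\<lambda>t. x 0 t) \<longlongrightarrow> 0) at_top"
  shows "((\<lambda>t. \<Sum>n. (cmod (x n t))\<^sup>2) \<longlongrightarrow> 0) at_top"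
proof -
  \<comment> \<open>The entry (K pi)^2 / n^2 comes from \<open>osc_bound_le\<close>. At n = 0 there
    is only convergence to 0, so the majorant 1 is valid for large t, which is enough for Tannery's
    theorem.\<close>
  let ?M = "\<lambda>n. if n = 0 then 1 else (K * pi)\<^sup>2 * (1 / (real n)\<^sup>2)"
  have lim: "((\<lambda>t. (cmod (x n t))\<^sup>2) \<longlongrightarrow> 0) at_top" for n
  proof (cases "n = 0")
    case False
    have "((\<lambda>t. K * osc_bound (real n) t) \<longlongrightarrow> 0) at_top"
      using False tendsto_mult_left[OF osc_bound_tendsto[of "real n"], of K] by simp
    moreover have "\<forall>\<^sub>F t in at_top. norm (x n t) \<le> K * osc_bound (real n) t"
      by (rule eventually_mono[OF eventually_ge_at_top[of 0]]) (use le False in auto)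
    ultimately have "((\<lambda>t. x n t) \<longlongrightarrow> 0) at_top" by (rule Lim_null_comparison[rotated])
    from tendsto_power[OF tendsto_norm[OF this], of 2] show ?thesis by simp
  qed (use tendsto_power[OF tendsto_norm[OF x0], of 2] in simp)
  have ev0: "\<forall>\<^sub>F t in at_top. (cmod (x 0 t))\<^sup>2 < 1 \<and> t \<ge> 0"
    using order_tendstoD(2)[OF lim[of 0], of 1] eventually_ge_at_top[of 0] by (auto intro: eventually_conj)
  have bound: "norm ((cmod (x n t))\<^sup>2) \<le> ?M n" if "(cmod (x 0 t))\<^sup>2 < 1 \<and> t \<ge> 0" for n t
  proof (cases "n = 0")
    case False
    have "cmod (x n t) \<le> K * (pi / real n)"
      using le[of n t] osc_bound_le[of "real n" t] False that K by (meson mult_left_mono of_nat_0_less_iff order.trans neq0_conv)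
    then have "(cmod (x n t))\<^sup>2 \<le> (K * (pi / real n))\<^sup>2" by (intro power_mono) auto
    then show ?thesis using False by (simp add: power_mult_distrib power_divide)
  qed (use that in auto)
  have "summable (\<lambda>n. (K * pi)\<^sup>2 * (1 / (real n)\<^sup>2))"
    using inverse_power_summable[of 2, where 'a = real] by (intro summable_mult) (simp add: field_simps)
  then have M: "summable ?M"
    by (rule summable_cong[THEN iffD1, rotated]) (use eventually_gt_at_top[of 0] in \<open>auto elim: eventually_mono\<close>)
  have "((\<lambda>t. \<Sum>n. (cmod (x n t))\<^sup>2) \<longlongrightarrow> (\<Sum>n. 0)) at_top"
  proof (rule tannerys_theorem[where M = ?M, THEN conjunct2, THEN conjunct2])
    show "\<forall>\<^sub>F (n, t) in sequentially \<times>\<^sub>F at_top. norm ((cmod (x n t))\<^sup>2) \<le> ?M n"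
      unfolding eventually_prod_filter
      by (rule exI[of _ "\<lambda>_. True"], rule exI[of _ "\<lambda>t. (cmod (x 0 t))\<^sup>2 < 1 \<and> t \<ge> 0"])
         (use ev0 bound in auto)
  qed (use lim M in auto)
  then show ?thesis by simp
qed


section \<open>The generalized eigenfunctions in the angle variable\<close>

lemma cos_image_open: "cos ` {0<..<pi} = {-1<..<1}"
proof (intro equalityI subsetI)
  fix y assume "y \<in> cos ` {0<..<pi}"
  then obtain x where x: "0 < x" "x < pi" "y = cos x" by auto
  have "cos x < cos 0" using x by (intro cos_monotone_0_pi) auto
  moreover have "cos pi < cos x" using x by (intro cos_monotone_0_pi) auto
  ultimately show "y \<in> {-1<..<1}" using x by simp
next
  fix y :: real assume y: "y \<in> {-1<..<1}"
  then show "y \<in> cos ` {0<..<pi}"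
    by (intro image_eqI[of _ _ "arccos y"]) (auto simp: arccos_lt_bounded cos_arccos)
qed

text \<open>The hypotheses concern \<open>g\<close>, the integrand in the angle with the Jacobian
  sin x absorbed, because \<open>g\<close> can be bounded where \<open>f\<close> is not: for a^2 = 2
  the functions \<open>psi a n\<close> blow up like (sin x)^(-1/2) at the endpoints.\<close>

lemma integral_angle_substitution:
  fixes f :: "real \<Rightarrow> 'b::euclidean_space"
  assumes eq: "\<And>x. x \<in> {0<..<pi} \<Longrightarrow> sin x *\<^sub>R f (cos x) = g x"
    and cont: "continuous_on {0<..<pi} g" and bound: "\<And>x. x \<in> {0<..<pi} \<Longrightarrow> norm (g x) \<le> B"
  shows "integrable leb f" and "(g has_integral (\<integral>x. f x \<partial>leb)) {0..pi}"
proof -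
  let ?S = "{0<..<pi}"
  have "finite_measure (lebesgue_on ?S)" by (rule finite_measure_lebesgue_on) simp
  moreover have "g \<in> borel_measurable (lebesgue_on ?S)"
    by (rule continuous_imp_measurable_on_sets_lebesgue[OF cont]) simp
  ultimately have "integrable (lebesgue_on ?S) g"
    using bound by (auto intro!: finite_measure.integrable_const_bound[where B = B] AE_I2)
  then have "g absolutely_integrable_on ?S"
    by (simp add: integrable_restrict_space set_integrable_def)
  then have "(\<lambda>x. \<bar>- sin x\<bar> *\<^sub>R f (cos x)) absolutely_integrable_on ?S"
    by (rule absolutely_integrable_spike[where S = "{}"]) (auto simp: eq sin_gt_zero abs_of_pos)
  moreover have int: "integral ?S (\<lambda>x. \<bar>- sin x\<bar> *\<^sub>R f (cos x)) = integral ?S g"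
    by (rule integral_cong) (auto simp: eq[symmetric] sin_gt_zero abs_of_pos)
  ultimately have f: "f absolutely_integrable_on cos ` ?S \<and> integral (cos ` ?S) f = integral ?S g"
    by (subst has_absolute_integral_change_of_variables_real[of ?S cos "\<lambda>x. - sin x", symmetric])
       (auto intro!: derivative_eq_intros inj_onI intro: cos_inj_pi)
  then show "integrable leb f"
    by (simp add: integrable_restrict_space set_integrable_def cos_image_open)
  then have "(\<integral>x. f x \<partial>leb) = integral ?S g"
    using f by (simp add: lebesgue_integral_eq_integral cos_image_open)
  moreover have "g integrable_on ?S"
    using \<open>g absolutely_integrable_on ?S\<close> by (simp add: absolutely_integrable_on_def)
  ultimately have "(g has_integral (\<integral>x. f x \<partial>leb)) ?S" by (simp add: integrable_integral)
  then show "(g has_integral (\<integral>x. f x \<partial>leb)) {0..pi}"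
    using has_integral_open_interval[of g _ 0 pi] by (simp add: box_real)
qed

text \<open>This is exp (i x) + (1 - a^2) exp (- i x). For a > 0 it vanishes somewhere on [0, pi]
  only if a^2 = 2, and then exactly at the endpoints.\<close>

definition jost :: "real \<Rightarrow> real \<Rightarrow> complex" where
  "jost a x = complex_of_real ((2 - a\<^sup>2) * cos x) + \<i> * complex_of_real (a\<^sup>2 * sin x)"

definition jost_phase :: "real \<Rightarrow> real \<Rightarrow> complex" where
  "jost_phase a x = jost a x / complex_of_real (cmod (jost a x))"

text \<open>\<open>Ch a 0\<close> is \<open>1 / a\<close> times the value at \<open>0\<close> of the trigonometric expression for \<open>Ch a n\<close>, \<open>n \<ge> 1\<close>.\<close>

definition jost_weight :: "real \<Rightarrow> nat \<Rightarrow> real" where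
  "jost_weight a n = (if n = 0 then 1 / a else 1)"

text \<open>On (0, pi) this is the image of \<open>psi a n\<close> under the unitary map taking g to
  sqrt (sin x) g(cos x), from L^2(-1, 1) onto L^2(0, pi): each of two factors takes half of the
  Jacobian.\<close>

definition phi :: "real \<Rightarrow> nat \<Rightarrow> real \<Rightarrow> real" where
  "phi a n x = sqrt (2 / pi) * jost_weight a n * Im (exp (\<i> * complex_of_real (real n * x)) * jost_phase a x)"

text \<open>The right-hand side is the radicand in both \<open>psi\<close> and \<open>sigma\<close>,
  so the root in their denominators is the modulus of the Jost function.\<close>

lemma cmod_jost_square: "(cmod (jost a x))\<^sup>2 = a ^ 4 - 4 * (a\<^sup>2 - 1) * (cos x)\<^sup>2"
proof -
  have "(cmod (jost a x))\<^sup>2 = (2 - a\<^sup>2)\<^sup>2 * (cos x)\<^sup>2 + a ^ 4 * (1 - (cos x)\<^sup>2)"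
    by (simp add: cmod_power2 jost_def power_mult_distrib sin_squared_eq)
  then show ?thesis by (simp add: algebra_simps power2_eq_square power4_eq_xxxx)
qed

lemma cmod_jost: "cmod (jost a x) = sqrt (a ^ 4 - 4 * (a\<^sup>2 - 1) * (cos x)\<^sup>2)"
  by (simp only: cmod_jost_square[symmetric] real_sqrt_abs abs_norm_cancel)

lemma jost_nonzero:
  assumes "a > 0" "x \<in> {0<..<pi}"
  shows "jost a x \<noteq> 0"
proof -
  have "Im (jost a x) > 0" using assms by (simp add: jost_def sin_gt_zero)
  then show ?thesis by auto
qed

lemma jost_one: "jost 1 x = exp (\<i> * complex_of_real x)"
  by (simp add: jost_def exp_Euler cos_of_real sin_of_real)

text \<open>As a combination of sin y and cos y, \<open>P\<close> satisfies P(y + x) + P(y - x) = 2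
  cos x P(y), the recurrence of the polynomials. The exceptional relation with the factor a
  continues it down to P(0) = a^2 sin x, whereas \<open>a * sin x * Ch a 0\<close> is a sin x; hence
  a correcting weight at n = 0 alone.\<close>

lemma Ch_angle:
  assumes "a > 0"
  shows "a * sin x * Ch a n (cos x) = jost_weight a n * Im (exp (\<i> * complex_of_real (real n * x)) * jost a x)"
proof -
  define P where "P y = (2 - a\<^sup>2) * cos x * sin y + a\<^sup>2 * sin x * cos y" for y
  have Im: "Im (exp (\<i> * complex_of_real y) * jost a x) = P y" for y
    by (simp add: exp_Euler cos_of_real sin_of_real jost_def P_def algebra_simps)
  have rec: "2 * cos x * P y - P (y - x) = P (y + x)" for y
    unfolding P_def sin_add sin_diff cos_add cos_diff by (simp add: algebra_simps)
  have "a * sin x * Ch a (Suc m) (cos x) = P (real (Suc m) * x)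
      \<and> a * sin x * Ch a (Suc (Suc m)) (cos x) = P (real (Suc (Suc m)) * x)" for m
  proof (induction m)
    case 0
    have 1: "a * sin x * Ch a (Suc 0) (cos x) = P x"
      using assms by (simp add: P_def algebra_simps power2_eq_square)
    have "a * sin x * Ch a (Suc (Suc 0)) (cos x) = 2 * cos x * (a * sin x * Ch a (Suc 0) (cos x)) - P 0"
      by (simp add: P_def algebra_simps power2_eq_square)
    also have "\<dots> = P (2 * x)" unfolding 1 using rec[of x] by simp
    finally show ?case using 1 by (simp only: of_nat_Suc) simp
  next
    case (Suc m)
    have "a * sin x * Ch a (Suc (Suc (Suc m))) (cos x) = 2 * cos x * (a * sin x * Ch a (Suc (Suc m)) (cos x))
        - a * sin x * Ch a (Suc m) (cos x)"
      by (simp add: algebra_simps)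
    also have "\<dots> = P (real (Suc (Suc (Suc m))) * x)"
      using Suc rec[of "real (Suc (Suc m)) * x"] by (simp add: algebra_simps)
    finally show ?case using Suc by blast
  qed
  moreover have "a * sin x * Ch a 0 (cos x) = 1 / a * P 0"
    using assms by (simp add: P_def power2_eq_square)
  ultimately show ?thesis
    unfolding Im by (cases n) (simp_all add: jost_weight_def del: Ch.simps(2-4))
qed

lemma root_4_sin_square:
  assumes "x \<in> {0<..<pi}"
  shows "root 4 (1 - (cos x)\<^sup>2) = sqrt (sin x)"
proof -
  have "root 4 ((sin x)\<^sup>2) = root (2 * 2) ((sin x)\<^sup>2)" by simp
  also have "\<dots> = sqrt (sqrt ((sin x)\<^sup>2))" unfolding sqrt_def by (rule real_root_mult_exp)
  finally show ?thesis using assms by (simp add: sin_squared_eq[symmetric] sin_ge_zero)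
qed

lemma psi_angle:
  assumes a: "a > 0" and x: "x \<in> {0<..<pi}"
  shows "sqrt (sin x) * psi a n (cos x) = phi a n x"
proof -
  have s: "sin x > 0" using x by (simp add: sin_gt_zero)
  have "sqrt (sin x) * psi a n (cos x)
      = sqrt (2 / pi) * ((sqrt (sin x) * sqrt (sin x)) * a * Ch a n (cos x) / cmod (jost a x))"
    unfolding psi_def root_4_sin_square[OF x] cmod_jost by (simp add: field_simps)
  also have "\<dots> = sqrt (2 / pi) * (a * sin x * Ch a n (cos x) / cmod (jost a x))"
    using s by (simp add: mult_ac)
  also have "\<dots> = phi a n x"
  proof -
    have "Im (z * (w / complex_of_real r)) = Im (z * w) / r" for z w r
      by (metis Im_divide_of_real times_divide_eq_right)
    then show ?thesis by (simp only: Ch_angle[OF a] phi_def jost_phase_def) simp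
  qed
  finally show ?thesis .
qed

lemma psi_product_angle:
  assumes "a > 0" "b > 0" "x \<in> {0<..<pi}"
  shows "sin x * (psi a m (cos x) * psi b n (cos x)) = phi a m x * phi b n x"
proof -
  have "sin x * (psi a m (cos x) * psi b n (cos x))
      = (sqrt (sin x) * sqrt (sin x)) * (psi a m (cos x) * psi b n (cos x))"
    using assms(3) by (simp add: sin_ge_zero)
  also have "\<dots> = (sqrt (sin x) * psi a m (cos x)) * (sqrt (sin x) * psi b n (cos x))"
    by (simp only: mult_ac)
  finally show ?thesis by (simp only: psi_angle[OF assms(1,3)] psi_angle[OF assms(2,3)])
qed

lemma cmod_jost_phase_le: "cmod (jost_phase a x) \<le> 1"
  by (simp add: jost_phase_def norm_divide divide_le_eq_1)

lemma abs_phi_le: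
  assumes "a > 0"
  shows "\<bar>phi a n x\<bar> \<le> sqrt (2 / pi) * jost_weight a n"
proof -
  have "\<bar>Im (exp (\<i> * complex_of_real (real n * x)) * jost_phase a x)\<bar>
      \<le> cmod (exp (\<i> * complex_of_real (real n * x)) * jost_phase a x)"
    by (rule abs_Im_le_cmod)
  also have "\<dots> \<le> 1"
    unfolding norm_mult norm_exp_i_times using cmod_jost_phase_le[of a x] by simp
  finally have le: "\<bar>Im (exp (\<i> * complex_of_real (real n * x)) * jost_phase a x)\<bar> \<le> 1" .
  have nonneg: "0 \<le> sqrt (2 / pi) * jost_weight a n" using assms by (simp add: jost_weight_def)
  show ?thesis
    unfolding phi_def abs_mult[of "sqrt (2 / pi) * jost_weight a n"] abs_of_nonneg[OF nonneg]
    by (rule mult_left_le[OF le nonneg])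
qed

lemma continuous_phi:
  assumes "a > 0"
  shows "continuous_on {0<..<pi} (phi a n)"
proof -
  have "continuous_on {0<..<pi} (jost_phase a)"
    unfolding jost_phase_def using jost_nonzero[OF assms] unfolding jost_def
    by (intro continuous_intros) auto
  then show ?thesis unfolding phi_def by (intro continuous_intros)
qed

lemma denominator_pos:
  fixes a l :: real
  assumes "a > 0" "l \<in> {-1<..<1}"
  shows "a ^ 4 - 4 * (a\<^sup>2 - 1) * l\<^sup>2 > 0"
proof -
  obtain x where x: "x \<in> {0<..<pi}" "l = cos x" using assms(2) cos_image_open by blast
  show ?thesis
    using jost_nonzero[OF assms(1) x(1)] unfolding x(2) cmod_jost_square[symmetric] by simp
qed

lemma continuous_psi:
  assumes "a > 0"
  shows "continuous_on {-1<..<1} (psi a n)"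
proof -
  have eqs: "Ch a 0 = (\<lambda>_. 1)" "Ch a (Suc 0) = (\<lambda>l. 2 / a * l)"
      "Ch a (Suc (Suc 0)) = (\<lambda>l. 2 * l * Ch a (Suc 0) l - a * Ch a 0 l)"
      "Ch a (Suc (Suc (Suc n))) = (\<lambda>l. 2 * l * Ch a (Suc (Suc n)) l - Ch a (Suc n) l)" for a n
    by (rule ext, simp)+
  have "continuous_on A (Ch a n)" for A
    by (rule Ch.induct[of "\<lambda>a n l. continuous_on A (Ch a n)" a n 0]; subst eqs; intro continuous_intros; assumption)
  then show ?thesis
    unfolding psi_def
    by (intro continuous_intros) (use denominator_pos[OF assms] in force)+
qed

lemma square_integrable_psi:
  assumes "a > 0"
  shows "square_integrable (\<lambda>l. complex_of_real (psi a n l))"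
  unfolding square_integrable_def
proof
  have "continuous_on {-1<..<1} (\<lambda>l. complex_of_real (psi a n l))"
    by (intro continuous_intros continuous_psi assms)
  then show "(\<lambda>l. complex_of_real (psi a n l)) \<in> borel_measurable leb"
    by (rule continuous_imp_measurable_on_sets_lebesgue) simp
  show "integrable leb (\<lambda>l. (cmod (complex_of_real (psi a n l)))\<^sup>2)"
  proof (rule integral_angle_substitution(1)[where g = "\<lambda>x. (phi a n x)\<^sup>2" and B = "(sqrt (2 / pi) * jost_weight a n)\<^sup>2"])
    show "norm ((phi a n x)\<^sup>2) \<le> (sqrt (2 / pi) * jost_weight a n)\<^sup>2" for x
      using power_mono[OF abs_phi_le[OF assms], of n x 2] by simp
  qed (use psi_product_angle[OF assms assms] in \<open>auto simp: power2_eq_square intro!: continuous_intros continuous_phi assms\<close>)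
qed

lemma integral_psi_psi:
  assumes ab: "a > 0" "b > 0" and \<phi>: "continuous_on {-1<..<1} \<phi>" "\<And>l. l \<in> {-1<..<1} \<Longrightarrow> cmod (\<phi> l) \<le> K"
  shows "((\<lambda>x. \<phi> (cos x) * complex_of_real (phi a m x * phi b n x)) has_integral
      (\<integral>l. \<phi> l * complex_of_real (psi a m l * psi b n l) \<partial>leb)) {0..pi}"
proof (rule integral_angle_substitution(2))
  have cos: "cos x \<in> {-1<..<1}" if "x \<in> {0<..<pi}" for x using that cos_image_open by blast
  show "sin x *\<^sub>R (\<phi> (cos x) * complex_of_real (psi a m (cos x) * psi b n (cos x)))
      = \<phi> (cos x) * complex_of_real (phi a m x * phi b n x)" if "x \<in> {0<..<pi}" for x
    using psi_product_angle[OF ab that, of m n, symmetric] by (simp add: scaleR_conv_of_real mult_ac)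
  have "continuous_on {0<..<pi} (\<lambda>x. \<phi> (cos x))"
    by (rule continuous_on_compose2[OF \<phi>(1)]) (use cos in \<open>auto intro!: continuous_intros\<close>)
  then show "continuous_on {0<..<pi} (\<lambda>x. \<phi> (cos x) * complex_of_real (phi a m x * phi b n x))"
    by (intro continuous_intros continuous_phi ab)
  show "norm (\<phi> (cos x) * complex_of_real (phi a m x * phi b n x))
      \<le> K * ((sqrt (2 / pi) * jost_weight a m) * (sqrt (2 / pi) * jost_weight b n))" if "x \<in> {0<..<pi}" for x
    unfolding norm_mult norm_of_real abs_mult
    using \<phi>(2)[OF cos[OF that]] abs_phi_le[OF ab(1), of m x] abs_phi_le[OF ab(2), of n x] ab
      order.trans[OF norm_ge_zero \<phi>(2)[OF cos[OF that]]]
    by (intro mult_mono) (auto simp: jost_weight_def)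
qed

section \<open>The case \<open>a = 1\<close>: orthonormal sines\<close>

lemma has_integral_cos_nat:
  "((\<lambda>x. cos ((real m - real n) * x)) has_integral (if m = n then pi else 0)) {0..pi}"
proof (cases "m = n")
  case True
  then show ?thesis using has_integral_const_real[of "1::real" 0 pi] by simp
next
  case False
  let ?j = "real m - real n"
  have "((\<lambda>x. cos (?j * x)) has_integral sin (?j * pi) / ?j - sin (?j * 0) / ?j) {0..pi}"
    using False
    by (intro fundamental_theorem_of_calculus)
       (auto intro!: derivative_eq_intros simp: has_real_derivative_iff_has_vector_derivative[symmetric])
  moreover have "sin (?j * pi) = 0" by (simp add: left_diff_distrib sin_diff)
  ultimately show ?thesis using False by simp
qed

text \<open>For a = 1 all weights are 1 and the Jost phase is exp (i x), which shifts the index by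
  one: the polynomials are the Chebyshev polynomials of the second kind.\<close>

lemma phi_one: "phi 1 n x = sqrt (2 / pi) * sin (real (Suc n) * x)"
proof -
  have "jost_phase 1 x = exp (\<i> * complex_of_real x)"
    by (simp add: jost_phase_def jost_one)
  then have "exp (\<i> * complex_of_real (real n * x)) * jost_phase 1 x = exp (\<i> * complex_of_real (real (Suc n) * x))"
    by (simp add: exp_add[symmetric] algebra_simps)
  then show ?thesis
    by (simp only: phi_def jost_weight_def div_by_1 if_cancel mult_1_right Im_exp) simp
qed

lemma psi_one_orthonormal:
  "cinner (L2_class (\<lambda>l. complex_of_real (psi 1 m l))) (L2_class (\<lambda>l. complex_of_real (psi 1 n l)))
    = (if m = n then 1 else 0)"
proof -
  let ?I = "\<integral>l. 1 * complex_of_real (psi 1 m l * psi 1 n l) \<partial>leb"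
  have "((\<lambda>x. 1 * complex_of_real (phi 1 m x * phi 1 n x)) has_integral ?I) {0..pi}"
    by (rule integral_psi_psi[where K = 1]) auto
  \<comment> \<open>Product-to-sum formula. The second frequency m + n + 2 is written as a
    difference of naturals so that \<open>has_integral_cos_nat\<close> covers both terms; being
    nonzero, it contributes nothing.\<close>
  moreover have "phi 1 m x * phi 1 n x
      = 1 / pi * (cos ((real m - real n) * x) - cos ((real (m + n + 2) - real 0) * x))" for x
  proof -
    have "phi 1 m x * phi 1 n x
        = (sqrt (2 / pi) * sqrt (2 / pi)) * (sin (real (Suc m) * x) * sin (real (Suc n) * x))"
      by (simp only: phi_one mult_ac)
    also have "\<dots> = 2 / pi * (sin (real (Suc m) * x) * sin (real (Suc n) * x))" by simp
    also have "\<dots> = 1 / pi * (cos ((real m - real n) * x) - cos ((real (m + n + 2) - real 0) * x))"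
    proof -
      have "real (Suc m) * x - real (Suc n) * x = (real m - real n) * x"
        "real (Suc m) * x + real (Suc n) * x = (real (m + n + 2) - real 0) * x"
        by (simp_all add: algebra_simps)
      then have "sin (real (Suc m) * x) * sin (real (Suc n) * x)
          = (cos ((real m - real n) * x) - cos ((real (m + n + 2) - real 0) * x)) / 2"
        by (simp only: sin_times_sin)
      moreover have "2 / pi * (y / 2) = 1 / pi * y" for y :: real by simp
      ultimately show ?thesis by (simp only:)
    qed
    finally show ?thesis .
  qed
  ultimately have "((\<lambda>x. complex_of_real (1 / pi * (cos ((real m - real n) * x) - cos ((real (m + n + 2) - real 0) * x))))
      has_integral ?I) {0..pi}" by simp
  moreover have "((\<lambda>x. complex_of_real (1 / pi * (cos ((real m - real n) * x) - cos ((real (m + n + 2) - real 0) * x))))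
      has_integral complex_of_real (1 / pi * ((if m = n then pi else 0) - (if m + n + 2 = 0 then pi else 0)))) {0..pi}"
    by (intro has_integral_of_real has_integral_mult_right has_integral_diff has_integral_cos_nat)
  ultimately have "?I = complex_of_real (1 / pi * ((if m = n then pi else 0) - (if m + n + 2 = 0 then pi else 0)))"
    by (rule has_integral_unique)
  then show ?thesis by (simp add: cinner_L2_class square_integrable_psi)
qed


section \<open>The operators \<open>F a\<close> and their intertwining property\<close>

text \<open>Parseval on (-pi, pi), folded onto (0, pi). The exponentials are not orthogonal on the
  half interval, but each cross term together with its reflection is a cosine of integral
  zero.\<close>

lemma has_integral_trig_poly:
  fixes b :: "nat \<Rightarrow> complex" and N :: nat
  defines "P \<equiv> \<lambda>x. \<Sum>n<N. b n * exp (\<i> * complex_of_real (real n * x))"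
  shows "((\<lambda>x. (cmod (P x))\<^sup>2 + (cmod (P (- x)))\<^sup>2) has_integral 2 * pi * (\<Sum>n<N. (cmod (b n))\<^sup>2)) {0..pi}"
proof -
  let ?e = "\<lambda>n x. exp (\<i> * complex_of_real (real n * x))"
  have ee: "cnj (?e m x) * ?e n x + cnj (?e m (- x)) * ?e n (- x)
      = complex_of_real (2 * cos ((real m - real n) * x))" for m n x
  proof -
    have "cnj (exp (\<i> * complex_of_real u)) * exp (\<i> * complex_of_real v)
        + cnj (exp (\<i> * complex_of_real (- u))) * exp (\<i> * complex_of_real (- v))
        = complex_of_real (2 * cos (u - v))" for u v
      unfolding cis_conv_exp[symmetric] by (simp add: complex_eq_iff cos_diff)
    from this[of "real m * x" "real n * x"] show ?thesis
      by (simp only: mult_minus_right left_diff_distrib)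
  qed
  have expand: "complex_of_real ((cmod (P x))\<^sup>2)
      = (\<Sum>m<N. \<Sum>n<N. cnj (b m) * b n * (cnj (?e m x) * ?e n x))" for x
    unfolding cnj_mult_self[symmetric] P_def cnj_sum sum_product
    by (intro sum.cong) (simp_all add: mult_ac)
  have "complex_of_real ((cmod (P x))\<^sup>2 + (cmod (P (- x)))\<^sup>2)
      = (\<Sum>m<N. \<Sum>n<N. cnj (b m) * b n * complex_of_real (2 * cos ((real m - real n) * x)))" for x
    unfolding of_real_add expand ee[symmetric] by (simp only: distrib_left sum.distrib)
  moreover have "((\<lambda>x. \<Sum>m<N. \<Sum>n<N. cnj (b m) * b n * complex_of_real (2 * cos ((real m - real n) * x)))
      has_integral (\<Sum>m<N. \<Sum>n<N. cnj (b m) * b n * complex_of_real (2 * (if m = n then pi else 0)))) {0..pi}"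
    by (intro has_integral_sum has_integral_mult_right has_integral_of_real has_integral_cos_nat finite_lessThan)
  moreover have "(\<Sum>m<N. \<Sum>n<N. cnj (b m) * b n * complex_of_real (2 * (if m = n then pi else 0)))
      = complex_of_real (2 * pi * (\<Sum>n<N. (cmod (b n))\<^sup>2))"
    by (simp add: if_distrib sum_distrib_left cnj_mult_self[symmetric] mult_ac cong: if_cong del: of_real_power)
  ultimately have "((\<lambda>x. complex_of_real ((cmod (P x))\<^sup>2 + (cmod (P (- x)))\<^sup>2)) has_integral
      complex_of_real (2 * pi * (\<Sum>n<N. (cmod (b n))\<^sup>2))) {0..pi}"
    by (simp only:)
  from has_integral_Re[OF this] show ?thesis by (simp only: Re_complex_of_real)
qed

text \<open>Writing the imaginary part through z and its conjugate, a combination of the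
  \<open>phi a n\<close> becomes a multiple of w P(x) - cnj w P(-x) for one trigonometric polynomial
  P. As |w| \<le> 1, the factor w drops out of the estimate and Parseval applies. The 2 comes from
  (u + v)^2 \<le> 2 (u^2 + v^2), the maximum from the squared weights.\<close>

lemma bessel_psi:
  assumes a: "a > 0"
  shows "bessel (\<lambda>n. L2_class (\<lambda>l. complex_of_real (psi a n l))) (2 * max 1 (1 / a\<^sup>2))"
  unfolding bessel_def
proof (intro conjI allI)
  fix c :: "nat \<Rightarrow> complex" and N
  define b where "b n = c n * complex_of_real (jost_weight a n)" for n
  define P where "P x = (\<Sum>n<N. b n * exp (\<i> * complex_of_real (real n * x)))" for x
  let ?g = "\<lambda>x. (cmod (\<Sum>n<N. c n * complex_of_real (phi a n x)))\<^sup>2"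
  let ?f = "\<lambda>l. (\<Sum>n<N. c n * complex_of_real (psi a n l))"
  let ?B = "\<Sum>n<N. cmod (c n) * (sqrt (2 / pi) * jost_weight a n)"
  note sq = square_integrable_scaleC[OF square_integrable_psi[OF a]]
  have int: "(?g has_integral (\<integral>l. (cmod (?f l))\<^sup>2 \<partial>leb)) {0..pi}"
  proof (rule integral_angle_substitution(2))
    fix x assume x: "x \<in> {0<..<pi}"
    have "sqrt (sin x) *\<^sub>R ?f (cos x) = (\<Sum>n<N. c n * complex_of_real (phi a n x))"
      by (simp add: scaleR_conv_of_real sum_distrib_left psi_angle[OF a x, symmetric] mult_ac)
    then have "cmod (\<Sum>n<N. c n * complex_of_real (phi a n x)) = sqrt (sin x) * cmod (?f (cos x))"
      using x by (metis abs_of_nonneg norm_scaleR real_sqrt_ge_zero sin_ge_zero greaterThanLessThan_iff less_imp_le)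
    then show "sin x *\<^sub>R (cmod (?f (cos x)))\<^sup>2 = ?g x"
      using x by (simp add: power_mult_distrib sin_ge_zero)
    have "cmod (\<Sum>n<N. c n * complex_of_real (phi a n x)) \<le> ?B"
      by (rule order.trans[OF norm_sum])
         (auto simp: norm_mult intro!: sum_mono mult_left_mono abs_phi_le[OF a])
    then show "norm (?g x) \<le> ?B\<^sup>2" by (simp add: power_mono)
  qed (intro continuous_intros continuous_phi a)
  have "?g x \<le> 1 / pi * ((cmod (P x))\<^sup>2 + (cmod (P (- x)))\<^sup>2)" for x
  proof -
    let ?w = "jost_phase a x"
    let ?e = "\<lambda>n x. exp (\<i> * complex_of_real (real n * x))"
    have im: "complex_of_real (Im z) = (z - cnj z) / (2 * \<i>)" for z
      by (simp add: complex_eq_iff)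
    have cnj_e: "cnj (?e n x) = ?e n (- x)" for n
      unfolding cis_conv_exp[symmetric] by (simp add: cis_cnj)
    have "c n * complex_of_real (phi a n x)
        = complex_of_real (sqrt (2 / pi)) / (2 * \<i>) * (?w * (b n * ?e n x) - cnj ?w * (b n * ?e n (- x)))" for n
      unfolding phi_def of_real_mult[of "sqrt (2 / pi) * jost_weight a n"] im complex_cnj_mult cnj_e
      by (simp add: b_def field_simps)
    then have "(\<Sum>n<N. c n * complex_of_real (phi a n x))
        = complex_of_real (sqrt (2 / pi)) / (2 * \<i>) * (?w * P x - cnj ?w * P (- x))"
      by (simp only: P_def sum_distrib_left sum_subtractf[symmetric] right_diff_distrib)
    then have "?g x = (sqrt (2 / pi) / 2)\<^sup>2 * (cmod (?w * P x - cnj ?w * P (- x)))\<^sup>2"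
      by (simp add: norm_mult norm_divide power_mult_distrib power_divide)
    also have "\<dots> \<le> (sqrt (2 / pi) / 2)\<^sup>2 * (cmod (P x) + cmod (P (- x)))\<^sup>2"
    proof (intro mult_left_mono power_mono)
      have "cmod (?w * P x - cnj ?w * P (- x)) \<le> cmod (?w * P x) + cmod (cnj ?w * P (- x))"
        by (rule norm_triangle_ineq4)
      also have "\<dots> \<le> cmod (P x) + cmod (P (- x))"
        unfolding norm_mult complex_mod_cnj
        by (intro add_mono mult_left_le_one_le cmod_jost_phase_le) auto
      finally show "cmod (?w * P x - cnj ?w * P (- x)) \<le> cmod (P x) + cmod (P (- x))" .
    qed auto
    also have "\<dots> = 1 / (2 * pi) * (cmod (P x) + cmod (P (- x)))\<^sup>2"
      by (simp add: power_divide)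
    also have "\<dots> \<le> 1 / (2 * pi) * (2 * ((cmod (P x))\<^sup>2 + (cmod (P (- x)))\<^sup>2))"
      using sum_squares_bound[of "cmod (P x)" "cmod (P (- x))"]
      by (intro mult_left_mono) (simp_all add: power2_sum)
    finally have "?g x \<le> 1 / (2 * pi) * (2 * ((cmod (P x))\<^sup>2 + (cmod (P (- x)))\<^sup>2))" .
    moreover have "1 / (2 * pi) * (2 * y) = 1 / pi * y" for y :: real by simp
    ultimately show ?thesis by (simp only:)
  qed
  then have "(\<integral>l. (cmod (?f l))\<^sup>2 \<partial>leb) \<le> 1 / pi * (2 * pi * (\<Sum>n<N. (cmod (b n))\<^sup>2))"
    unfolding P_def
    by (intro has_integral_le[OF int has_integral_mult_right[OF has_integral_trig_poly]]) auto
  also have "\<dots> = 2 * (\<Sum>n<N. (jost_weight a n)\<^sup>2 * (cmod (c n))\<^sup>2)"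
    by (simp add: b_def norm_mult power_mult_distrib mult_ac)
  also have "\<dots> \<le> 2 * (\<Sum>n<N. max 1 (1 / a\<^sup>2) * (cmod (c n))\<^sup>2)"
    by (intro mult_left_mono sum_mono mult_right_mono) (auto simp: jost_weight_def power_divide)
  also have "(\<integral>l. (cmod (?f l))\<^sup>2 \<partial>leb) = (norm (\<Sum>n<N. c n *\<^sub>C L2_class (\<lambda>l. complex_of_real (psi a n l))))\<^sup>2"
    by (simp only: L2_class_scaleC[OF square_integrable_psi[OF a]] L2_class_sum[OF sq]
        norm_L2_class[OF square_integrable_sum[OF sq]])
  finally show "(norm (\<Sum>n<N. c n *\<^sub>C L2_class (\<lambda>l. complex_of_real (psi a n l))))\<^sup>2
      \<le> 2 * max 1 (1 / a\<^sup>2) * (\<Sum>n<N. (cmod (c n))\<^sup>2)"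
    by (simp add: sum_distrib_left mult_ac)
qed (simp add: le_max_iff_disj)

lemma bounded_clinear_F: "a > 0 \<Longrightarrow> bounded_clinear (F a)"
  and F_basis: "a > 0 \<Longrightarrow> F a (ell2_basis n) = L2_class (\<lambda>l. complex_of_real (psi a n l))"
  unfolding F_def using ell2_op_bessel[OF bessel_psi] by auto

lemma cadjoint_F_one: "cadjoint (F 1) (F 1 f) = f"
proof -
  have F: "bounded_clinear (F 1)" by (simp add: bounded_clinear_F)
  have "cadjoint (F 1) (F 1 (ell2_basis n)) = ell2_basis n" for n
    by (rule ell2_eqI) (simp add: cadjoint_ell2(3)[OF F] F_basis psi_one_orthonormal ell2_nth_basis eq_commute)
  moreover have "bounded_clinear (\<lambda>f::ell2. f)" by (rule bounded_clinearI[where K = 1]) auto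
  ultimately show ?thesis
    by (rule bounded_clinear_eq_on_basis[OF bounded_clinear_compose[OF cadjoint_ell2(2)[OF F] F], rotated])
qed

lemma psi_recurrence:
  assumes "a > 0"
  shows "l * psi a n l = (if n = 0 then 0 else if n = 1 then a / 2 else 1 / 2) * psi a (n - 1) l
      + (if n = 0 then a / 2 else 1 / 2) * psi a (n + 1) l"
proof -
  have "l * Ch a n l = (if n = 0 then 0 else if n = 1 then a / 2 else 1 / 2) * Ch a (n - 1) l
      + (if n = 0 then a / 2 else 1 / 2) * Ch a (n + 1) l"
    using assms by (induction a n l rule: Ch.induct) (simp_all add: field_simps)
  then have "x * (l * Ch a n l) = x * ((if n = 0 then 0 else if n = 1 then a / 2 else 1 / 2) * Ch a (n - 1) l
      + (if n = 0 then a / 2 else 1 / 2) * Ch a (n + 1) l)" for x by (simp only:)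
  from this[of "sqrt (2 / pi) * (a * root 4 (1 - l\<^sup>2) / sqrt (a ^ 4 - 4 * (a\<^sup>2 - 1) * l\<^sup>2))"]
  show ?thesis unfolding psi_def by (simp only: distrib_left mult_ac)
qed

lemma F_H:
  assumes a: "a > 0"
  shows "F a (H a f) = mult_op complex_of_real (F a f)"
proof (rule bounded_clinear_eq_on_basis[of "\<lambda>f. F a (H a f)" "\<lambda>f. mult_op complex_of_real (F a f)"])
  note F = bounded_clinear_F[OF a]
  show "bounded_clinear (\<lambda>f. F a (H a f))" by (rule bounded_clinear_compose[OF F bounded_clinear_H])
  show "bounded_clinear (\<lambda>f. mult_op complex_of_real (F a f))"
    by (rule bounded_clinear_compose[OF bounded_clinear_mult_op[OF bounded_symbol_id] F])
  fix n
  note sq = square_integrable_psi[OF a]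
  have "F a (H a (ell2_basis n)) = L2_class (\<lambda>l. complex_of_real (if n = 0 then 0 else if n = 1 then a / 2 else 1 / 2) *
        complex_of_real (psi a (n - 1) l)
      + complex_of_real (if n = 0 then a / 2 else 1 / 2) * complex_of_real (psi a (n + 1) l))"
    unfolding H_basis
    by (simp only: linear_add[OF bounded_linear.linear[OF bounded_clinear_linear[OF F]]]
        bounded_clinear_scaleC[OF F] F_basis[OF a] L2_class_scaleC[OF sq]
        L2_class_add[OF square_integrable_scaleC[OF sq] square_integrable_scaleC[OF sq]])
  also have "\<dots> = L2_class (\<lambda>l. complex_of_real l * complex_of_real (psi a n l))"
    by (simp only: of_real_mult[symmetric] of_real_add[symmetric] psi_recurrence[OF a])
  also have "\<dots> = mult_op complex_of_real (F a (ell2_basis n))"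
    by (simp only: F_basis[OF a] mult_op_class[OF bounded_symbol_id sq])
  finally show "F a (H a (ell2_basis n)) = mult_op complex_of_real (F a (ell2_basis n))" .
qed

lemma cadjoint_F_mult_op:
  assumes a: "a > 0"
  shows "cadjoint (F a) (mult_op complex_of_real g) = H a (cadjoint (F a) g)"
proof (rule cinner_eqI)
  fix x
  note adj = cadjoint_ell2(1)[OF bounded_clinear_F[OF a], symmetric]
  have "cinner x (cadjoint (F a) (mult_op complex_of_real g)) = cinner (mult_op complex_of_real (F a x)) g"
    by (simp add: adj cinner_mult_op[OF bounded_symbol_id])
  also have "\<dots> = cinner x (H a (cadjoint (F a) g))"
    by (simp only: F_H[OF a, symmetric] adj[symmetric] H_selfadjoint cadjoint_ell2(1)[OF bounded_clinear_F[OF a]])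
  finally show "cinner x (cadjoint (F a) (mult_op complex_of_real g)) = cinner x (H a (cadjoint (F a) g))" .
qed

section \<open>Exponentials of \<open>H 1\<close> and \<open>H a\<close> through the spectral
  representation\<close>

lemma op_exp_mult_op: "op_exp (\<lambda>g. c *\<^sub>C mult_op complex_of_real g) g = mult_op (\<lambda>l. exp (c * complex_of_real l)) g"
  using op_exp_sums[OF bounded_clinear_mult_op[OF bounded_symbol_id]] exp_term_mult_op_sums by (rule sums_unique2)

lemma op_exp_H_one: "op_exp (\<lambda>f. c *\<^sub>C H 1 f) f = cadjoint (F 1) (mult_op (\<lambda>l. exp (c * complex_of_real l)) (F 1 f))"
proof -
  have "exp_term (mult_op complex_of_real) c (F 1 f) sums F 1 (op_exp (\<lambda>f. c *\<^sub>C H 1 f) f)"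
    by (rule bounded_clinear_op_exp_sums) (simp_all add: bounded_clinear_H bounded_clinear_F F_H)
  then have "F 1 (op_exp (\<lambda>f. c *\<^sub>C H 1 f) f) = mult_op (\<lambda>l. exp (c * complex_of_real l)) (F 1 f)"
    using exp_term_mult_op_sums by (rule sums_unique2)
  then show ?thesis using cadjoint_F_one[of "op_exp (\<lambda>f. c *\<^sub>C H 1 f) f"] by simp
qed

text \<open>For general a the exponential is evaluated on the range of the adjoint of
  \<open>F a\<close>, by the adjoint form of the intertwining relation; the claimed limit takes its
  values there.\<close>

lemma op_exp_H_cadjoint:
  assumes a: "a > 0"
  shows "op_exp (\<lambda>f. c *\<^sub>C H a f) (cadjoint (F a) g) = cadjoint (F a) (mult_op (\<lambda>l. exp (c * complex_of_real l)) g)"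
proof -
  have "exp_term (H a) c (cadjoint (F a) g) sums cadjoint (F a) (op_exp (\<lambda>g. c *\<^sub>C mult_op complex_of_real g) g)"
    by (rule bounded_clinear_op_exp_sums)
       (simp_all add: bounded_clinear_mult_op[OF bounded_symbol_id] cadjoint_ell2(2) bounded_clinear_F a
         cadjoint_F_mult_op)
  then show ?thesis
    unfolding op_exp_mult_op by (rule sums_unique2[OF op_exp_sums[OF bounded_clinear_H]])
qed


section \<open>Asymptotics of the free evolution\<close>

lemma sigma_minus: "sigma (-1) a l = cnj (sigma 1 a l)"
  by (simp add: sigma_def)

text \<open>In the angle the numerator of the symbol is 1 + (1 - a^2) exp (- 2 i x), that is, the
  Jost function times exp (- i x).\<close>

lemma sigma_angle:
  assumes "x \<in> {0<..<pi}"
  shows "sigma 1 a (cos x) = jost_phase a x * exp (\<i> * complex_of_real (- x))"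
proof -
  have s: "sqrt (1 - (cos x)\<^sup>2) = sin x"
    using assms by (simp add: sin_squared_eq[symmetric] sin_ge_zero)
  have "complex_of_real (a\<^sup>2 + 2 * (1 - a\<^sup>2) * (cos x)\<^sup>2)
      + complex_of_real 1 * 2 * \<i> * complex_of_real ((a\<^sup>2 - 1) * cos x * sin x)
      = jost a x * exp (\<i> * complex_of_real (- x))"
  proof -
    have "a * a = a * (a * (cos x * cos x)) + a * (a * (sin x * sin x))"
      by (metis distrib_left mult_1_right sin_cos_squared_add3)
    then have "a * (a * (sin x * sin x)) = a * a - a * (a * (cos x * cos x))" by linarith
    then show ?thesis
      unfolding cis_conv_exp[symmetric] jost_def
      by (simp add: complex_eq_iff power2_eq_square algebra_simps)
  qed
  then show ?thesis by (simp only: sigma_def s cmod_jost[symmetric] jost_phase_def times_divide_eq_left)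
qed

lemma cmod_jost_phase:
  "a > 0 \<Longrightarrow> x \<in> {0<..<pi} \<Longrightarrow> cmod (jost_phase a x) = 1"
  using jost_nonzero by (simp add: jost_phase_def norm_divide)

lemma cmod_sigma:
  assumes "a > 0" "l \<in> {-1<..<1}" "s \<in> {1, -1}"
  shows "cmod (sigma s a l) = 1"
proof -
  obtain x where x: "x \<in> {0<..<pi}" "l = cos x" using assms(2) cos_image_open by blast
  have "cmod (sigma 1 a l) = 1"
    unfolding x(2) sigma_angle[OF x(1)] norm_mult norm_exp_i_times
    by (simp add: cmod_jost_phase[OF assms(1) x(1)])
  then show ?thesis using assms(3) by (auto simp: sigma_minus)
qed

lemma continuous_sigma: "a > 0 \<Longrightarrow> continuous_on {-1<..<1} (sigma s a)"
  unfolding sigma_def by (intro continuous_intros) (use denominator_pos in force)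

lemma bounded_symbol_sigma: "a > 0 \<Longrightarrow> s \<in> {1, -1} \<Longrightarrow> bounded_symbol (sigma s a) 1"
  by (rule bounded_symbol_continuous) (use continuous_sigma cmod_sigma in auto)

text \<open>For \<open>a\<^sup>2 = 2\<close> the Jost function vanishes at the endpoints, but then its phase is constant.\<close>

definition phase_square :: "real \<Rightarrow> real \<Rightarrow> complex" where
  "phase_square a x = (if a\<^sup>2 = 2 then - 1 else jost a x * inverse (cnj (jost a x)))"

lemma phase_square_eq:
  assumes "a > 0" "x \<in> {0<..<pi}"
  shows "phase_square a x = jost_phase a x * jost_phase a x"
proof -
  have nz: "jost a x \<noteq> 0" by (rule jost_nonzero[OF assms])
  have "complex_of_real (cmod (jost a x)) * complex_of_real (cmod (jost a x)) = cnj (jost a x) * jost a x"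
    by (simp only: cnj_mult_self power2_eq_square of_real_mult)
  then have w: "jost_phase a x * jost_phase a x = jost a x * inverse (cnj (jost a x))"
    using nz unfolding jost_phase_def times_divide_times_eq by (simp add: field_simps)
  show ?thesis
  proof (cases "a\<^sup>2 = 2")
    case True
    then have "cnj (jost a x) = - jost a x" by (simp add: jost_def)
    then show ?thesis using True nz w by (simp add: phase_square_def)
  next
    case False
    then show ?thesis by (simp only: w phase_square_def if_False)
  qed
qed

lemma bdd_C1_trig: "bdd_C1 (\<lambda>x. complex_of_real (c * cos x) + \<i> * complex_of_real (d * sin x))"
proof (rule bdd_C1I)
  fix x
  have "((\<lambda>x. c * cos x) has_real_derivative - c * sin x) (at x)"
    "((\<lambda>x. d * sin x) has_real_derivative d * cos x) (at x)"
    by (auto intro!: derivative_eq_intros)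
  then show "((\<lambda>x. complex_of_real (c * cos x) + \<i> * complex_of_real (d * sin x)) has_vector_derivative
      complex_of_real (- c * sin x) + \<i> * complex_of_real (d * cos x)) (at x)"
    by (intro has_vector_derivative_add has_vector_derivative_mult_right has_vector_derivative_of_real)
qed (intro continuous_intros)

text \<open>The quotient of the Jost function by its conjugate involves no modulus, so it is smooth
  wherever the Jost function has no zero; for a^2 \<noteq> 2 this is the whole closed
  interval.\<close>

lemma bdd_C1_phase_square:
  assumes "a > 0"
  shows "bdd_C1 (phase_square a)"
proof (cases "a\<^sup>2 = 2")
  case True
  then show ?thesis using bdd_C1_const[of "- 1"] by (simp add: phase_square_def[abs_def])
next
  case False
  have nz: "jost a x \<noteq> 0" for x
  proof
    assume "jost a x = 0"
    then have "Re (jost a x) = 0" "Im (jost a x) = 0" by simp_all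
    then have "cos x = 0" "sin x = 0" using False assms by (simp_all add: jost_def)
    then show False using sin_cos_squared_add[of x] by simp
  qed
  have "cnj (jost a x) = complex_of_real ((2 - a\<^sup>2) * cos x) + \<i> * complex_of_real (- (a\<^sup>2) * sin x)" for x
    by (simp add: jost_def)
  then have "bdd_C1 (\<lambda>x. cnj (jost a x))" by (simp only: bdd_C1_trig)
  moreover have "bdd_C1 (jost a)" unfolding jost_def[abs_def] by (rule bdd_C1_trig)
  ultimately have "bdd_C1 (\<lambda>x. jost a x * inverse (cnj (jost a x)))"
    using nz by (intro bdd_C1_mult bdd_C1_inverse) auto
  with False show ?thesis by (simp add: phase_square_def[abs_def])
qed

text \<open>Bracketed as exp (c l) with c = - i t, the shape in which the lemmas on
  \<open>op_exp\<close> produce it.\<close>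

definition free_phase :: "real \<Rightarrow> real \<Rightarrow> complex" where
  "free_phase t l = exp (- \<i> * complex_of_real t * complex_of_real l)"

lemma cmod_free_phase: "cmod (free_phase t l) = 1"
proof -
  have "free_phase t l = exp (\<i> * complex_of_real (- (t * l)))" by (simp add: free_phase_def mult.assoc)
  then show ?thesis by (simp only: norm_exp_i_times)
qed

lemma bounded_symbol_free_phase: "bounded_symbol (free_phase t) 1"
  by (rule bounded_symbol_continuous) (auto simp: cmod_free_phase, auto simp: free_phase_def intro!: continuous_intros)

text \<open>The difference of the two evolutions of the \<open>k\<close>-th basis vector, in coordinates.\<close>

definition wave_defect :: "real \<Rightarrow> real \<Rightarrow> nat \<Rightarrow> real \<Rightarrow> nat \<Rightarrow> complex" where
  "wave_defect s a k t n =
     (\<integral>l. free_phase t l * complex_of_real (psi 1 n l * psi 1 k l) \<partial>leb)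
     - (\<integral>l. free_phase t l * sigma s a l * complex_of_real (psi a n l * psi 1 k l) \<partial>leb)"

text \<open>The functions \<open>psi\<close> are real and the two symbols are conjugate, so complex
  conjugation amounts to time reversal. This reduces the limit at minus infinity to the one at plus
  infinity.\<close>

lemma wave_defect_minus: "wave_defect (- 1) a k t n = cnj (wave_defect 1 a k (- t) n)"
proof -
  have "cnj (free_phase (- t) l) = free_phase t l" for l
    by (simp add: free_phase_def exp_cnj)
  then show ?thesis
    unfolding wave_defect_def sigma_minus complex_cnj_diff Bochner_Integration.integral_cnj[symmetric] by simp
qed

text \<open>The choice of the sign in \<open>\<sigma>\<close> cancels the exponential \<open>exp (- i n x)\<close> in the difference of the
  eigenfunctions, so that only the nonstationary one is left.\<close>

lemma wave_defect_osc:
  assumes a: "a > 0"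
  shows "n > 0 \<Longrightarrow> wave_defect 1 a k t n = osc (real n) t (\<lambda>x. complex_of_real (sin (real (Suc k) * x)) *
      (1 / (complex_of_real pi * \<i>) * (exp (\<i> * complex_of_real (1 * x))
        - phase_square a x * exp (\<i> * complex_of_real (- 1 * x)))))"
    and "wave_defect 1 a k t 0 = osc 1 t (\<lambda>x. complex_of_real (sin (real (Suc k) * x)) *
      (1 / (complex_of_real pi * \<i>) * (exp (\<i> * complex_of_real (1 * x)) - exp (\<i> * complex_of_real (- 1 * x))
        - complex_of_real (1 / a) * ((phase_square a x - 1) * exp (\<i> * complex_of_real (- 1 * x))))
        * exp (\<i> * complex_of_real (- 1 * x))))"
proof -
  let ?F = "\<lambda>n x. free_phase t (cos x) * complex_of_real (phi 1 n x * phi 1 k x)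
      - free_phase t (cos x) * sigma 1 a (cos x) * complex_of_real (phi a n x * phi 1 k x)"
  have int: "(?F n has_integral wave_defect 1 a k t n) {0..pi}" for n
    unfolding wave_defect_def
  proof (intro has_integral_diff integral_psi_psi[where K = 1] a zero_less_one)
    show "continuous_on {-1<..<1} (free_phase t)"
      unfolding free_phase_def by (intro continuous_intros)
    then show "continuous_on {-1<..<1} (\<lambda>l. free_phase t l * sigma 1 a l)"
      by (intro continuous_intros continuous_sigma a)
  qed (simp_all add: norm_mult cmod_free_phase cmod_sigma a)
  have osc: "wave_defect 1 a k t n = osc m t h"
    if "\<And>x. x \<in> {0<..<pi} \<Longrightarrow> exp (\<i> * complex_of_real (m * x - t * cos x)) * h x = ?F n x" for n m h
  proof -
    have "((\<lambda>x. exp (\<i> * complex_of_real (m * x - t * cos x)) * h x) has_integral wave_defect 1 a k t n) (cbox 0 pi)"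
      by (rule has_integral_spike_interior[of "?F n"]) (use int that in \<open>simp_all add: box_real\<close>)
    then show ?thesis unfolding osc_def by (simp add: integral_unique)
  qed
  let ?C = "complex_of_real (sqrt (2 / pi))"
  have CC: "?C * ?C = 2 / complex_of_real pi"
    by (simp add: of_real_mult[symmetric] del: of_real_mult)
  have im: "complex_of_real (Im z) = (z - cnj z) / (2 * \<i>)" for z
    by (simp add: complex_eq_iff)
  have split: "exp (\<i> * complex_of_real (m * x - t * cos x)) = free_phase t (cos x) * exp (\<i> * complex_of_real (m * x))"
    for m x
    by (simp add: free_phase_def exp_add[symmetric] algebra_simps)
  \<comment> \<open>One factor w comes from \<open>phi a n\<close> and one from the symbol w exp (-
    i x): the term with \<open>E\<close> collects w^2, while in the term with \<open>E'\<close> the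
    two phases cancel. If the weight is 1, both copies of \<open>E' * e'\<close> disappear and
    \<open>E * (e - w^2 * e')\<close> is left.\<close>
  have key: "?F n x = free_phase t (cos x) * (complex_of_real (sin (real (Suc k) * x)) * (1 / (complex_of_real pi * \<i>)) *
      ((E * e - E' * e') - complex_of_real (jost_weight a n) * (phase_square a x * E - E') * e'))"
    if x: "x \<in> {0<..<pi}" and E: "E = exp (\<i> * complex_of_real (real n * x))" and E': "E' = cnj E"
      and e: "e = exp (\<i> * complex_of_real (1 * x))" and e': "e' = exp (\<i> * complex_of_real (- 1 * x))"
    for n x E E' e e'
  proof -
    let ?w = "jost_phase a x" and ?S = "complex_of_real (sin (real (Suc k) * x))"
    have w: "?w * cnj ?w = 1"
      using cmod_jost_phase[OF a x] by (metis cnj_mult_self mult.commute of_real_1 one_power2)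
    have "cnj e = e'" unfolding e e' cis_conv_exp[symmetric] by (simp add: cis_cnj)
    moreover have "E * e = exp (\<i> * complex_of_real (real (Suc n) * x))"
      unfolding E e exp_add[symmetric] by (simp add: algebra_simps)
    moreover have "Im (exp (\<i> * complex_of_real (real (Suc n) * x))) = sin (real (Suc n) * x)"
      unfolding cis_conv_exp[symmetric] by simp
    ultimately have one: "complex_of_real (phi 1 n x) = ?C * ((E * e - E' * e') / (2 * \<i>))"
      unfolding phi_one of_real_mult[of "sqrt (2 / pi)"] E' by (metis complex_cnj_mult im)
    have two: "complex_of_real (phi a n x) = ?C * complex_of_real (jost_weight a n) * ((E * ?w - E' * cnj ?w) / (2 * \<i>))"
      unfolding phi_def of_real_mult[of "sqrt (2 / pi) * jost_weight a n"] im E' E by simp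
    have "?F n x = free_phase t (cos x) * ((complex_of_real (phi 1 n x)
        - complex_of_real (phi a n x) * (?w * e')) * (?C * ?S))"
      unfolding sigma_angle[OF x] of_real_mult[of "phi 1 n x"] of_real_mult[of "phi a n x"] phi_one[of k] e'
      by (simp add: algebra_simps)
    also have "(complex_of_real (phi 1 n x) - complex_of_real (phi a n x) * (?w * e')) * (?C * ?S)
        = (?C * ?C) * ?S * ((E * e - E' * e')
          - complex_of_real (jost_weight a n) * ((?w * ?w) * E - E' * (?w * cnj ?w)) * e') / (2 * \<i>)"
      unfolding one two divide_inverse by (simp only: algebra_simps)
    also have "\<dots> = ?S * (1 / (complex_of_real pi * \<i>)) *
      ((E * e - E' * e') - complex_of_real (jost_weight a n) * (phase_square a x * E - E') * e')"
      unfolding CC w phase_square_eq[OF a x] by (simp add: field_simps)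
    finally show ?thesis .
  qed
  show "n > 0 \<Longrightarrow> wave_defect 1 a k t n = osc (real n) t (\<lambda>x. complex_of_real (sin (real (Suc k) * x)) *
      (1 / (complex_of_real pi * \<i>) * (exp (\<i> * complex_of_real (1 * x))
        - phase_square a x * exp (\<i> * complex_of_real (- 1 * x)))))"
    by (rule osc, subst key[OF _ refl refl refl refl], assumption, unfold split)
       (simp add: jost_weight_def algebra_simps)
  \<comment> \<open>With the weight 1 / a the constant terms do not cancel in general, and the
    frequency would be 0. The product of exp (i x) and exp (- i x) is inserted: the first raises the
    frequency to 1, the second joins the amplitude.\<close>
  show "wave_defect 1 a k t 0 = osc 1 t (\<lambda>x. complex_of_real (sin (real (Suc k) * x)) *
      (1 / (complex_of_real pi * \<i>) * (exp (\<i> * complex_of_real (1 * x)) - exp (\<i> * complex_of_real (- 1 * x))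
        - complex_of_real (1 / a) * ((phase_square a x - 1) * exp (\<i> * complex_of_real (- 1 * x))))
        * exp (\<i> * complex_of_real (- 1 * x))))"
  proof (rule osc, subst key[OF _ refl refl refl refl], assumption, unfold split)
    fix x
    have "exp (\<i> * complex_of_real (1 * x)) * exp (\<i> * complex_of_real (- 1 * x)) = 1"
      unfolding exp_add[symmetric] by simp
    then have "y * exp (\<i> * complex_of_real (1 * x)) * (u * (v * exp (\<i> * complex_of_real (- 1 * x)))) = y * (u * v)" for y u v
      by (metis mult.assoc mult.commute mult_1_right)
    then show "free_phase t (cos x) * exp (\<i> * complex_of_real (1 * x)) *
        (complex_of_real (sin (real (Suc k) * x)) * (1 / (complex_of_real pi * \<i>) *
        (exp (\<i> * complex_of_real (1 * x)) - exp (\<i> * complex_of_real (- 1 * x)) - complex_of_real (1 / a) *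
        ((phase_square a x - 1) * exp (\<i> * complex_of_real (- 1 * x)))) * exp (\<i> * complex_of_real (- 1 * x))))
      = free_phase t (cos x) * (complex_of_real (sin (real (Suc k) * x)) * (1 / (complex_of_real pi * \<i>)) *
        ((exp (\<i> * complex_of_real (real 0 * x)) * exp (\<i> * complex_of_real (1 * x))
        - cnj (exp (\<i> * complex_of_real (real 0 * x))) * exp (\<i> * complex_of_real (- 1 * x)))
        - complex_of_real (jost_weight a 0) * (phase_square a x * exp (\<i> * complex_of_real (real 0 * x))
        - cnj (exp (\<i> * complex_of_real (real 0 * x)))) * exp (\<i> * complex_of_real (- 1 * x))))"
      by (simp only:) (simp add: jost_weight_def mult_ac)
  qed
qed

lemma wave_defect_tendsto:
  assumes a: "a > 0"
  shows "((\<lambda>t. \<Sum>n. (cmod (wave_defect 1 a k t n))\<^sup>2) \<longlongrightarrow> 0) at_top"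
proof -
  note C1 = bdd_C1_mult bdd_C1_diff bdd_C1_const bdd_C1_exp bdd_C1_phase_square[OF a]
  obtain K where K: "K \<ge> 0" "\<And>n t. n > 0 \<Longrightarrow> t \<ge> 0 \<Longrightarrow> cmod (wave_defect 1 a k t n) \<le> K * osc_bound (real n) t"
  proof (rule osc_decay[of "\<lambda>x. 1 / (complex_of_real pi * \<i>) * (exp (\<i> * complex_of_real (1 * x))
        - phase_square a x * exp (\<i> * complex_of_real (- 1 * x)))" k])
    show "bdd_C1 (\<lambda>x. 1 / (complex_of_real pi * \<i>) * (exp (\<i> * complex_of_real (1 * x))
        - phase_square a x * exp (\<i> * complex_of_real (- 1 * x))))"
      by (intro C1)
  qed (use that wave_defect_osc(1)[OF a] in simp)
  obtain L where L: "L \<ge> 0" "\<And>t. t \<ge> 0 \<Longrightarrow> cmod (wave_defect 1 a k t 0) \<le> L * osc_bound 1 t"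
  proof (rule osc_decay[of "\<lambda>x. 1 / (complex_of_real pi * \<i>) * (exp (\<i> * complex_of_real (1 * x)) - exp (\<i> * complex_of_real (- 1 * x))
        - complex_of_real (1 / a) * ((phase_square a x - 1) * exp (\<i> * complex_of_real (- 1 * x))))
        * exp (\<i> * complex_of_real (- 1 * x))" k])
    show "bdd_C1 (\<lambda>x. 1 / (complex_of_real pi * \<i>) * (exp (\<i> * complex_of_real (1 * x)) - exp (\<i> * complex_of_real (- 1 * x))
        - complex_of_real (1 / a) * ((phase_square a x - 1) * exp (\<i> * complex_of_real (- 1 * x))))
        * exp (\<i> * complex_of_real (- 1 * x)))"
      by (intro C1)
  qed (use that wave_defect_osc(2)[OF a] in simp)
  have "((\<lambda>t. L * osc_bound 1 t) \<longlongrightarrow> 0) at_top"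
    using tendsto_mult_left[OF osc_bound_tendsto[of 1], of L] by simp
  moreover have "\<forall>\<^sub>F t in at_top. norm (wave_defect 1 a k t 0) \<le> L * osc_bound 1 t"
    by (rule eventually_mono[OF eventually_ge_at_top[of 0]]) (use L in auto)
  ultimately have "((\<lambda>t. wave_defect 1 a k t 0) \<longlongrightarrow> 0) at_top" by (rule Lim_null_comparison[rotated])
  with K show ?thesis by (intro osc_square_sum_tendsto[where K = K]) auto
qed

section \<open>The wave operators\<close>

lemma op_exp_diff:
  fixes A :: "'a::{complex_inner,banach} \<Rightarrow> 'a"
  assumes A: "bounded_clinear A"
  shows "op_exp (\<lambda>f. c *\<^sub>C A f) (x - y) = op_exp (\<lambda>f. c *\<^sub>C A f) x - op_exp (\<lambda>f. c *\<^sub>C A f) y"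
proof -
  have "(A ^^ k) (x - y) = (A ^^ k) x - (A ^^ k) y" for k
    by (induction k) (simp_all add: linear_diff[OF bounded_linear.linear[OF bounded_clinear_linear[OF A]]])
  then have "exp_term A c (x - y) k = exp_term A c x k - exp_term A c y k" for k
    by (simp add: exp_term_def scaleC_diff_right)
  then have "exp_term A c (x - y) = (\<lambda>k. exp_term A c x k - exp_term A c y k)" by (rule ext)
  then have "exp_term A c (x - y) sums (op_exp (\<lambda>f. c *\<^sub>C A f) x - op_exp (\<lambda>f. c *\<^sub>C A f) y)"
    using sums_diff[OF op_exp_sums[OF A, of c x] op_exp_sums[OF A, of c y]] by (simp only:)
  then show ?thesis by (rule sums_unique2[OF op_exp_sums[OF A]])
qed

lemma tendsto_zero_of_basis:
  fixes A :: "'t \<Rightarrow> ell2 \<Rightarrow> 'a::complex_inner"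
  assumes A: "\<And>t. bounded_clinear (A t)" and C: "C \<ge> 0" "\<And>t f. norm (A t f) \<le> C * norm f"
    and basis: "\<And>n. ((\<lambda>t. A t (ell2_basis n)) \<longlongrightarrow> 0) G"
  shows "((\<lambda>t. A t f) \<longlongrightarrow> 0) G"
proof (rule tendstoI)
  fix e :: real assume e: "e > 0"
  let ?S = "\<lambda>N. \<Sum>n<N. ell2_nth f n *\<^sub>C ell2_basis n"
  have "?S \<longlonglongrightarrow> f" using ell2_expansion[of f] by (simp add: sums_def)
  \<comment> \<open>Again C + 1, since C may be 0.\<close>
  moreover have "e / (2 * (C + 1)) > 0" using e C by simp
  ultimately obtain N where "norm (?S N - f) < e / (2 * (C + 1))"
    using LIMSEQ_D by blast
  then have N: "(C + 1) * norm (f - ?S N) < e / 2"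
    using C by (simp add: norm_minus_commute field_simps)
  have "((\<lambda>t. \<Sum>n<N. ell2_nth f n *\<^sub>C A t (ell2_basis n)) \<longlongrightarrow> (\<Sum>n<N. 0)) G"
    by (intro tendsto_sum bounded_linear.tendsto_zero[OF bounded_linear_scaleC_right] basis)
  then have "((\<lambda>t. \<Sum>n<N. ell2_nth f n *\<^sub>C A t (ell2_basis n)) \<longlongrightarrow> 0) G" by simp
  from order_tendstoD(2)[OF tendsto_norm_zero[OF this], of "e / 2"]
  have "\<forall>\<^sub>F t in G. norm (\<Sum>n<N. ell2_nth f n *\<^sub>C A t (ell2_basis n)) < e / 2"
    using e by simp
  then show "\<forall>\<^sub>F t in G. dist (A t f) 0 < e"
  proof eventually_elim
    case (elim t)
    note lin = bounded_linear.linear[OF bounded_clinear_linear[OF A[of t]]]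
    have "A t f = A t (f - ?S N) + (\<Sum>n<N. ell2_nth f n *\<^sub>C A t (ell2_basis n))"
      by (simp add: linear_diff[OF lin] linear_sum[OF lin] bounded_clinear_scaleC[OF A])
    then have "norm (A t f) \<le> norm (A t (f - ?S N)) + norm (\<Sum>n<N. ell2_nth f n *\<^sub>C A t (ell2_basis n))"
      by (metis norm_triangle_ineq)
    also have "norm (A t (f - ?S N)) \<le> (C + 1) * norm (f - ?S N)"
      using C(2)[of t "f - ?S N"] by (simp add: distrib_right add_increasing2)
    finally show ?case using N elim by (simp add: dist_norm)
  qed
qed

text \<open>The difference of \<open>exp (- i H_1 t) f\<close> and \<open>exp (- i H_a t) W f\<close>, where \<open>W\<close> is the claimed limit.\<close>

definition evolution_defect :: "real \<Rightarrow> real \<Rightarrow> real \<Rightarrow> ell2 \<Rightarrow> ell2" where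
  "evolution_defect s a t f = cadjoint (F 1) (mult_op (free_phase t) (F 1 f))
     - cadjoint (F a) (mult_op (free_phase t) (mult_op (sigma s a) (F 1 f)))"

lemma evolution_defect_basis:
  assumes a: "a > 0" and s: "s \<in> {1, -1}"
  shows "ell2_nth (evolution_defect s a t (ell2_basis k)) n = wave_defect s a k t n"
proof -
  note sq = square_integrable_psi[OF a] square_integrable_psi[OF zero_less_one]
  note b = bounded_symbol_free_phase[of t] bounded_symbol_sigma[OF a s]
  note sq' = square_integrable_mult[OF b(2) sq(2)]
  show ?thesis
    unfolding evolution_defect_def wave_defect_def ell2_nth_diff
    by (simp only: cadjoint_ell2(3) bounded_clinear_F zero_less_one a F_basis
        mult_op_class[OF b(1) sq(2)] mult_op_class[OF b(2) sq(2)] mult_op_class[OF b(1) sq']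
        cinner_L2_class[OF sq(2) square_integrable_mult[OF b(1) sq(2)]]
        cinner_L2_class[OF sq(1) square_integrable_mult[OF b(1) sq']] complex_cnj_complex_of_real)
       (simp add: mult_ac)
qed

lemma norm_evolution_defect_basis:
  assumes "a > 0" "s \<in> {1, -1}"
  shows "(norm (evolution_defect s a t (ell2_basis k)))\<^sup>2 = (\<Sum>n. (cmod (wave_defect s a k t n))\<^sup>2)"
  using ell2_norm_sums[of "evolution_defect s a t (ell2_basis k)"]
  by (simp add: evolution_defect_basis[OF assms] sums_iff)

text \<open>Time enters as \<open>s * t\<close>, so both signs are limits at plus infinity.
  Coordinates for s = -1 are conjugates of those for s = 1, and the norm on basis vectors is the
  same; a bound uniform in t extends convergence to all vectors.\<close>

lemma evolution_defect_tendsto: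
  assumes a: "a > 0" and s: "s \<in> {1, -1}"
  shows "((\<lambda>t. evolution_defect s a (s * t) f) \<longlongrightarrow> 0) at_top"
proof -
  have F1: "bounded_clinear (F 1)" and Fa: "bounded_clinear (F a)" by (simp_all add: bounded_clinear_F a)
  obtain K where K: "K > 0" "\<And>f. norm (F 1 f) \<le> K * norm f" using bounded_clinear_norm_le[OF F1] by blast
  obtain L where L: "L > 0" "\<And>f. norm (cadjoint (F 1) f) \<le> L * norm f"
    using bounded_clinear_norm_le[OF cadjoint_ell2(2)[OF F1]] by blast
  obtain M where M: "M > 0" "\<And>f. norm (cadjoint (F a) f) \<le> M * norm f"
    using bounded_clinear_norm_le[OF cadjoint_ell2(2)[OF Fa]] by blast
  note b = bounded_symbol_free_phase bounded_symbol_sigma[OF a s]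
  have le: "norm (mult_op (free_phase t) g) \<le> norm g" "norm (mult_op (sigma s a) g) \<le> norm g" for t g
    using norm_mult_op_le[OF b(1), of t g] norm_mult_op_le[OF b(2), of g] by simp_all
  have bd: "norm (evolution_defect s a t f) \<le> (L * K + M * K) * norm f" for t f
  proof -
    have "norm (evolution_defect s a t f) \<le> norm (cadjoint (F 1) (mult_op (free_phase t) (F 1 f)))
        + norm (cadjoint (F a) (mult_op (free_phase t) (mult_op (sigma s a) (F 1 f))))"
      unfolding evolution_defect_def by (rule norm_triangle_ineq4)
    also have "\<dots> \<le> L * (K * norm f) + M * (K * norm f)"
      using K L M
      by (intro add_mono order.trans[OF L(2)] order.trans[OF M(2)] mult_left_mono
          order.trans[OF le(1)] order.trans[OF le(2)]) (auto intro: order.trans[OF le(2)])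
    finally show ?thesis by (simp add: algebra_simps)
  qed
  have clin: "bounded_clinear (evolution_defect s a t)" for t
    unfolding evolution_defect_def[abs_def]
    by (rule bounded_clinear_diff)
       (rule bounded_clinear_compose[OF cadjoint_ell2(2)[OF F1]] bounded_clinear_compose[OF cadjoint_ell2(2)[OF Fa]]
          bounded_clinear_compose[OF bounded_clinear_mult_op[OF b(1)]]
          bounded_clinear_compose[OF bounded_clinear_mult_op[OF b(2)]] F1)+
  have "((\<lambda>t. evolution_defect s a (s * t) (ell2_basis k)) \<longlongrightarrow> 0) at_top" for k
  proof -
    have "cmod (wave_defect s a k (s * t) n) = cmod (wave_defect 1 a k t n)" for t n
      using s by (auto simp: wave_defect_minus)
    then have "norm (evolution_defect s a (s * t) (ell2_basis k))
        = sqrt (\<Sum>n. (cmod (wave_defect 1 a k t n))\<^sup>2)" for t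
      using norm_evolution_defect_basis[OF a s, of "s * t" k] by (simp add: real_sqrt_unique)
    then have "((\<lambda>t. norm (evolution_defect s a (s * t) (ell2_basis k))) \<longlongrightarrow> 0) at_top"
      using tendsto_real_sqrt[OF wave_defect_tendsto[OF a, of k]] by simp
    then show ?thesis by (rule tendsto_norm_zero_cancel)
  qed
  moreover have "0 \<le> L * K + M * K" using K(1) L(1) M(1) by simp
  ultimately show ?thesis
    using bd
    by (rule tendsto_zero_of_basis[of "\<lambda>t. evolution_defect s a (s * t)" "L * K + M * K", OF clin, rotated 2])
qed

text \<open>exp (i t H_a) undoes the free phase under the adjoint of \<open>F a\<close>, so the
  left-hand difference is exp (i t H_a) applied to the defect, and this exponential preserves
  norms.\<close>

lemma wave_family_defect:
  assumes a: "a > 0" and s: "s \<in> {1, -1}"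
  shows "norm (wave_family (H a) (H 1) t f - cadjoint (F a) (mult_op (sigma s a) (F 1 f)))
    = norm (evolution_defect s a t f)"
proof -
  let ?U = "op_exp (\<lambda>f. (\<i> * complex_of_real t) *\<^sub>C H a f)"
  let ?g = "mult_op (sigma s a) (F 1 f)"
  have e: "bounded_symbol (\<lambda>l. exp (\<i> * complex_of_real t * complex_of_real l)) (exp (cmod (\<i> * complex_of_real t)))"
    by (rule bounded_symbol_exp)
  have "mult_op (\<lambda>l. exp (\<i> * complex_of_real t * complex_of_real l)) (mult_op (free_phase t) ?g) = mult_op (\<lambda>_. 1) ?g"
    unfolding mult_op_mult_op[OF e bounded_symbol_free_phase]
    by (rule mult_op_cong[OF bounded_symbol_mult[OF e bounded_symbol_free_phase], of _ 1])
       (simp_all add: bounded_symbol_def free_phase_def exp_add[symmetric])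
  then have "?U (cadjoint (F a) (mult_op (free_phase t) ?g)) = cadjoint (F a) ?g"
    by (simp add: op_exp_H_cadjoint[OF a] mult_op_one)
  then have "wave_family (H a) (H 1) t f - cadjoint (F a) ?g = ?U (evolution_defect s a t f)"
    unfolding evolution_defect_def op_exp_diff[OF bounded_clinear_H]
    by (simp add: wave_family_def op_exp_H_one free_phase_def[abs_def])
  then show ?thesis
    by (simp add: norm_op_exp_selfadjoint[OF bounded_clinear_H H_selfadjoint])
qed

lemma wave_limit:
  assumes a: "a > 0" and s: "s \<in> {1, -1}"
  shows "has_strong_limit (\<lambda>t. wave_family (H a) (H 1) (s * t)) (cadjoint (F a) \<circ> mult_op (sigma s a) \<circ> F 1) at_top"
  unfolding has_strong_limit_def
proof (intro conjI allI)
  have F: "bounded_clinear (F 1)" "bounded_clinear (F a)" by (simp_all add: bounded_clinear_F a)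
  show "bounded_clinear (cadjoint (F a) \<circ> mult_op (sigma s a) \<circ> F 1)"
    unfolding o_def
    by (rule bounded_clinear_compose[OF cadjoint_ell2(2)[OF F(2)] bounded_clinear_compose[OF
            bounded_clinear_mult_op[OF bounded_symbol_sigma[OF a s]] F(1)]])
  fix f
  have "((\<lambda>t. norm (wave_family (H a) (H 1) (s * t) f - cadjoint (F a) (mult_op (sigma s a) (F 1 f)))) \<longlongrightarrow> 0) at_top"
    unfolding wave_family_defect[OF a s] using evolution_defect_tendsto[OF a s] by (rule tendsto_norm_zero)
  then show "((\<lambda>t. wave_family (H a) (H 1) (s * t) f) \<longlongrightarrow> (cadjoint (F a) \<circ> mult_op (sigma s a) \<circ> F 1) f) at_top"
    unfolding o_def by (rule LIM_zero_cancel[OF tendsto_norm_zero_cancel])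
qed

theorem proposition4p6:
  fixes a :: real
  assumes "a > 0"
  shows "(\<exists>W. has_strong_limit (wave_family (H a) (H 1)) W at_top)
       \<and> (\<exists>W. has_strong_limit (wave_family (H a) (H 1)) W at_bot)
       \<and> unitary (Sigma_plus a) \<and> unitary (Sigma_minus a)
       \<and> wave_plus (H a) (H 1) = cadjoint (F a) \<circ> Sigma_plus a \<circ> F 1
       \<and> wave_minus (H a) (H 1) = cadjoint (F a) \<circ> Sigma_minus a \<circ> F 1"
proof -
  have plus: "has_strong_limit (wave_family (H a) (H 1)) (cadjoint (F a) \<circ> Sigma_plus a \<circ> F 1) at_top"
    using wave_limit[OF assms, of 1] by (simp add: Sigma_plus_def)
  have minus: "has_strong_limit (wave_family (H a) (H 1)) (cadjoint (F a) \<circ> Sigma_minus a \<circ> F 1) at_bot"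
    using wave_limit[OF assms, of "- 1"] unfolding has_strong_limit_def Sigma_minus_def
    by (simp add: filterlim_at_bot_mirror)
  have "unitary (mult_op (sigma s a))" if "s \<in> {1, -1}" for s
    using bounded_symbol_sigma[OF assms that] cmod_sigma[OF assms _ that]
    by (intro unitary_mult_op) (auto simp: bounded_symbol_def)
  then have "unitary (Sigma_plus a)" "unitary (Sigma_minus a)"
    by (simp_all add: Sigma_plus_def Sigma_minus_def)
  with plus minus strong_limit_eqI[OF plus] strong_limit_eqI[OF minus] show ?thesis
    unfolding wave_plus_def wave_minus_def by auto
qed

end
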